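(* Consider a homogeneous open quantum random walk with finite-dimensional local space $\mathfrak h$, local channel $\mathfrak L$ and initial state $\rho$, and let $\hat{\mathbb P}_{\rho,n}$ be the law of $\frac{X_n-X_0}{n}$ under $\mathbb P_\rho$. Let $\mathcal R=\bigoplus_{\alpha\in A}\chi_\alpha=\bigoplus_{\alpha\in A}\bigoplus_{\beta\in I_\alpha}\mathcal V_{\alpha,\beta}$ be a decomposition of the fast recurrent space into minimal enclosures refining the canonical decomposition, and let $a_{\alpha,\beta}(\rho)=\sum_{\underline k\in V}\mathrm{Tr}(A(\mathcal V_{\alpha,\beta})\rho(\underline k))$. For any measurable $B\in\mathcal B(\mathbb R^d)$: - $\displaystyle\limsup_{n\to+\infty}\frac1n\log(\hat{\mathbb P}_{\rho,n}(B))\le-\inf_{x\in\overline B}\ \min_{\alpha,\beta\,:\,a_{\alpha,\beta}(\rho)\neq0}\Lambda^\rho_{\alpha,\beta}(x)$; - $\displaystyle\liminf_{n\to+\infty}\frac1n\log(\hat{\mathbb P}_{\rho,n}(B))\ge-\min_{\alpha,\beta\,:\,a_{\alpha,\beta}(\rho)\neq0}\ \inf_{x\in\mathring B\cap\mathcal S_{\alpha,\beta}}\Lambda^\rho_{\alpha,\beta}(x)$, where - $\lambda^\rho_{\alpha,\beta,u}=r(\mathfrak L_{|\mathcal Q^\rho_{\alpha,\beta},u})$ is the spectral radius of the deformed compression of $\mathfrak L$ to $\mathcal Q^\rho_{\alpha,\beta}:=\tilde p_{\mathcal V_{\alpha,\beta}}\mathcal E(\rho)$; - $\Lambda^\rho_{\alpha,\beta}(x)=\sup_{u\in\mathbb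 R^d}\{\langle u,x\rangle-\log(\lambda^\rho_{\alpha,\beta,u})\}$ is the Fenchel–Legendre transform of $\log(\lambda^\rho_{\alpha,\beta,u})$; - $\mathcal S_{\alpha,\beta}=\mathbb R^d$ if $u\mapsto\lambda^\rho_{\alpha,\beta,u}$ is smooth, and otherwise $\mathcal S_{\alpha,\beta}$ is the set of exposed points of $\Lambda^\rho_{\alpha,\beta}$.
   Context: **Walk.** $V\subset\mathbb R^d$ is a locally finite lattice containing $0$, positively generated by a finite set $S=\{s_1,\dots,s_v\}\neq\{0\}$. $\mathfrak h$ is a finite-dimensional complex Hilbert space, $B(\mathfrak h)$ its bounded operators, $L^1(\mathfrak h)$ its trace-class operators. $L_1,\dots,L_v\in B(\mathfrak h)$ satisfy $\sum_i L_i^*L_i=1_{\mathfrak h}$. The local channel is $\mathfrak L(\sigma)=\sum_{i=1}^v L_i\sigma L_i^*$ on $L^1(\mathfrak h)$, with dual $\mathfrak L^*(x)=\sum_i L_i^*xL_i$ on $B(\mathfrak h)$. The initial state is $\rho=\sum_{\underline k\in V}\rho(\underline k)\otimes|\underline k\rangle\langle\underline k|$ with $\rho(\underline k)\ge 0$ in $L^1(\mathfrak h)$ and $\sum_{\underline k}\mathrm{Tr}\,\rho(\underline k)=1$. **Position process.** Let $J=\{1,\dots,v\}$, $\Omega=V\times J^{\mathbb N}$ with the $\sigma$-algebra $\mathcal F$ generated by cylinder sets. $\mathbb P_\rho$ is the unique probability on $(\Omega,\mathcal F)$ with $\mathbb P_\rho(\{\underline k\}\times J^{\mathbb N})=\mathrm{Tr}\,\rho(\underline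 k)$ and $\mathbb P_\rho(\{(\underline k,j_1,\dots,j_n)\}\times J^{\mathbb N})=\mathrm{Tr}(L_{j_n}\cdots L_{j_1}\rho(\underline k)L_{j_1}^*\cdots L_{j_n}^* )$. For $\omega=(\underline k,j_1,j_2,\dots)$: $X_0=\underline k$, $X_{n+1}=X_n+s_{j_{n+1}}$. **Enclosures.** A subspace $\mathcal V\subset\mathfrak h$ is an enclosure for $\mathfrak L$ if for every positive $\omega\in L^1(\mathfrak h)$, $\mathrm{supp}(\omega)\subset\mathcal V$ implies $\mathrm{supp}(\mathfrak L(\omega))\subset\mathcal V$ (support of a positive operator $=\ker^\perp$). A minimal enclosure is a nonzero enclosure containing no enclosures other than $\{0\}$ and itself. With $p_{\mathcal V}$ the orthogonal projection onto $\mathcal V$, the absorption operator is $A(\mathcal V)=\lim_{n\to\infty}\mathfrak L^{*n}(p_{\mathcal V})$, and $\tilde p_{\mathcal V}$ is the orthogonal projection onto $\mathrm{supp}(A(\mathcal V))$. **Decomposition.** The fast recurrent space $\mathcal R$ is the supremum (span) of the supports of all invariant states of $\mathfrak L$. There is a unique decomposition $\mathcal R=\bigoplus_{\alpha\in A}\chi_\alpha$ into finitely many mutually orthogonal nonzero enclosures, each minimal among nonzero enclosures $\chi$ with the property: every minimal enclosure $\mathcal W$ satisfies $\mathcal W\perp\chi$ or $\mathcal W\subset\chi$. Each $\chi_\alpha$ is further decomposed (in general non-uniquely; a decomposition is fixed) as $\chi_\alpha=\bigoplus_{\beta\in I_\alpha}\mathcal V_{\alpha,\beta}$ with finitely many mutually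 orthogonal minimal enclosures $\mathcal V_{\alpha,\beta}$. **Reachable space and deformation.** $\mathcal E(\rho)=\mathrm{span}\{\mathrm{supp}(\mathfrak L^n(\rho(\underline k))):\underline k\in V,\ n\ge0\}\subset\mathfrak h$. For a subspace $\mathcal Q\subset\mathfrak h$ with orthogonal projection $p_{\mathcal Q}$ and $u\in\mathbb R^d$, $\mathfrak L_{|\mathcal Q,u}(\sigma)=\sum_{i=1}^v e^{u\cdot s_i}\,p_{\mathcal Q}L_ip_{\mathcal Q}\,\sigma\,p_{\mathcal Q}L_i^*p_{\mathcal Q}$ on $L^1(\mathcal Q)$; $r(\cdot)$ denotes spectral radius. **Conventions.** $\mathring B,\overline B$ are interior and closure of $B$; $\inf\emptyset=+\infty$, $\log0=-\infty$; smooth means infinitely differentiable. A point $y\in\mathbb R^d$ is an exposed point of $\Lambda$ if there is $\eta\in\mathbb R^d$ such that $\langle\eta,y\rangle-\Lambda(y)>\langle\eta,x\rangle-\Lambda(x)$ for all $x\neq y$. *)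

theory Defs
  imports "HOL-Probability.Probability"
begin

text \<open>The finite-dimensional complex Hilbert space is modelled by \<open>complex ^ 'n\<close> with its
  standard Hermitian inner product; both the bounded and the trace-class operators are
  the matrices \<open>complex ^ 'n ^ 'n\<close>.  Subspaces are complex subspaces (\<open>vec.subspace\<close>), and
  \<open>vec.span\<close> is the complex linear span.  The library operation \<open>\<bullet>\<close> on \<open>complex ^ 'n\<close> is the
  real part of \<open>cinner\<close> and is not used on that space.\<close>

definition cinner :: "complex ^ 'n \<Rightarrow> complex ^ 'n \<Rightarrow> complex" where
  "cinner x y = (\<Sum>i\<in>UNIV. cnj (x $ i) * y $ i)"

definition cadj :: "complex ^ 'n ^ 'n \<Rightarrow> complex ^ 'n ^ 'n" where
  "cadj A = map_matrix cnj (transpose A)"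

definition psd :: "complex ^ 'n ^ 'n \<Rightarrow> bool" where
  "psd A \<longleftrightarrow> (\<forall>x. cinner x (A *v x) \<in> \<real>\<^sub>\<ge>\<^sub>0)"

definition orth :: "(complex ^ 'n) set \<Rightarrow> (complex ^ 'n) set \<Rightarrow> bool" where
  "orth U W \<longleftrightarrow> (\<forall>x\<in>U. \<forall>y\<in>W. cinner x y = 0)"

definition supp :: "complex ^ 'n ^ 'n \<Rightarrow> (complex ^ 'n) set" where
  "supp A = {y. \<forall>x. A *v x = 0 \<longrightarrow> cinner x y = 0}"

definition orth_proj :: "(complex ^ 'n) set \<Rightarrow> complex ^ 'n ^ 'n" where
  "orth_proj U = (THE P. P ** P = P \<and> cadj P = P \<and> range ((*v) P) = U)"


definition channel :: "nat \<Rightarrow> (nat \<Rightarrow> complex ^ 'n ^ 'n) \<Rightarrow> complex ^ 'n ^ 'n \<Rightarrow> complex ^ 'n ^ 'n" where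
  "channel v L \<sigma> = (\<Sum>i=1..v. L i ** \<sigma> ** cadj (L i))"

definition dual_channel :: "nat \<Rightarrow> (nat \<Rightarrow> complex ^ 'n ^ 'n) \<Rightarrow> complex ^ 'n ^ 'n \<Rightarrow> complex ^ 'n ^ 'n" where
  "dual_channel v L x = (\<Sum>i=1..v. cadj (L i) ** x ** L i)"


definition locally_finite_lattice :: "(real ^ 'd) set \<Rightarrow> bool" where
  "locally_finite_lattice V \<longleftrightarrow>
     0 \<in> V \<and> (\<forall>x\<in>V. \<forall>y\<in>V. x - y \<in> V) \<and> (\<forall>R. finite (V \<inter> cball 0 R))"

definition positively_generated :: "(real ^ 'd) set \<Rightarrow> nat \<Rightarrow> (nat \<Rightarrow> real ^ 'd) \<Rightarrow> bool" where
  "positively_generated V v s \<longleftrightarrow>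
     V = {(\<Sum>i=1..v. real (m i) *\<^sub>R s i) | m :: nat \<Rightarrow> nat. True}"

definition homogeneous_oqrw ::
  "(real ^ 'd) set \<Rightarrow> nat \<Rightarrow> (nat \<Rightarrow> real ^ 'd) \<Rightarrow> (nat \<Rightarrow> complex ^ 'n ^ 'n) \<Rightarrow> bool" where
  "homogeneous_oqrw V v s L \<longleftrightarrow>
     locally_finite_lattice V \<and> positively_generated V v s \<and> s ` {1..v} \<noteq> {0} \<and>
     (\<Sum>i=1..v. cadj (L i) ** L i) = mat 1"

text \<open>\<open>\<rho> k\<close> is the block of the initial state at the site \<open>k\<close>; values outside \<open>V\<close> are
  irrelevant.\<close>

definition initial_state :: "(real ^ 'd) set \<Rightarrow> (real ^ 'd \<Rightarrow> complex ^ 'n ^ 'n) \<Rightarrow> bool" where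
  "initial_state V \<rho> \<longleftrightarrow> (\<forall>k\<in>V. psd (\<rho> k)) \<and> ((\<lambda>k. trace (\<rho> k)) has_sum 1) V"


text \<open>A trajectory is a pair \<open>(k, f)\<close>, where \<open>f n\<close> is the jump index \<open>j\<^bsub>n+1\<^esub>\<close>.\<close>

definition traj :: "(real ^ 'd) set \<Rightarrow> nat \<Rightarrow> ((real ^ 'd) \<times> (nat \<Rightarrow> nat)) set" where
  "traj V v = V \<times> (UNIV \<rightarrow> {1..v})"

definition cyl :: "nat \<Rightarrow> real ^ 'd \<Rightarrow> nat list \<Rightarrow> ((real ^ 'd) \<times> (nat \<Rightarrow> nat)) set" where
  "cyl v k js = {k} \<times> {f \<in> UNIV \<rightarrow> {1..v}. \<forall>i<length js. f i = js ! i}"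

text \<open>\<open>kraus_word L [j\<^sub>1, \<dots>, j\<^sub>n]\<close> is the product \<open>L j\<^sub>n ** \<dots> ** L j\<^sub>1\<close>.\<close>

definition kraus_word :: "(nat \<Rightarrow> complex ^ 'n ^ 'n) \<Rightarrow> nat list \<Rightarrow> complex ^ 'n ^ 'n" where
  "kraus_word L js = foldl (\<lambda>M j. L j ** M) (mat 1) js"

text \<open>The empty word covers the prescribed probabilities of the initial position.\<close>

definition trajectory_law ::
  "(real ^ 'd) set \<Rightarrow> nat \<Rightarrow> (nat \<Rightarrow> complex ^ 'n ^ 'n) \<Rightarrow> (real ^ 'd \<Rightarrow> complex ^ 'n ^ 'n)
    \<Rightarrow> ((real ^ 'd) \<times> (nat \<Rightarrow> nat)) measure \<Rightarrow> bool" where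
  "trajectory_law V v L \<rho> P \<longleftrightarrow>
     prob_space P \<and>
     space P = traj V v \<and>
     sets P = sigma_sets (traj V v) {cyl v k js | k js. k \<in> V \<and> set js \<subseteq> {1..v}} \<and>
     (\<forall>k\<in>V. \<forall>js. set js \<subseteq> {1..v} \<longrightarrow>
        complex_of_real (measure P (cyl v k js)) =
          trace (kraus_word L js ** \<rho> k ** cadj (kraus_word L js)))"

primrec pos :: "(nat \<Rightarrow> real ^ 'd) \<Rightarrow> nat \<Rightarrow> (real ^ 'd) \<times> (nat \<Rightarrow> nat) \<Rightarrow> real ^ 'd" where
  "pos s 0 \<omega> = fst \<omega>"
| "pos s (Suc n) \<omega> = pos s n \<omega> + s (snd \<omega> n)"

definition mean_law ::
  "(nat \<Rightarrow> real ^ 'd) \<Rightarrow> ((real ^ 'd) \<times> (nat \<Rightarrow> nat)) measure \<Rightarrow> nat \<Rightarrow> (real ^ 'd) measure" where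
  "mean_law s P n = distr P borel (\<lambda>\<omega>. (pos s n \<omega> - pos s 0 \<omega>) /\<^sub>R real n)"


definition enclosure :: "nat \<Rightarrow> (nat \<Rightarrow> complex ^ 'n ^ 'n) \<Rightarrow> (complex ^ 'n) set \<Rightarrow> bool" where
  "enclosure v L U \<longleftrightarrow>
     vec.subspace U \<and> (\<forall>\<omega>. psd \<omega> \<and> supp \<omega> \<subseteq> U \<longrightarrow> supp (channel v L \<omega>) \<subseteq> U)"

definition minimal_enclosure :: "nat \<Rightarrow> (nat \<Rightarrow> complex ^ 'n ^ 'n) \<Rightarrow> (complex ^ 'n) set \<Rightarrow> bool" where
  "minimal_enclosure v L U \<longleftrightarrow>
     enclosure v L U \<and> U \<noteq> {0} \<and> (\<forall>W. enclosure v L W \<and> W \<subseteq> U \<longrightarrow> W = {0} \<or> W = U)"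

definition absorption :: "nat \<Rightarrow> (nat \<Rightarrow> complex ^ 'n ^ 'n) \<Rightarrow> (complex ^ 'n) set \<Rightarrow> complex ^ 'n ^ 'n" where
  "absorption v L U = lim (\<lambda>n. (dual_channel v L ^^ n) (orth_proj U))"

definition absorption_proj :: "nat \<Rightarrow> (nat \<Rightarrow> complex ^ 'n ^ 'n) \<Rightarrow> (complex ^ 'n) set \<Rightarrow> complex ^ 'n ^ 'n" where
  "absorption_proj v L U = orth_proj (supp (absorption v L U))"

definition fast_recurrent :: "nat \<Rightarrow> (nat \<Rightarrow> complex ^ 'n ^ 'n) \<Rightarrow> (complex ^ 'n) set" where
  "fast_recurrent v L =
     vec.span (\<Union>{supp \<sigma> | \<sigma>. psd \<sigma> \<and> trace \<sigma> = 1 \<and> channel v L \<sigma> = \<sigma>})"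

definition separating_enclosure :: "nat \<Rightarrow> (nat \<Rightarrow> complex ^ 'n ^ 'n) \<Rightarrow> (complex ^ 'n) set \<Rightarrow> bool" where
  "separating_enclosure v L X \<longleftrightarrow>
     enclosure v L X \<and> X \<noteq> {0} \<and> (\<forall>W. minimal_enclosure v L W \<longrightarrow> orth W X \<or> W \<subseteq> X)"

definition minimal_separating_enclosure :: "nat \<Rightarrow> (nat \<Rightarrow> complex ^ 'n ^ 'n) \<Rightarrow> (complex ^ 'n) set \<Rightarrow> bool" where
  "minimal_separating_enclosure v L X \<longleftrightarrow>
     separating_enclosure v L X \<and> (\<forall>Y. separating_enclosure v L Y \<and> Y \<subseteq> X \<longrightarrow> Y = X)"

definition orth_direct_sum :: "'i set \<Rightarrow> ('i \<Rightarrow> (complex ^ 'n) set) \<Rightarrow> (complex ^ 'n) set \<Rightarrow> bool" where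
  "orth_direct_sum I U W \<longleftrightarrow>
     finite I \<and> (\<forall>i\<in>I. vec.subspace (U i)) \<and>
     (\<forall>i\<in>I. \<forall>j\<in>I. i \<noteq> j \<longrightarrow> orth (U i) (U j)) \<and> W = vec.span (\<Union>i\<in>I. U i)"

definition enclosure_decomposition ::
  "nat \<Rightarrow> (nat \<Rightarrow> complex ^ 'n ^ 'n) \<Rightarrow> 'a set \<Rightarrow> ('a \<Rightarrow> (complex ^ 'n) set)
    \<Rightarrow> ('a \<Rightarrow> 'b set) \<Rightarrow> ('a \<Rightarrow> 'b \<Rightarrow> (complex ^ 'n) set) \<Rightarrow> bool" where
  "enclosure_decomposition v L A C I U \<longleftrightarrow>
     orth_direct_sum A C (fast_recurrent v L) \<and>
     (\<forall>\<alpha>\<in>A. minimal_separating_enclosure v L (C \<alpha>)) \<and>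
     (\<forall>\<alpha>\<in>A. orth_direct_sum (I \<alpha>) (U \<alpha>) (C \<alpha>)) \<and>
     (\<forall>\<alpha>\<in>A. \<forall>\<beta>\<in>I \<alpha>. minimal_enclosure v L (U \<alpha> \<beta>))"


definition absorption_weight ::
  "(real ^ 'd) set \<Rightarrow> nat \<Rightarrow> (nat \<Rightarrow> complex ^ 'n ^ 'n) \<Rightarrow> (real ^ 'd \<Rightarrow> complex ^ 'n ^ 'n)
    \<Rightarrow> (complex ^ 'n) set \<Rightarrow> complex" where
  "absorption_weight V v L \<rho> U = (\<Sum>\<^sub>\<infinity>k\<in>V. trace (absorption v L U ** \<rho> k))"

definition reachable ::
  "(real ^ 'd) set \<Rightarrow> nat \<Rightarrow> (nat \<Rightarrow> complex ^ 'n ^ 'n) \<Rightarrow> (real ^ 'd \<Rightarrow> complex ^ 'n ^ 'n)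
    \<Rightarrow> (complex ^ 'n) set" where
  "reachable V v L \<rho> = vec.span (\<Union>k\<in>V. \<Union>n. supp ((channel v L ^^ n) (\<rho> k)))"

definition reach_absorb ::
  "(real ^ 'd) set \<Rightarrow> nat \<Rightarrow> (nat \<Rightarrow> complex ^ 'n ^ 'n) \<Rightarrow> (real ^ 'd \<Rightarrow> complex ^ 'n ^ 'n)
    \<Rightarrow> (complex ^ 'n) set \<Rightarrow> (complex ^ 'n) set" where
  "reach_absorb V v L \<rho> U = (\<lambda>x. absorption_proj v L U *v x) ` reachable V v L \<rho>"

text \<open>The operators on a subspace \<open>Q\<close>, embedded as the corner \<open>p\<^sub>Q \<sigma> p\<^sub>Q\<close>.\<close>

definition corner :: "(complex ^ 'n) set \<Rightarrow> (complex ^ 'n ^ 'n) set" where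
  "corner Q = {\<sigma>. orth_proj Q ** \<sigma> ** orth_proj Q = \<sigma>}"

definition deformed ::
  "nat \<Rightarrow> (nat \<Rightarrow> real ^ 'd) \<Rightarrow> (nat \<Rightarrow> complex ^ 'n ^ 'n) \<Rightarrow> (complex ^ 'n) set \<Rightarrow> real ^ 'd
    \<Rightarrow> complex ^ 'n ^ 'n \<Rightarrow> complex ^ 'n ^ 'n" where
  "deformed v s L Q u \<sigma> =
     (let p = orth_proj Q in
      \<Sum>i=1..v. exp (u \<bullet> s i) *\<^sub>R (p ** L i ** p ** \<sigma> ** p ** cadj (L i) ** p))"

definition op_spectrum ::
  "(complex ^ 'n ^ 'n) set \<Rightarrow> (complex ^ 'n ^ 'n \<Rightarrow> complex ^ 'n ^ 'n) \<Rightarrow> complex set" where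
  "op_spectrum W T = {\<mu>. \<not> bij_betw (\<lambda>\<sigma>. T \<sigma> - mat \<mu> ** \<sigma>) W W}"

text \<open>Inserting \<open>0\<close> only matters for \<open>W = {0}\<close>, where the spectrum is empty and the spectral
  radius is \<open>0\<close>.\<close>

definition op_spectral_radius ::
  "(complex ^ 'n ^ 'n) set \<Rightarrow> (complex ^ 'n ^ 'n \<Rightarrow> complex ^ 'n ^ 'n) \<Rightarrow> real" where
  "op_spectral_radius W T = Sup (insert 0 (cmod ` op_spectrum W T))"

definition lam ::
  "(real ^ 'd) set \<Rightarrow> nat \<Rightarrow> (nat \<Rightarrow> real ^ 'd) \<Rightarrow> (nat \<Rightarrow> complex ^ 'n ^ 'n)
    \<Rightarrow> (real ^ 'd \<Rightarrow> complex ^ 'n ^ 'n) \<Rightarrow> (complex ^ 'n) set \<Rightarrow> real ^ 'd \<Rightarrow> real" where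
  "lam V v s L \<rho> U u =
     (let Q = reach_absorb V v L \<rho> U in op_spectral_radius (corner Q) (deformed v s L Q u))"


text \<open>Only used for nonnegative arguments.\<close>

definition log_ereal :: "real \<Rightarrow> ereal" where
  "log_ereal x = (if x > 0 then ereal (ln x) else -\<infinity>)"

definition rate ::
  "(real ^ 'd) set \<Rightarrow> nat \<Rightarrow> (nat \<Rightarrow> real ^ 'd) \<Rightarrow> (nat \<Rightarrow> complex ^ 'n ^ 'n)
    \<Rightarrow> (real ^ 'd \<Rightarrow> complex ^ 'n ^ 'n) \<Rightarrow> (complex ^ 'n) set \<Rightarrow> real ^ 'd \<Rightarrow> ereal" where
  "rate V v s L \<rho> U x = (SUP u. ereal (u \<bullet> x) - log_ereal (lam V v s L \<rho> U u))"

definition exposed_points :: "(real ^ 'd \<Rightarrow> ereal) \<Rightarrow> (real ^ 'd) set" where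
  "exposed_points \<Lambda> =
     {y. \<exists>\<eta>. \<forall>x. x \<noteq> y \<longrightarrow> ereal (\<eta> \<bullet> y) - \<Lambda> y > ereal (\<eta> \<bullet> x) - \<Lambda> x}"

primrec times_differentiable :: "nat \<Rightarrow> (real ^ 'd \<Rightarrow> real) \<Rightarrow> bool" where
  "times_differentiable 0 f \<longleftrightarrow> continuous_on UNIV f"
| "times_differentiable (Suc n) f \<longleftrightarrow>
     (\<forall>x. f differentiable (at x)) \<and>
     (\<forall>h. times_differentiable n (\<lambda>x. frechet_derivative f (at x) h))"

definition smooth :: "(real ^ 'd \<Rightarrow> real) \<Rightarrow> bool" where
  "smooth f \<longleftrightarrow> (\<forall>n. times_differentiable n f)"

definition lower_set ::
  "(real ^ 'd) set \<Rightarrow> nat \<Rightarrow> (nat \<Rightarrow> real ^ 'd) \<Rightarrow> (nat \<Rightarrow> complex ^ 'n ^ 'n)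
    \<Rightarrow> (real ^ 'd \<Rightarrow> complex ^ 'n ^ 'n) \<Rightarrow> (complex ^ 'n) set \<Rightarrow> (real ^ 'd) set" where
  "lower_set V v s L \<rho> U =
     (if smooth (lam V v s L \<rho> U) then UNIV else exposed_points (rate V v s L \<rho> U))"

end

theory Submission
  imports Defs "HOL-Computational_Algebra.Fundamental_Theorem_Algebra"
begin

text \<open>
  Write \<open>A\<^sub>j\<close> for the absorption operators of the minimal enclosures. Each is fixed by the dual channel,
  and \<open>\<Sum>\<^sub>j A\<^sub>j = 1\<close> because the Cesaro means of the iterates of any state converge to invariant states. Hence the
  law of the empirical mean splits into the measures giving the word \<open>w\<close> the mass
  \<open>Tr(A\<^sub>j L\<^sub>w \<rho> L\<^sub>w\<^sup>*)\<close>, those with \<open>a\<^sub>j = 0\<close> vanishing. As \<open>ker A\<^sub>j\<close> is invariant under all \<open>L\<^sub>i\<close>, the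
  moment generating function of the \<open>j\<close>-th measure is, up to constants, the trace of the \<open>n\<close>-th iterate of the deformed
  channel compressed to \<open>Q\<^sub>j\<close>. Finitely many iterates of the compressed initial state add up to a
  faithful one, so this trace grows exactly like the \<open>n\<close>-th power of the spectral radius.

  The Gaertner-Ellis argument is then applied to each component separately. The lower bound at \<open>y\<close> is a
  change of measure by \<open>\<eta>\<close>, valid as soon as \<open>y\<close> is the only possible subgradient of \<open>u \<mapsto> log \<lambda>\<^sub>u\<close> at
  \<open>\<eta>\<close>, which needs no convexity. In the smooth case every point of finite rate is approximated by
  gradients of no larger rate, through a quadratic regularisation of \<open>log \<lambda>\<close>.
\<close>

text \<open>The law has to be split before any Legendre transform is taken: the logarithmic moment
  function of the whole law is a maximum over the components, and its transform can lie strictly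
  below the minimum of the component rates. The components have total mass below one in general, so
  the large deviation part works with weights rather than probabilities. A compressed channel may be
  reducible, with degenerate peripheral spectrum, so its growth is not read off a Perron eigenvector
  but pinned between \<open>exp (n (ln r - e))\<close> and \<open>exp (n (ln r + e))\<close>. From
  above, an annihilating polynomial does the work of the Jordan form. From below, an eigenvector, in
  general not positive, is dominated as a sesquilinear form by a faithful positive operator, and
  iteration preserves this domination. Reachability is blind to \<open>u\<close>: the factors
  \<open>exp (u \<bullet> s i)\<close> are positive, so every deformed iterate of the initial state
  vanishes on the same vectors orthogonal to the reachable space. With the invariance of the kernel
  of the absorption operator, this is why compression commutes with iteration.\<close>

lemma cinner_add_left: "cinner (x + y) z = cinner x z + cinner y z"
  by (simp add: cinner_def sum.distrib algebra_simps)

lemma cinner_add_right: "cinner x (y + z) = cinner x y + cinner x z"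
  by (simp add: cinner_def sum.distrib algebra_simps)

lemma cinner_diff_left: "cinner (x - y) z = cinner x z - cinner y z"
  by (simp add: cinner_def sum_subtractf algebra_simps)

lemma cinner_diff_right: "cinner x (y - z) = cinner x y - cinner x z"
  by (simp add: cinner_def sum_subtractf algebra_simps)

lemma cinner_scale_left: "cinner (c *s x) y = cnj c * cinner x y"
  by (simp add: cinner_def sum_distrib_left algebra_simps)

lemma cinner_scale_right: "cinner x (c *s y) = c * cinner x y"
  by (simp add: cinner_def sum_distrib_left algebra_simps)

lemma cinner_scaleR_right: "cinner x (c *\<^sub>R y) = c *\<^sub>R cinner x y"
  by (simp add: cinner_def scaleR_right.sum)

lemma cinner_scaleR_left: "cinner (c *\<^sub>R x) y = c *\<^sub>R cinner x y"
  by (simp add: cinner_def scaleR_right.sum)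

lemma cinner_0_left [simp]: "cinner 0 x = 0" and cinner_0_right [simp]: "cinner x 0 = 0"
  by (simp_all add: cinner_def)

lemma cinner_sum_right: "cinner x (\<Sum>i\<in>S. f i) = (\<Sum>i\<in>S. cinner x (f i))"
  by (induction S rule: infinite_finite_induct) (simp_all add: cinner_add_right)

lemma cinner_commute: "cinner y x = cnj (cinner x y)"
  by (simp add: cinner_def mult.commute)

lemma Re_cinner: "Re (cinner x y) = x \<bullet> y"
  by (simp add: cinner_def inner_vec_def inner_complex_def)

lemma cinner_self: "cinner x x = complex_of_real ((norm x)\<^sup>2)"
proof -
  have "cinner x x = (\<Sum>i\<in>UNIV. complex_of_real ((cmod (x $ i))\<^sup>2))"
    unfolding cinner_def by (intro sum.cong refl) (metis complex_norm_square mult.commute)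
  also have "\<dots> = complex_of_real ((norm x)\<^sup>2)"
    by (simp add: norm_vec_def L2_set_def sum_nonneg)
  finally show ?thesis .
qed

lemma cinner_self_eq_0 [simp]: "cinner x x = 0 \<longleftrightarrow> x = 0"
  by (simp add: cinner_self)

lemma cinner_eq_0_commute: "cinner x y = 0 \<longleftrightarrow> cinner y x = 0"
  using cinner_commute[of x y] by auto

text \<open>The real inequality applies once \<open>y\<close> is rotated by the unit phase
  \<open>c\<close> that makes the form real and nonnegative.\<close>

lemma norm_cinner_le: "cmod (cinner x y) \<le> norm x * norm y"
proof (cases "cinner x y = 0")
  case False
  define c where "c = cnj (cinner x y) / cmod (cinner x y)"
  have c: "cmod c = 1" using False by (simp add: c_def norm_divide)
  have "cinner x (c *s y) = cmod (cinner x y)"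
    using False
    by (simp add: c_def cinner_scale_right) (metis complex_norm_square mult.commute nonzero_mult_div_cancel_left norm_eq_zero of_real_eq_0_iff of_real_power power2_eq_square)
  hence "cmod (cinner x y) = x \<bullet> (c *s y)"
    using Re_cinner[of x "c *s y"] by simp
  also have "\<dots> \<le> norm x * norm (c *s y)" by (rule norm_cauchy_schwarz)
  also have "norm (c *s y) = norm y"
    using c by (simp add: norm_vec_def norm_mult)
  finally show ?thesis .
qed simp

section \<open>Adjoints and matrix algebra\<close>

lemma cadj_nth [simp]: "cadj A $ i $ j = cnj (A $ j $ i)"
  by (simp add: cadj_def map_matrix_def transpose_def)

lemma cadj_mult: "cadj (A ** B) = cadj B ** cadj A"
  by (simp add: vec_eq_iff matrix_matrix_mult_def mult.commute)

lemma cadj_cadj [simp]: "cadj (cadj A) = A"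
  by (simp add: vec_eq_iff)

lemma cadj_mat_1 [simp]: "cadj (mat 1) = mat 1"
  by (auto simp: vec_eq_iff mat_def)

lemma cinner_adj_right: "cinner x (A *v y) = cinner (cadj A *v x) y"
  unfolding cinner_def matrix_vector_mult_def
  by (simp add: sum_distrib_left sum_distrib_right)
     (subst sum.swap, simp add: mult_ac)

lemma cinner_adj_left: "cinner (A *v x) y = cinner x (cadj A *v y)"
  by (simp add: cinner_adj_right)

lemma matrix_nth_cinner: "A $ i $ j = cinner (axis i 1) (A *v axis j 1)"
  by (simp add: cinner_def axis_def matrix_vector_mult_def if_distrib[of cnj] if_distrib[of "(*) _"]
      if_distrib[of "\<lambda>x. x * _"] cong: if_cong)

lemma matrix_sum_mult_left: "(\<Sum>i\<in>S. f i) ** (B :: complex^'n^'n) = (\<Sum>i\<in>S. f i ** B)"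
  by (induction S rule: infinite_finite_induct)
     (simp_all add: vec_eq_iff matrix_matrix_mult_def sum.distrib algebra_simps)

lemma matrix_sum_mult_right: "(B :: complex^'n^'n) ** (\<Sum>i\<in>S. f i) = (\<Sum>i\<in>S. B ** f i)"
  by (induction S rule: infinite_finite_induct)
     (simp_all add: vec_eq_iff matrix_matrix_mult_def sum.distrib algebra_simps)

lemma matrix_sum_vector: "(\<Sum>i\<in>S. f i) *v (x :: complex^'n) = (\<Sum>i\<in>S. f i *v x)"
  by (induction S rule: infinite_finite_induct) (simp_all add: matrix_vector_mult_add_rdistrib)

lemma matrix_scaleR_mult_left: "(c *\<^sub>R A) ** (B :: complex^'n^'n) = c *\<^sub>R (A ** B)"
  by (simp add: vec_eq_iff matrix_matrix_mult_def scaleR_right.sum)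

lemma matrix_scaleR_mult_right: "(A :: complex^'n^'n) ** (c *\<^sub>R B) = c *\<^sub>R (A ** B)"
  by (simp add: vec_eq_iff matrix_matrix_mult_def scaleR_right.sum)

lemma matrix_scaleR_vector: "(c *\<^sub>R A) *v (x :: complex^'n) = c *\<^sub>R (A *v x)"
  by (simp add: vec_eq_iff matrix_vector_mult_def scaleR_right.sum)

lemma matrix_add_mult_left: "(A + B) ** (C :: complex^'n^'n) = A ** C + B ** C"
  by (simp add: vec_eq_iff matrix_matrix_mult_def sum.distrib algebra_simps)

lemma matrix_diff_mult_left: "(A - B) ** (C :: complex^'n^'n) = A ** C - B ** C"
  by (simp add: vec_eq_iff matrix_matrix_mult_def sum_subtractf algebra_simps)

lemma trace_sum: "trace (\<Sum>i\<in>S. f i :: complex^'n^'n) = (\<Sum>i\<in>S. trace (f i))"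
  by (induction S rule: infinite_finite_induct) (simp_all add: trace_def sum.distrib)

lemma trace_scaleR: "trace (c *\<^sub>R A :: complex^'n^'n) = c *\<^sub>R trace A"
  by (simp add: trace_def scaleR_right.sum)

lemma bounded_linear_matrix_mult_left: "bounded_linear (\<lambda>X. (A :: complex^'n^'n) ** X)"
  by (rule linear_conv_bounded_linear[THEN iffD1], rule linearI)
     (simp_all add: matrix_add_ldistrib matrix_scaleR_mult_right)

lemma bounded_linear_matrix_mult_right: "bounded_linear (\<lambda>X. X ** (A :: complex^'n^'n))"
  by (rule linear_conv_bounded_linear[THEN iffD1], rule linearI)
     (simp_all add: matrix_add_mult_left matrix_scaleR_mult_left)

lemma bounded_linear_trace: "bounded_linear (trace :: complex^'n^'n \<Rightarrow> complex)"
  by (rule linear_conv_bounded_linear[THEN iffD1], rule linearI)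
     (simp_all add: trace_add trace_scaleR)

lemma bounded_linear_cinner_mult: "bounded_linear (\<lambda>X :: complex^'n^'n. cinner x (X *v y))"
  by (rule linear_conv_bounded_linear[THEN iffD1], rule linearI)
     (simp_all add: matrix_vector_mult_add_rdistrib cinner_add_right matrix_scaleR_vector cinner_scaleR_right)

lemma continuous_on_cinner_mult: "continuous_on S (\<lambda>x. cinner x (A *v x))"
  unfolding cinner_def matrix_vector_mult_def
  by (intro continuous_intros continuous_on_component)

subsection \<open>Positive semidefinite matrices\<close>

lemma psd_iff: "psd A \<longleftrightarrow> (\<forall>x. 0 \<le> Re (cinner x (A *v x)) \<and> Im (cinner x (A *v x)) = 0)"
  by (simp add: psd_def complex_nonneg_Reals_iff)

lemma psd_form_eq: "psd A \<Longrightarrow> cinner x (A *v x) = complex_of_real (Re (cinner x (A *v x)))"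
  by (simp add: psd_iff complex_eq_iff)

lemma psd_form_nonneg: "psd A \<Longrightarrow> 0 \<le> Re (cinner x (A *v x))"
  by (simp add: psd_iff)

lemma psd_add: "psd A \<Longrightarrow> psd B \<Longrightarrow> psd (A + B)"
  by (simp add: psd_iff matrix_vector_mult_add_rdistrib cinner_add_right)

lemma psd_0 [simp]: "psd 0"
  by (simp add: psd_iff)

lemma psd_scaleR: "psd A \<Longrightarrow> 0 \<le> c \<Longrightarrow> psd (c *\<^sub>R A)"
  by (simp add: psd_iff matrix_scaleR_vector cinner_scaleR_right)

lemma psd_sum: "(\<And>i. i \<in> S \<Longrightarrow> psd (f i)) \<Longrightarrow> psd (\<Sum>i\<in>S. f i)"
  by (induction S rule: infinite_finite_induct) (simp_all add: psd_add)

lemma conj_form: "cinner x ((K ** A ** cadj K) *v y) = cinner (cadj K *v x) (A *v (cadj K *v y))"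
  by (simp add: matrix_vector_mul_assoc[symmetric] cinner_adj_right)

lemma psd_conj: "psd A \<Longrightarrow> psd (K ** A ** cadj K)"
  unfolding psd_iff by (simp add: conj_form)

text \<open>Polarisation: reality of the form at \<open>x + y\<close> and at
  \<open>x + \<i> y\<close> determines both parts. Hermitian symmetry is thus a consequence of
  \<open>psd\<close>, not a part of it.\<close>

lemma psd_hermitian_form:
  assumes "psd A" shows "cinner y (A *v x) = cnj (cinner x (A *v y))"
proof -
  have 1: "Im (cinner (x + y) (A *v (x + y))) = 0" "Im (cinner x (A *v x)) = 0" "Im (cinner y (A *v y)) = 0"
    "Im (cinner (x + \<i> *s y) (A *v (x + \<i> *s y))) = 0"
    using assms by (auto simp: psd_iff)
  show ?thesis
    using 1 by (simp add: complex_eq_iff matrix_vector_right_distrib cinner_add_left cinner_add_right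
        vector_scalar_commute cinner_scale_left cinner_scale_right algebra_simps)
qed

lemma psd_hermitian: "psd A \<Longrightarrow> cadj A = A"
  unfolding vec_eq_iff cadj_nth by (metis matrix_nth_cinner psd_hermitian_form)

lemma psd_cauchy_schwarz:
  assumes "psd A"
  shows "(cmod (cinner x (A *v y)))\<^sup>2 \<le> Re (cinner x (A *v x)) * Re (cinner y (A *v y))"
proof -
  define a b c where "a = Re (cinner x (A *v x))" and "b = Re (cinner y (A *v y))" and "c = cinner x (A *v y)"
  have yx: "cinner y (A *v x) = cnj c" unfolding c_def by (rule psd_hermitian_form[OF assms])
  have xx: "cinner x (A *v x) = of_real a" and yy: "cinner y (A *v y) = of_real b"
    unfolding a_def b_def by (rule psd_form_eq[OF assms])+
  have a0: "0 \<le> a" and b0: "0 \<le> b" using psd_form_nonneg[OF assms] by (simp_all add: a_def b_def)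
  have cc: "c * cnj c = of_real ((cmod c)\<^sup>2)" by (simp only: complex_norm_square)
  have key: "0 \<le> a + 2 * t * (cmod c)\<^sup>2 + t\<^sup>2 * (cmod c)\<^sup>2 * b" for t :: real
  proof -
    \<comment> \<open>The factor \<open>cnj c\<close> makes both cross terms equal to
      \<open>t\<close> times the squared modulus of \<open>c\<close>, leaving a real polynomial in
      \<open>t\<close>.\<close>
    define d where "d = of_real t * cnj c"
    have "0 \<le> Re (cinner (x + d *s y) (A *v (x + d *s y)))"
      by (rule psd_form_nonneg[OF assms])
    also have "cinner (x + d *s y) (A *v (x + d *s y)) = of_real a + d * c + cnj d * cnj c + d * cnj d * of_real b"
      by (simp add: matrix_vector_right_distrib cinner_add_left cinner_add_right
          vector_scalar_commute cinner_scale_left cinner_scale_right xx yy yx distrib_left flip: c_def)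
    also have "d * c = of_real t * (c * cnj c)" by (simp add: d_def)
    also have "cnj d * cnj c = of_real t * (c * cnj c)" by (simp add: d_def)
    also have "d * cnj d = of_real (t\<^sup>2) * (c * cnj c)" by (simp add: d_def power2_eq_square)
    finally show ?thesis unfolding cc by simp
  qed
  show ?thesis
  proof (cases "b = 0")
    case True
    have "c = 0"
    proof (rule ccontr)
      assume "c \<noteq> 0"
      then have "(cmod c)\<^sup>2 > 0" by simp
      \<comment> \<open>With \<open>b = 0\<close> the polynomial is affine in \<open>t\<close>, and
        this \<open>t\<close> sends it to \<open>- a - 2\<close>.\<close>
      then have "a + 2 * (- (a + 1) / (cmod c)\<^sup>2) * (cmod c)\<^sup>2 < 0" using a0 by simp
      with key[of "- (a + 1) / (cmod c)\<^sup>2"] True show False by simp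
    qed
    then show ?thesis using a0 b0 by (simp flip: a_def b_def c_def)
  next
    case False
    have "0 \<le> a - (cmod c)\<^sup>2 / b"
      using key[of "- 1 / b"] False by (simp add: power2_eq_square field_simps)
    then show ?thesis using False b0
      by (simp add: field_simps flip: a_def b_def c_def)
  qed
qed

lemma psd_form_eq_0:
  assumes "psd A" "Re (cinner x (A *v x)) = 0" shows "A *v x = 0"
proof -
  have "(cmod (cinner (A *v x) (A *v x)))\<^sup>2 \<le> 0"
    using psd_cauchy_schwarz[OF assms(1), of "A *v x" x] assms(2) by simp
  then show ?thesis by simp
qed

lemma psd_diag_nonneg: "psd A \<Longrightarrow> 0 \<le> Re (A $ i $ i)"
  by (simp add: matrix_nth_cinner psd_form_nonneg)

lemma psd_trace: assumes "psd A" shows "0 \<le> Re (trace A)" "trace A = complex_of_real (Re (trace A))"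
proof -
  show "0 \<le> Re (trace A)" by (auto simp: trace_def intro!: sum_nonneg psd_diag_nonneg assms)
  have "Im (trace A) = 0"
    using assms by (auto simp: trace_def matrix_nth_cinner psd_iff intro!: sum.neutral)
  then show "trace A = complex_of_real (Re (trace A))" by (simp add: complex_eq_iff)
qed

lemma psd_diag_le_trace: "psd A \<Longrightarrow> Re (A $ i $ i) \<le> Re (trace A)"
  unfolding trace_def by (simp, intro member_le_sum) (auto simp: psd_diag_nonneg)

lemma psd_entry_le_trace:
  assumes "psd A" shows "cmod (A $ i $ j) \<le> Re (trace A)"
proof -
  have "(cmod (A $ i $ j))\<^sup>2 \<le> Re (A $ i $ i) * Re (A $ j $ j)"
    using psd_cauchy_schwarz[OF assms, of "axis i 1" "axis j 1"] by (simp add: matrix_nth_cinner)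
  also have "\<dots> \<le> Re (trace A) * Re (trace A)"
    by (intro mult_mono psd_diag_le_trace psd_diag_nonneg psd_trace assms)
  finally show ?thesis
    using psd_trace(1)[OF assms] by (metis power2_eq_square power2_le_imp_le)
qed

lemma psd_trace_0: "psd A \<Longrightarrow> Re (trace A) = 0 \<Longrightarrow> A = 0"
  using psd_entry_le_trace[of A] by (simp add: vec_eq_iff)

section \<open>Rank-one operators and traces of products\<close>

definition outer :: "complex ^ 'n \<Rightarrow> complex ^ 'n ^ 'n" where
  "outer x = (\<chi> i j. x $ i * cnj (x $ j))"

lemma outer_mult: "outer x *v y = cinner x y *s x"
  by (simp add: vec_eq_iff outer_def matrix_vector_mult_def cinner_def sum_distrib_right
      sum_distrib_left mult_ac)

lemma outer_form: "cinner y (outer x *v y) = complex_of_real ((cmod (cinner x y))\<^sup>2)"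
  by (simp add: outer_mult cinner_scale_right cinner_commute[of y x])
     (metis complex_norm_square of_real_power)

lemma psd_outer: "psd (outer x)"
  by (simp add: psd_iff outer_form)

lemma trace_mult_outer: "trace (M ** outer x) = cinner x (M *v x)"
  by (simp add: trace_def outer_def matrix_matrix_mult_def matrix_vector_mult_def cinner_def
      sum_distrib_left mult_ac)

lemma conj_outer: "K ** outer x ** cadj K = outer (K *v x)"
  unfolding matrix_eq
  by (simp add: matrix_vector_mul_assoc[symmetric] outer_mult vector_scalar_commute cinner_adj_right)

text \<open>Cholesky elimination: each step subtracts a rank-one matrix and clears one column of \<open>X\<close>.\<close>

lemma trace_psd_mult_psd:
  assumes "psd M" "psd X" shows "0 \<le> Re (trace (M ** X))" "Im (trace (M ** X)) = 0"
proof -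
  have "psd X \<Longrightarrow> (\<And>i. i \<notin> S \<Longrightarrow> X *v axis i 1 = 0) \<Longrightarrow> 0 \<le> Re (trace (M ** X)) \<and> Im (trace (M ** X)) = 0"
    if "finite S" for S :: "'a set" and X :: "complex^'a^'a"
    using that
  proof (induction S arbitrary: X rule: finite_induct)
    case empty
    then have "X $ i $ j = 0" for i j by (simp only: matrix_nth_cinner) simp
    then have "X = 0" by (simp add: vec_eq_iff)
    then show ?case by (simp add: trace_def)
  next
    case (insert i S)
    define e where "e = (axis i 1 :: complex^'a)"
    define a where "a = Re (cinner e (X *v e))"
    have a: "cinner e (X *v e) = of_real a" unfolding a_def by (rule psd_form_eq) (rule insert.prems)
    have a0: "0 \<le> a" using insert.prems by (simp add: a_def psd_form_nonneg)
    show ?case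
    proof (cases "a = 0")
      case True
      then have "X *v e = 0" using insert.prems psd_form_eq_0 by (auto simp: a_def)
      then show ?thesis using insert.IH[of X] insert.prems by (metis e_def insert_iff)
    next
      case False
      \<comment> \<open>\<open>Y\<close> is the Schur complement of the pivot \<open>a\<close>:
        Cauchy-Schwarz keeps it positive, it annihilates \<open>e\<close>, and columns already
        cleared stay clear because the form of \<open>z\<close> vanishes on them.\<close>
      define z where "z = (1 / sqrt a) *\<^sub>R (X *v e)"
      have zy: "cinner z y = (1 / sqrt a) *\<^sub>R cinner e (X *v y)" for y
        by (simp add: z_def cinner_scaleR_left cinner_adj_left psd_hermitian[OF insert.prems(1)])
      define Y where "Y = X - outer z"
      have "psd Y"
        unfolding psd_iff
      proof (intro allI conjI)
        fix y
        have e1: "cinner y (Y *v y) = cinner y (X *v y) - of_real ((cmod (cinner e (X *v y)))\<^sup>2 / a)"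
          using a0 by (simp add: Y_def matrix_vector_mult_diff_rdistrib cinner_diff_right outer_form zy
              power_divide norm_divide)
        then have e2: "Re (cinner y (Y *v y)) = Re (cinner y (X *v y)) - (cmod (cinner e (X *v y)))\<^sup>2 / a"
          by simp
        from e1 show "Im (cinner y (Y *v y)) = 0" using insert.prems(1) by (simp add: psd_iff)
        have "(cmod (cinner e (X *v y)))\<^sup>2 \<le> a * Re (cinner y (X *v y))"
          using psd_cauchy_schwarz[OF insert.prems(1), of e y] by (simp add: a_def)
        then show "0 \<le> Re (cinner y (Y *v y))" unfolding e2 using a0 False by (simp add: field_simps)
      qed
      moreover have "Y *v axis j 1 = 0" if "j \<notin> S" for j
      proof (cases "j = i")
        case True
        have "outer z *v e = X *v e"
          using a0 False by (simp add: outer_mult zy a) (simp add: z_def vec_eq_iff scaleR_conv_of_real[where 'a = complex] 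
             flip: of_real_mult)
        then show ?thesis by (simp add: Y_def matrix_vector_mult_diff_rdistrib e_def True)
      next
        case False
        then have "X *v axis j 1 = 0" using insert.prems that by auto
        then show ?thesis by (simp add: Y_def matrix_vector_mult_diff_rdistrib outer_mult zy)
      qed
      ultimately have IH: "0 \<le> Re (trace (M ** Y)) \<and> Im (trace (M ** Y)) = 0" by (rule insert.IH)
      have "M ** X = M ** Y + M ** outer z" by (simp add: Y_def flip: matrix_add_ldistrib)
      then have "trace (M ** X) = trace (M ** Y) + cinner z (M *v z)"
        by (simp add: trace_add trace_mult_outer)
      then show ?thesis using IH \<open>psd M\<close> by (simp add: psd_iff)
    qed
  qed
  from this[of UNIV X] assms(2) show "0 \<le> Re (trace (M ** X))" "Im (trace (M ** X)) = 0" by auto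
qed

subsection \<open>Supports and orthogonal projections\<close>

lemma subspace_supp: "vec.subspace (supp A)"
  by (simp add: vec.subspace_def supp_def cinner_add_right cinner_scale_right)

lemma mult_in_supp: "cadj A = A \<Longrightarrow> A *v x \<in> supp A"
  by (simp add: supp_def cinner_adj_right)

text \<open>\<open>A *v x\<close> itself lies in the support, so the form of \<open>A\<close>
  vanishes at \<open>x\<close>.\<close>

lemma psd_orth_supp: "psd A \<Longrightarrow> (\<And>y. y \<in> supp A \<Longrightarrow> cinner x y = 0) \<Longrightarrow> A *v x = 0"
  using mult_in_supp[of A x] psd_hermitian[of A] psd_form_eq_0[of A x] by auto

lemma is_orth_proj_unique:
  assumes "P ** P = P" "cadj P = P" "range ((*v) P) = U"
    and "P' ** P' = P'" "cadj P' = P'" "range ((*v) P') = U"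
  shows "P' = P"
proof -
  have fix1: "P *v x = x" if "x \<in> U" for x
    using that assms(1,3) by (auto simp: matrix_vector_mul_assoc)
  have fix2: "P' *v x = x" if "x \<in> U" for x
    using that assms(4,6) by (auto simp: matrix_vector_mul_assoc)
  have "P ** P' = P'" using fix1 assms(6) by (auto simp: matrix_eq matrix_vector_mul_assoc[symmetric])
  moreover have "P' ** P = P" using fix2 assms(3) by (auto simp: matrix_eq matrix_vector_mul_assoc[symmetric])
  ultimately show ?thesis using assms(2,5) by (metis cadj_mult)
qed

lemma subspace_real:
  assumes "vec.subspace (Q :: (complex^'n) set)" shows "subspace Q"
proof -
  have "c *\<^sub>R x = complex_of_real c *s x" for c and x :: "complex^'n"
    by (simp add: vec_eq_iff scaleR_conv_of_real[where 'a = complex])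
  then show ?thesis using assms by (auto simp: subspace_def vec.subspace_def)
qed

lemma is_orth_proj_exists:
  assumes U: "vec.subspace (U :: (complex^'n) set)"
  shows "\<exists>P. P ** P = P \<and> cadj P = P \<and> range ((*v) P) = U"
proof -
  have "\<exists>y z. y \<in> U \<and> (\<forall>w\<in>U. cinner z w = 0) \<and> x = y + z" for x
  proof -
    \<comment> \<open>This decomposition is orthogonal for the real inner product only; stability of
      \<open>U\<close> under \<open>\<i>\<close> upgrades it to the Hermitian form.\<close>
    obtain y z where yz: "y \<in> span U" "\<And>w. w \<in> span U \<Longrightarrow> orthogonal z w" "x = y + z"
      using orthogonal_subspace_decomp_exists[of U x] by metis
    have sp: "span U = U" using subspace_real[OF U] by (simp add: span_eq_iff)
    have "cinner z w = 0" if "w \<in> U" for w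
    proof -
      have "\<i> *s w \<in> U" using U that by (simp add: vec.subspace_scale)
      then have "Re (cinner z (\<i> *s w)) = 0" "Re (cinner z w) = 0"
        using yz(2) that sp by (auto simp: Re_cinner orthogonal_def)
      then show ?thesis by (simp add: complex_eq_iff cinner_scale_right)
    qed
    then show ?thesis using yz sp by blast
  qed
  then obtain f g where f: "\<And>x. f x \<in> U" and g: "\<And>x w. w \<in> U \<Longrightarrow> cinner (g x) w = 0" and fg: "\<And>x. x = f x + g x"
    by metis
  \<comment> \<open>\<open>f\<close> is a mere choice function, so the projection is rebuilt
    linearly from its values on the standard basis.\<close>
  define P where "P = (\<chi> i j. f (axis j 1) $ i)"
  have P1: "P *v x = (\<Sum>j\<in>UNIV. x $ j *s f (axis j 1))" for x
    by (simp add: P_def vec_eq_iff matrix_vector_mult_def mult.commute)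
  have PU: "P *v x \<in> U" for x
    unfolding P1 by (intro vec.subspace_sum vec.subspace_scale U f)
  have xexp: "x = (\<Sum>j\<in>UNIV. x $ j *s axis j 1)" for x :: "complex^'n"
    by (metis basis_expansion)
  have orthP: "cinner w (x - P *v x) = 0" if "w \<in> U" for x w
  proof -
    have "x - P *v x = (\<Sum>j\<in>UNIV. x $ j *s g (axis j 1))"
    proof -
      have "g (axis j 1) = axis j 1 - f (axis j 1)" for j using fg[of "axis j 1"] by (metis add_diff_cancel_left')
      then have "(\<Sum>j\<in>UNIV. x $ j *s g (axis j 1)) = (\<Sum>j\<in>UNIV. x $ j *s axis j 1) - P *v x"
        by (simp add: P1 sum_subtractf vec.scale_right_diff_distrib)
      then show ?thesis using xexp by metis
    qed
    then show ?thesis using g[OF that] by (simp add: cinner_sum_right cinner_scale_right cinner_eq_0_commute)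
  qed
  have fixP: "P *v x = x" if "x \<in> U" for x
  proof -
    have "x - P *v x \<in> U" using U PU that by (simp add: vec.subspace_diff)
    then have "cinner (x - P *v x) (x - P *v x) = 0" by (rule orthP)
    then show ?thesis by simp
  qed
  have "P ** P = P" using fixP PU by (simp add: matrix_eq matrix_vector_mul_assoc[symmetric])
  moreover have "cadj P = P"
  proof -
    have "cinner (P *v x) y = cinner x (P *v y)" for x y
    proof -
      have "cinner (P *v x) y = cinner (P *v x) (P *v y)"
        using orthP[OF PU[of x], of y] by (simp add: cinner_diff_right)
      also have "\<dots> = cinner x (P *v y)"
        using orthP[OF PU[of y], of x] by (simp add: cinner_diff_right cinner_eq_0_commute[of "P *v y"] flip: cinner_commute)
         (metis cinner_commute)
      finally show ?thesis .
    qed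
    then have "cnj (P $ j $ i) = P $ i $ j" for i j
      by (metis matrix_nth_cinner cinner_commute)
    then show ?thesis by (simp add: vec_eq_iff)
  qed
  moreover have "range ((*v) P) = U" using PU fixP by (metis image_subsetI rangeI subsetI subset_antisym)
  ultimately show ?thesis by blast
qed

lemma orth_proj:
  assumes "vec.subspace U"
  shows orth_proj_idem: "orth_proj U ** orth_proj U = orth_proj U"
    and orth_proj_adj: "cadj (orth_proj U) = orth_proj U"
    and orth_proj_range: "range ((*v) (orth_proj U)) = U"
proof -
  have "\<exists>!P. P ** P = P \<and> cadj P = P \<and> range ((*v) P) = U"
    using is_orth_proj_exists[OF assms] is_orth_proj_unique[of _ U] by (metis (no_types))
  from theI'[OF this] show "orth_proj U ** orth_proj U = orth_proj U"
    "cadj (orth_proj U) = orth_proj U" "range ((*v) (orth_proj U)) = U"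
    by (simp_all add: orth_proj_def)
qed

lemma orth_proj_in: "vec.subspace U \<Longrightarrow> orth_proj U *v x \<in> U"
  using orth_proj_range by blast

lemma orth_proj_fix: "vec.subspace U \<Longrightarrow> x \<in> U \<Longrightarrow> orth_proj U *v x = x"
  by (metis imageE matrix_vector_mul_assoc orth_proj_idem orth_proj_range)

lemma orth_proj_orth:
  assumes "vec.subspace U" "\<And>y. y \<in> U \<Longrightarrow> cinner x y = 0" shows "orth_proj U *v x = 0"
proof -
  have "cinner (orth_proj U *v x) (orth_proj U *v x) = cinner x (orth_proj U *v (orth_proj U *v x))"
    by (simp add: cinner_adj_left orth_proj_adj assms)
  also have "\<dots> = 0" by (intro assms(2) orth_proj_in assms)
  finally show ?thesis by simp
qed

lemma orth_proj_residual:
  assumes "vec.subspace U" "y \<in> U" shows "cinner (x - orth_proj U *v x) y = 0"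
  using assms by (simp add: cinner_diff_left cinner_adj_left orth_proj_adj orth_proj_fix)

lemma orth_proj_form:
  assumes "vec.subspace U" shows "cinner x (orth_proj U *v x) = complex_of_real ((norm (orth_proj U *v x))\<^sup>2)"
  by (metis assms cinner_adj_right cinner_self matrix_vector_mul_assoc orth_proj_adj orth_proj_idem)

lemma psd_orth_proj: "vec.subspace U \<Longrightarrow> psd (orth_proj U)"
  by (simp add: psd_iff orth_proj_form)


subsection \<open>Large deviations of weighted finite families of points\<close>

lemma exp_decay: "0 < (a :: real) \<Longrightarrow> (\<lambda>n. exp (- real n * a)) \<longlonglongrightarrow> 0"
  by real_asymp

text \<open>The Gaertner-Ellis setting without probability: a finite weighted family of points in a
  fixed ball for every \<open>n\<close>, whose moment generating function grows like
  \<open>exp (n f)\<close>. The total mass is not normalised, so \<open>f 0\<close> need not be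
  \<open>0\<close>.\<close>

locale weighted_points =
  fixes W :: "nat \<Rightarrow> 'w set" and q :: "nat \<Rightarrow> 'w \<Rightarrow> real" and X :: "nat \<Rightarrow> 'w \<Rightarrow> 'e :: euclidean_space"
    and M :: real and f :: "'e \<Rightarrow> real"
  assumes fin: "finite (W n)" and q_nonneg: "w \<in> W n \<Longrightarrow> 0 \<le> q n w"
    and bounded: "w \<in> W n \<Longrightarrow> norm (X n w) \<le> M"
    and growth_upper: "e > 0 \<Longrightarrow> \<forall>\<^sub>F n in sequentially. (\<Sum>w\<in>W n. q n w * exp (real n * (u \<bullet> X n w))) \<le> exp (real n * (f u + e))"
    and growth_lower: "e > 0 \<Longrightarrow> \<forall>\<^sub>F n in sequentially. (\<Sum>w\<in>W n. q n w * exp (real n * (u \<bullet> X n w))) \<ge> exp (real n * (f u - e))"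
begin

definition mass :: "nat \<Rightarrow> 'e set \<Rightarrow> real" where
  "mass n B = (\<Sum>w\<in>{w\<in>W n. X n w \<in> B}. q n w)"

definition tilt :: "'e \<Rightarrow> nat \<Rightarrow> 'e set \<Rightarrow> real" where
  "tilt \<eta> n B = (\<Sum>w\<in>{w\<in>W n. X n w \<in> B}. q n w * exp (real n * (\<eta> \<bullet> X n w)))"

lemma mass_eq_tilt: "mass n B = tilt 0 n B"
  by (simp add: mass_def tilt_def)

lemma tilt_mono: "B \<inter> cball 0 M \<subseteq> B' \<Longrightarrow> tilt \<eta> n B \<le> tilt \<eta> n B'"
  unfolding tilt_def using bounded by (intro sum_mono2) (auto simp: fin q_nonneg)

lemma tilt_Un: "tilt \<eta> n (B \<union> B') \<le> tilt \<eta> n B + tilt \<eta> n B'"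
proof -
  have "{w\<in>W n. X n w \<in> B \<union> B'} = {w\<in>W n. X n w \<in> B} \<union> {w\<in>W n. X n w \<in> B'}" by auto
  moreover have "0 \<le> (\<Sum>w\<in>{w\<in>W n. X n w \<in> B} \<inter> {w\<in>W n. X n w \<in> B'}. q n w * exp (real n * (\<eta> \<bullet> X n w)))"
    by (intro sum_nonneg) (auto simp: q_nonneg)
  ultimately show ?thesis unfolding tilt_def
    using sum.union_inter[of "{w\<in>W n. X n w \<in> B}" "{w\<in>W n. X n w \<in> B'}"
        "\<lambda>w. q n w * exp (real n * (\<eta> \<bullet> X n w))"] by (simp add: fin)
qed

lemma tilt_UN: "finite D \<Longrightarrow> tilt \<eta> n (\<Union>d\<in>D. H d) \<le> (\<Sum>d\<in>D. tilt \<eta> n (H d))"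
proof (induction D rule: finite_induct)
  case empty then show ?case by (simp add: tilt_def)
next
  case (insert d D)
  then show ?case using tilt_Un[of \<eta> n "H d" "\<Union>d\<in>D. H d"] by simp
qed

text \<open>The strict rate \<open>a\<close> is improved by a positive margin, since finitely many half-spaces cover
  the bounded part of \<open>F\<close>.\<close>

lemma tilt_upper_strict:
  assumes F: "closed F" and a: "\<And>x. x \<in> F \<Longrightarrow> \<exists>u. u \<bullet> x - f (\<eta> + u) > a"
  shows "\<exists>e>0. \<forall>\<^sub>F n in sequentially. tilt \<eta> n F \<le> exp (- real n * (a + e))"
proof -
  obtain u where u: "\<And>x. x \<in> F \<Longrightarrow> u x \<bullet> x - f (\<eta> + u x) > a" using a by metis
  \<comment> \<open>The threshold lies halfway between \<open>u x \<bullet> x\<close> and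
    \<open>a + f (\<eta> + u x)\<close>: the open half-space contains \<open>x\<close> and still
    beats \<open>a\<close> by the margin \<open>d x\<close>.\<close>
  define H where "H x = {y. u x \<bullet> y > (u x \<bullet> x + a + f (\<eta> + u x)) / 2}" for x
  define d where "d x = (u x \<bullet> x - a - f (\<eta> + u x)) / 2" for x
  have H_eq: "H x = {y. u x \<bullet> y > a + f (\<eta> + u x) + d x}" for x
    by (simp add: H_def d_def field_simps)
  have d0: "d x > 0" if "x \<in> F" for x using u[OF that] by (simp add: d_def)
  have xH: "x \<in> H x" if "x \<in> F" for x using u[OF that] by (simp add: H_def field_simps)
  have "compact (F \<inter> cball 0 M)" using F by (intro closed_Int_compact) auto
  moreover have "\<forall>T\<in>H ` F. open T" by (auto simp: H_eq open_halfspace_gt)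
  moreover have "F \<inter> cball 0 M \<subseteq> \<Union>(H ` F)" using xH by auto
  ultimately obtain T where T: "T \<subseteq> H ` F" "finite T" "F \<inter> cball 0 M \<subseteq> \<Union>T"
    by (meson compactE)
  then obtain D where D: "D \<subseteq> F" "finite D" "T = H ` D" by (meson finite_subset_image)
  \<comment> \<open>A third of the smallest margin: one share pays for the growth bound, one for the
    number of half-spaces, and one is the gain that remains.\<close>
  obtain e where e: "e > 0" "\<And>x. x \<in> D \<Longrightarrow> 3 * e \<le> d x"
  proof (cases "D = {}")
    case True then show ?thesis using that[of 1] by simp
  next
    case False
    then have "Min (d ` D) > 0" using D d0 by (subst Min_gr_iff) auto
    moreover have "Min (d ` D) \<le> d x" if "x \<in> D" for x using D that by simp
    ultimately show ?thesis by (intro that[of "Min (d ` D) / 3"]) auto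
  qed
  have half: "\<forall>\<^sub>F n in sequentially. tilt \<eta> n (H x) \<le> exp (- real n * (a + 2 * e))" if "x \<in> D" for x
    using growth_upper[OF e(1), of "\<eta> + u x"]
  proof eventually_elim
    case (elim n)
    \<comment> \<open>Exponential Chebyshev inequality: on \<open>H x\<close> the additional tilt by
      \<open>u x\<close> is at least the constant factor on the left.\<close>
    have "tilt \<eta> n (H x) * exp (real n * (a + f (\<eta> + u x) + d x))
        = (\<Sum>w\<in>{w\<in>W n. X n w \<in> H x}. q n w * exp (real n * (\<eta> \<bullet> X n w)) * exp (real n * (a + f (\<eta> + u x) + d x)))"
      by (simp add: tilt_def sum_distrib_right)
    also have "\<dots> \<le> (\<Sum>w\<in>{w\<in>W n. X n w \<in> H x}. q n w * exp (real n * ((\<eta> + u x) \<bullet> X n w)))"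
    proof (rule sum_mono)
      fix w assume w: "w \<in> {w\<in>W n. X n w \<in> H x}"
      then have "a + f (\<eta> + u x) + d x \<le> u x \<bullet> X n w" by (auto simp: H_eq)
      then have "real n * (a + f (\<eta> + u x) + d x) \<le> real n * (u x \<bullet> X n w)" by (intro mult_left_mono) auto
      then have "exp (real n * (\<eta> \<bullet> X n w)) * exp (real n * (a + f (\<eta> + u x) + d x))
          \<le> exp (real n * ((\<eta> + u x) \<bullet> X n w))"
        by (simp add: inner_add_left distrib_left flip: exp_add)
      then show "q n w * exp (real n * (\<eta> \<bullet> X n w)) * exp (real n * (a + f (\<eta> + u x) + d x))
          \<le> q n w * exp (real n * ((\<eta> + u x) \<bullet> X n w))"
        using w q_nonneg by (simp add: mult.assoc mult_left_mono)
    qed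
    also have "\<dots> \<le> (\<Sum>w\<in>W n. q n w * exp (real n * ((\<eta> + u x) \<bullet> X n w)))"
      by (intro sum_mono2) (auto simp: fin q_nonneg)
    also have "\<dots> \<le> exp (real n * (f (\<eta> + u x) + e))" by (rule elim)
    finally have "tilt \<eta> n (H x) \<le> exp (real n * (f (\<eta> + u x) + e)) / exp (real n * (a + f (\<eta> + u x) + d x))"
      by (simp add: field_simps)
    also have "\<dots> = exp (- real n * (a + (d x - e)))"
      by (simp add: algebra_simps flip: exp_diff)
    also have "\<dots> \<le> exp (- real n * (a + 2 * e))"
      using e(2)[OF that] by (auto intro!: mult_left_mono)
    finally show ?case .
  qed
  then have "\<forall>\<^sub>F n in sequentially. \<forall>x\<in>D. tilt \<eta> n (H x) \<le> exp (- real n * (a + 2 * e))"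
    using D by (simp add: eventually_ball_finite)
  moreover have "\<forall>\<^sub>F n in sequentially. real (card D) * exp (- real n * e) \<le> 1"
  proof -
    have "(\<lambda>n. real (card D) * exp (- real n * e)) \<longlonglongrightarrow> 0"
      using tendsto_mult_right_zero[OF exp_decay[OF e(1)]] .
    then show ?thesis by (rule eventually_mono[OF order_tendstoD(2)[where a = 1]]) auto
  qed
  ultimately have "\<forall>\<^sub>F n in sequentially. tilt \<eta> n F \<le> exp (- real n * (a + e))"
  proof eventually_elim
    case (elim n)
    have "tilt \<eta> n F \<le> tilt \<eta> n (\<Union>x\<in>D. H x)" using T D by (intro tilt_mono) auto
    also have "\<dots> \<le> (\<Sum>x\<in>D. tilt \<eta> n (H x))" by (rule tilt_UN) fact
    also have "\<dots> \<le> (\<Sum>x\<in>D. exp (- real n * (a + 2 * e)))" using elim(1) by (intro sum_mono) auto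
    also have "\<dots> = (real (card D) * exp (- real n * e)) * exp (- real n * (a + e))"
      by (simp add: algebra_simps flip: exp_add)
    also have "\<dots> \<le> 1 * exp (- real n * (a + e))" by (intro mult_right_mono elim) auto
    finally show ?case by simp
  qed
  with e(1) show ?thesis by blast
qed

lemma mass_upper:
  assumes "closed F" "\<And>x. x \<in> F \<Longrightarrow> \<exists>u. u \<bullet> x - f u > a"
  shows "\<forall>\<^sub>F n in sequentially. mass n F \<le> exp (- real n * a)"
proof -
  obtain e where e: "e > 0" "\<forall>\<^sub>F n in sequentially. tilt 0 n F \<le> exp (- real n * (a + e))"
    using tilt_upper_strict[of F a 0] assms by auto
  from e(2) show ?thesis
  proof eventually_elim
    case (elim n)
    also have "exp (- real n * (a + e)) \<le> exp (- real n * a)" using e(1) by (auto intro!: mult_left_mono)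
    finally show ?case by (simp add: mass_eq_tilt)
  qed
qed

text \<open>The total tilted mass is about \<open>exp (n f \<eta>)\<close>. By uniqueness of
  \<open>y\<close>, each other point has a half-space beating the rate \<open>- f \<eta>\<close>, so
  the mass outside a small ball is smaller by an exponential factor. The tilted mass thus sits near
  \<open>y\<close>, where undoing the tilt costs about
  \<open>exp (- n (\<eta> \<bullet> y))\<close>.\<close>

lemma exposed_lower:
  assumes y: "\<And>x. (\<And>u. u \<bullet> x - f (\<eta> + u) \<le> - f \<eta>) \<Longrightarrow> x = y"
    and G: "open G" "y \<in> G" and e: "e > 0"
  shows "\<forall>\<^sub>F n in sequentially. mass n G \<ge> exp (- real n * (\<eta> \<bullet> y - f \<eta> + e))"
proof -
  obtain r where r: "r > 0" "ball y r \<subseteq> G" using G by (meson openE)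
  \<comment> \<open>On \<open>ball y d\<close> the exponent of the tilt differs from
    \<open>\<eta> \<bullet> y\<close> by at most \<open>e / 2\<close>; the \<open>+ 1\<close> covers
    \<open>\<eta> = 0\<close>.\<close>
  define d where "d = min r (e / (2 * (norm \<eta> + 1)))"
  have pos: "norm \<eta> + 1 > 0" by (simp add: add_nonneg_pos)
  have d: "d > 0" "d \<le> r" "norm \<eta> * d \<le> e / 2"
  proof -
    show "d > 0" "d \<le> r" using r e pos by (auto simp: d_def)
    have "norm \<eta> * d \<le> norm \<eta> * (e / (2 * (norm \<eta> + 1)))"
      by (intro mult_left_mono) (auto simp: d_def)
    also have "\<dots> \<le> e / 2" using pos e by (simp add: field_simps)
    finally show "norm \<eta> * d \<le> e / 2" .
  qed
  have "\<exists>u. u \<bullet> x - f (\<eta> + u) > - f \<eta>" if "x \<in> - ball y d" for x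
    using y[of x] that d(1) by (force simp: not_le)
  from tilt_upper_strict[OF _ this, of "- ball y d"]
  obtain b where b: "b > 0" "\<forall>\<^sub>F n in sequentially. tilt \<eta> n (- ball y d) \<le> exp (- real n * (- f \<eta> + b))"
    by (auto simp: closed_Compl)
  \<comment> \<open>\<open>c < b\<close> lets the total beat the complement of the ball, and
    \<open>c < e / 2\<close> leaves room to absorb the subtraction.\<close>
  define c where "c = min (b / 2) (e / 4)"
  have c: "c > 0" "c < b" "c \<le> e / 4" using b e by (auto simp: c_def)
  have "\<forall>\<^sub>F n :: nat in sequentially. exp (real n * (f \<eta> - c)) - exp (- real n * (- f \<eta> + b)) \<ge> exp (real n * (f \<eta> - e / 2))"
  proof -
    have "\<forall>\<^sub>F n :: nat in sequentially. exp (- real n * (b - c)) + exp (- real n * (e / 2 - c)) \<le> 1"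
    proof -
      have "b - c > 0" "e / 2 - c > 0" using c e by auto
      then have "(\<lambda>n :: nat. exp (- real n * (b - c)) + exp (- real n * (e / 2 - c))) \<longlonglongrightarrow> 0 + 0"
        by (intro tendsto_add exp_decay)
      then show ?thesis by (rule eventually_mono[OF order_tendstoD(2)[where a = 1]]) auto
    qed
    then show ?thesis
    proof eventually_elim
      case (elim n)
      have "exp (real n * (f \<eta> - c)) * (exp (- real n * (b - c)) + exp (- real n * (e / 2 - c))) \<le> exp (real n * (f \<eta> - c)) * 1"
        by (intro mult_left_mono elim) auto
      then show ?case by (simp add: distrib_left algebra_simps flip: exp_add)
    qed
  qed
  with growth_lower[OF c(1), of \<eta>] b(2)
  show ?thesis
  proof eventually_elim
    case (elim n)
    have "exp (real n * (f \<eta> - c)) \<le> tilt \<eta> n UNIV" using elim(1) by (simp add: tilt_def)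
    also have "\<dots> \<le> tilt \<eta> n (ball y d) + tilt \<eta> n (- ball y d)"
      using tilt_Un[of \<eta> n "ball y d" "- ball y d"] by simp
    finally have 1: "exp (real n * (f \<eta> - e / 2)) \<le> tilt \<eta> n (ball y d)" using elim by linarith
    have "tilt \<eta> n (ball y d) \<le> mass n (ball y d) * exp (real n * (\<eta> \<bullet> y + e / 2))"
      unfolding mass_def tilt_def sum_distrib_right
    proof (rule sum_mono)
      fix w assume w: "w \<in> {w\<in>W n. X n w \<in> ball y d}"
      have "\<eta> \<bullet> (X n w - y) \<le> norm \<eta> * norm (X n w - y)" by (rule norm_cauchy_schwarz)
      also have "\<dots> \<le> norm \<eta> * d" using w by (intro mult_left_mono) (auto simp: dist_norm norm_minus_commute)
      finally have "\<eta> \<bullet> X n w \<le> \<eta> \<bullet> y + e / 2" using d(3) by (simp add: inner_diff_right)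
      then show "q n w * exp (real n * (\<eta> \<bullet> X n w)) \<le> q n w * exp (real n * (\<eta> \<bullet> y + e / 2))"
        using w q_nonneg by (auto intro!: mult_left_mono)
    qed
    also have "mass n (ball y d) \<le> mass n G"
      unfolding mass_eq_tilt using r d by (intro tilt_mono) auto
    finally have "tilt \<eta> n (ball y d) \<le> mass n G * exp (real n * (\<eta> \<bullet> y + e / 2))"
      by (simp add: mult_right_mono)
    with 1 have "exp (real n * (f \<eta> - e / 2)) / exp (real n * (\<eta> \<bullet> y + e / 2)) \<le> mass n G"
      by (simp add: field_simps)
    also have "exp (real n * (f \<eta> - e / 2)) / exp (real n * (\<eta> \<bullet> y + e / 2)) = exp (- real n * (\<eta> \<bullet> y - f \<eta> + e))"
      by (simp add: algebra_simps flip: exp_diff)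
    finally show ?case .
  qed
qed

text \<open>On points of norm at most \<open>M\<close> the deformation by \<open>u\<close> costs at
  most the factor \<open>exp (n M |u|)\<close>. The bound is linear in the norm of \<open>u\<close>,
  so a quadratic penalty makes \<open>u \<bullet> x - f u\<close> attain its maximum.\<close>

lemma growth_linear_lower: "f 0 - M * norm u \<le> f u"
proof (rule field_le_epsilon)
  fix e :: real assume "e > 0"
  then have e2: "e / 2 > 0" by simp
  have "\<forall>\<^sub>F n in sequentially. f 0 - M * norm u \<le> f u + e"
    using growth_upper[OF e2, of u] growth_lower[OF e2, of 0] eventually_gt_at_top[of 0]
  proof eventually_elim
    case (elim n)
    have "exp (real n * (f 0 - e / 2)) * exp (- real n * (M * norm u)) \<le> (\<Sum>w\<in>W n. q n w) * exp (- real n * (M * norm u))"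
      using elim(2) by (intro mult_right_mono) auto
    also have "\<dots> \<le> (\<Sum>w\<in>W n. q n w * exp (real n * (u \<bullet> X n w)))"
      unfolding sum_distrib_right
    proof (rule sum_mono)
      fix w assume w: "w \<in> W n"
      have "- (u \<bullet> X n w) \<le> norm u * norm (X n w)" using norm_cauchy_schwarz[of "- u" "X n w"] by simp
      also have "\<dots> \<le> norm u * M" by (intro mult_left_mono bounded[OF w]) auto
      finally have "real n * (- (M * norm u)) \<le> real n * (u \<bullet> X n w)" by (intro mult_left_mono) (auto simp: mult.commute)
      then show "q n w * exp (- real n * (M * norm u)) \<le> q n w * exp (real n * (u \<bullet> X n w))"
        using q_nonneg[OF w] by (intro mult_left_mono) auto
    qed
    also have "\<dots> \<le> exp (real n * (f u + e / 2))" by (rule elim)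
    finally have "real n * (f 0 - e / 2 - M * norm u) \<le> real n * (f u + e / 2)"
      by (simp add: algebra_simps flip: exp_add)
    then show ?case using elim(3) by (simp add: mult_le_cancel_left)
  qed
  then show "f 0 - M * norm u \<le> f u + e" by (simp add: eventually_const_iff)
qed

text \<open>If \<open>f\<close> is differentiable, the maximiser \<open>\<eta>\<close> of \<open>u \<mapsto> \<langle>u, x\<rangle> - f u - t \<bar>u\<bar>\<^sup>2 / 2\<close> has gradient
  \<open>x - t \<eta>\<close>, a point which is exposed by \<open>\<eta>\<close>, close to \<open>x\<close> and of no larger rate.\<close>

lemma differentiable_lower:
  assumes diff: "\<And>u. f differentiable (at u)"
    and l: "\<And>u. u \<bullet> x - f u \<le> l" and G: "open G" "x \<in> G" and e: "e > 0"
  shows "\<forall>\<^sub>F n in sequentially. mass n G \<ge> exp (- real n * (l + e))"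
proof -
  have K0: "0 \<le> l + f 0" using l[of 0] by simp
  obtain r where r: "r > 0" "ball x r \<subseteq> G" using G by (meson openE)
  \<comment> \<open>Maximality will give \<open>t / 2 * |\<eta>|^2 \<le> l + f 0\<close>, so the
    squared norm of \<open>t \<eta>\<close> is at most \<open>2 t (l + f 0)\<close>, which this
    \<open>t\<close> brings below \<open>r^2\<close>. The \<open>+ 1\<close> covers
    \<open>l + f 0 = 0\<close>.\<close>
  define t where "t = r\<^sup>2 / (4 * (l + f 0 + 1))"
  have t0: "t > 0" using r K0 by (simp add: t_def)
  define g where "g u = u \<bullet> x - f u - t / 2 * (norm u)\<^sup>2" for u
  have contf: "continuous_on UNIV f"
    using diff by (simp add: differentiable_imp_continuous_on differentiable_on_def differentiable_at_withinI)
  have contg: "continuous_on UNIV g"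
    unfolding g_def by (intro continuous_intros contf)
  \<comment> \<open>From radius \<open>R\<close> on, the quadratic term outweighs the linear bounds,
    so a maximum over the ball is global.\<close>
  define R where "R = 2 * (norm x + \<bar>M\<bar>) / t + 1"
  have far: "g u < g 0" if u: "norm u \<ge> R" for u
  proof -
    have "R > 0" using t0 by (simp add: R_def add_nonneg_pos)
    then have "norm u > 0" using u by linarith
    have "g u \<le> norm u * norm x - f u - t / 2 * (norm u)\<^sup>2"
      using norm_cauchy_schwarz[of u x] by (simp add: g_def)
    also have "\<dots> \<le> norm u * norm x - f 0 + M * norm u - t / 2 * (norm u)\<^sup>2"
      using growth_linear_lower[of u] by simp
    also have "\<dots> \<le> g 0 + norm u * (norm x + \<bar>M\<bar> - t / 2 * norm u)"
      using mult_right_mono[of M "\<bar>M\<bar>" "norm u"] by (simp add: g_def algebra_simps power2_eq_square)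
    also have "\<dots> < g 0"
    proof -
      have "norm x + \<bar>M\<bar> < t / 2 * norm u"
        using u t0 by (simp add: R_def field_simps)
      then show ?thesis using \<open>norm u > 0\<close> by (simp add: mult_pos_neg)
    qed
    finally show ?thesis .
  qed
  have R0: "R \<ge> 0" using t0 by (simp add: R_def)
  obtain \<eta> where "\<forall>u\<in>cball 0 R. g u \<le> g \<eta>"
    using continuous_attains_sup[of "cball 0 R" g] continuous_on_subset[OF contg, of "cball 0 R"] R0 by auto
  then have \<eta>: "g u \<le> g \<eta>" if "norm u \<le> R" for u using that by simp
  have max: "g u \<le> g \<eta>" for u
    using \<eta>[of u] \<eta>[of 0] far[of u] R0 by fastforce
  define y where "y = x - t *\<^sub>R \<eta>"
  obtain f' where f': "(f has_derivative f') (at \<eta>)" using diff differentiable_def by blast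
  have "((\<lambda>u. u \<bullet> x - f u - t / 2 * (u \<bullet> u)) has_derivative (\<lambda>h. h \<bullet> x - f' h - t / 2 * (\<eta> \<bullet> h + h \<bullet> \<eta>))) (at \<eta>)"
    by (auto intro!: derivative_eq_intros f')
  then have "(\<lambda>h. h \<bullet> x - f' h - t / 2 * (\<eta> \<bullet> h + h \<bullet> \<eta>)) = (\<lambda>h. 0)"
    by (rule differential_zero_maxmin[OF UNIV_I open_UNIV])
       (use max in \<open>auto simp: g_def power2_norm_eq_inner\<close>)
  then have grad: "f' h = h \<bullet> y" for h
    by (drule_tac fun_cong[of _ _ h]) (simp add: y_def inner_diff_right inner_commute[of \<eta>])
  \<comment> \<open>A subgradient at a point of differentiability is the gradient:
    \<open>u \<bullet> z - f u\<close> is maximal at \<open>\<eta>\<close>.\<close>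
  have uniq: "z = y" if z: "\<And>u. u \<bullet> z - f (\<eta> + u) \<le> - f \<eta>" for z
  proof -
    have "((\<lambda>u. u \<bullet> z - f u) has_derivative (\<lambda>h. h \<bullet> z - f' h)) (at \<eta>)"
      by (auto intro!: derivative_eq_intros f')
    moreover have "u \<bullet> z - f u \<le> \<eta> \<bullet> z - f \<eta>" for u
      using z[of "u - \<eta>"] by (simp add: inner_diff_left)
    ultimately have "(\<lambda>h. h \<bullet> z - f' h) = (\<lambda>h. 0)"
      by (intro differential_zero_maxmin[OF UNIV_I open_UNIV]) auto
    then have "(z - y) \<bullet> (z - y) = 0" using grad
      by (drule_tac fun_cong[of _ _ "z - y"]) (simp add: inner_diff_right)
    then show ?thesis by simp
  qed
  have small: "t / 2 * (norm \<eta>)\<^sup>2 \<le> l + f 0"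
    using max[of 0] l[of \<eta>] by (simp add: g_def)
  have "norm (t *\<^sub>R \<eta>) < r"
  proof (rule power2_less_imp_less)
    have "(norm (t *\<^sub>R \<eta>))\<^sup>2 = 2 * t * (t / 2 * (norm \<eta>)\<^sup>2)"
      using t0 by (simp add: power_mult_distrib power2_eq_square)
    also have "\<dots> \<le> 2 * t * (l + f 0)" using small t0 by (intro mult_left_mono) auto
    also have "\<dots> \<le> r\<^sup>2 / 2" using K0 by (simp add: t_def field_simps)
    also have "\<dots> < r\<^sup>2" using r by simp
    finally show "(norm (t *\<^sub>R \<eta>))\<^sup>2 < r\<^sup>2" .
  qed (use r in auto)
  then have "y \<in> G" using r by (auto simp: y_def dist_norm)
  have "\<forall>\<^sub>F n in sequentially. mass n G \<ge> exp (- real n * (\<eta> \<bullet> y - f \<eta> + e))"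
    by (rule exposed_lower[OF _ G(1) \<open>y \<in> G\<close> e]) (rule uniq)
  then show ?thesis
  proof eventually_elim
    case (elim n)
    \<comment> \<open>Since \<open>\<eta> \<bullet> y = \<eta> \<bullet> x - t |\<eta>|^2\<close>,
      replacing \<open>x\<close> by \<open>y\<close> can only lower the exponent.\<close>
    have "\<eta> \<bullet> y - f \<eta> \<le> l" 
    proof -
      have "0 \<le> t * (\<eta> \<bullet> \<eta>)" using t0 by simp
      then show ?thesis using l[of \<eta>] by (simp add: y_def inner_diff_right del: mult_nonneg_nonneg)
    qed
    then have "exp (- real n * (l + e)) \<le> exp (- real n * (\<eta> \<bullet> y - f \<eta> + e))"
      by (auto intro!: mult_left_mono)
    with elim show ?case by linarith
  qed
qed

end


subsection \<open>Spectral radius and growth of iterates\<close>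

lemma mat_mult_nth [simp]: "(mat c ** X) $ i $ j = c * (X :: complex^'n^'n) $ i $ j"
  by (simp add: matrix_matrix_mult_def mat_def if_distrib[of "\<lambda>x. x * _"] cong: if_cong)

lemma norm_mat_mult: "norm (mat c ** (X :: complex^'n^'n)) = cmod c * norm X"
proof -
  have row: "norm ((mat c ** X) $ i) = cmod c * norm (X $ i)" for i
    by (simp add: norm_vec_def norm_mult L2_set_right_distrib)
  show ?thesis
    by (simp add: norm_vec_def[of "mat c ** X"] row L2_set_right_distrib norm_vec_def[of X])
qed

text \<open>Complex scalars act on matrices as \<open>mat c ** X\<close>, the convention of
  \<open>op_spectrum\<close>; the locale says that \<open>T\<close> is complex linear and preserves
  the complex subspace \<open>W\<close>.\<close>

locale complex_operator =
  fixes W :: "(complex^'n^'n) set" and T :: "complex^'n^'n \<Rightarrow> complex^'n^'n"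
  assumes W_zero: "0 \<in> W" and W_add: "X \<in> W \<Longrightarrow> Y \<in> W \<Longrightarrow> X + Y \<in> W"
    and W_scale: "X \<in> W \<Longrightarrow> mat c ** X \<in> W"
    and T_add: "T (X + Y) = T X + T Y" and T_scale: "T (mat c ** X) = mat c ** T X"
    and T_W: "X \<in> W \<Longrightarrow> T X \<in> W"
begin

lemma mat_neg: "mat (- 1) ** (X :: complex^'n^'n) = - X"
  by (simp add: vec_eq_iff)

lemma mat_real: "c *\<^sub>R (X :: complex^'n^'n) = mat (of_real c) ** X"
  by (simp add: vec_eq_iff scaleR_conv_of_real[where 'a = complex])

lemma W_diff: "X \<in> W \<Longrightarrow> Y \<in> W \<Longrightarrow> X - Y \<in> W"
  using W_add[of X "- Y"] W_scale[of Y "- 1"] by (simp add: mat_neg)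

lemma T_zero [simp]: "T 0 = 0"
  using T_add[of 0 0] by simp

lemma T_diff: "T (X - Y) = T X - T Y"
  using T_add[of X "- Y"] T_scale[of "- 1" Y] by (simp add: mat_neg)

lemma subspace_W: "subspace W"
  by (simp add: subspace_def W_zero W_add mat_real W_scale)

lemma linear_T: "linear T"
  by (intro linearI) (simp_all add: T_add mat_real T_scale)

lemma linear_shift: "linear (\<lambda>X. T X - mat c ** X)"
  by (intro linear_compose_sub linear_T bounded_linear.linear[OF bounded_linear_matrix_mult_left])

lemma shift_W: "X \<in> W \<Longrightarrow> T X - mat c ** X \<in> W"
  by (simp add: W_diff T_W W_scale)

text \<open>In finite dimension an injective endomorphism of \<open>W\<close> is bijective. The
  dimensions are counted over the reals, where the shifted operator is linear too.\<close>

lemma spectrum_iff: "\<mu> \<in> op_spectrum W T \<longleftrightarrow> (\<exists>X\<in>W. X \<noteq> 0 \<and> T X = mat \<mu> ** X)"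
proof -
  define g where "g X = T X - mat \<mu> ** X" for X
  have lin: "linear g" unfolding g_def by (rule linear_shift)
  have gW: "g ` W \<subseteq> W" by (auto simp: g_def shift_W)
  have "bij_betw g W W \<longleftrightarrow> inj_on g W"
  proof
    assume "inj_on g W"
    moreover have "g ` W = W"
    proof (rule subspace_dim_equal)
      show "subspace (g ` W)" "subspace W" using lin subspace_W by (auto intro: linear_subspace_image)
      show "g ` W \<subseteq> W" by (rule gW)
      show "dim W \<le> dim (g ` W)"
        using dim_image_eq[OF lin, of W] \<open>inj_on g W\<close> subspace_W by (simp add: span_eq_iff[THEN iffD2])
    qed
    ultimately show "bij_betw g W W" by (simp add: bij_betw_def)
  qed (simp add: bij_betw_def)
  also have "inj_on g W \<longleftrightarrow> (\<forall>X\<in>W. g X = 0 \<longrightarrow> X = 0)"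
    using linear_inj_on_iff_eq_0[OF lin subspace_W] .
  finally show ?thesis by (auto simp: op_spectrum_def g_def[abs_def])
qed

lemma iterate_eigenvector: "T X = mat \<mu> ** X \<Longrightarrow> (T ^^ n) X = mat (\<mu> ^ n) ** X"
proof (induction n)
  case (Suc n)
  then have "(T ^^ Suc n) X = mat (\<mu> ^ n) ** (mat \<mu> ** X)" by (simp add: T_scale)
  then show ?case by (simp add: vec_eq_iff)
qed (simp add: vec_eq_iff)

lemma bdd_above_spectrum: "bdd_above (cmod ` op_spectrum W T)"
proof -
  obtain K where K: "\<And>X. norm (T X) \<le> norm X * K"
    using linear_conv_bounded_linear[THEN iffD1, OF linear_T] bounded_linear.bounded by blast
  have "cmod \<mu> \<le> K" if mu: "\<mu> \<in> op_spectrum W T" for \<mu>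
  proof -
    obtain X where "X \<noteq> 0" "T X = mat \<mu> ** X" using mu unfolding spectrum_iff by auto
    then show ?thesis using K[of X] by (simp add: norm_mat_mult mult.commute)
  qed
  then show ?thesis by (auto intro!: bdd_aboveI[of _ K])
qed

lemma spectrum_le_radius: "\<mu> \<in> op_spectrum W T \<Longrightarrow> cmod \<mu> \<le> op_spectral_radius W T"
  unfolding op_spectral_radius_def by (intro cSup_upper) (auto simp: bdd_above_spectrum)

lemma spectrum_near_radius:
  assumes "0 \<le> a" "a < op_spectral_radius W T" shows "\<exists>\<mu>\<in>op_spectrum W T. a < cmod \<mu>"
  using assms less_cSup_iff[of "insert 0 (cmod ` op_spectrum W T)" a] bdd_above_spectrum
  unfolding op_spectral_radius_def by auto

text \<open>The vector \<open>p(T) X\<close>, evaluated by Horner's scheme.\<close>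

definition pev :: "complex poly \<Rightarrow> complex^'n^'n \<Rightarrow> complex^'n^'n" where
  "pev p X = fold_coeffs (\<lambda>a Y. mat a ** X + T Y) p 0"

lemma mat_zero_mult [simp]: "mat 0 ** (X :: complex^'n^'n) = 0"
  by (simp add: vec_eq_iff)

lemma pev_0 [simp]: "pev 0 X = 0"
  by (simp add: pev_def)

lemma pev_pCons: "pev (pCons a p) X = mat a ** X + T (pev p X)"
  by (cases "p = 0 \<and> a = 0") (auto simp: pev_def)

lemma pev_add: "pev (p + q) X = pev p X + pev q X"
proof (induction p q rule: poly_induct2)
  case (pCons a p b q)
  then show ?case by (simp add: pev_pCons T_add) (simp add: vec_eq_iff algebra_simps)
qed simp

lemma pev_smult: "pev (smult c p) X = mat c ** pev p X"
proof (induction p)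
  case (pCons a p)
  then show ?case by (simp add: pev_pCons T_scale) (simp add: vec_eq_iff algebra_simps)
qed simp

lemma pev_sum: "pev (\<Sum>i\<in>S. p i) X = (\<Sum>i\<in>S. pev (p i) X)"
  by (induction S rule: infinite_finite_induct) (simp_all add: pev_add)

lemma pev_monom: "pev (monom a n) X = mat a ** (T ^^ n) X"
  by (induction n) (simp_all add: monom_0 monom_Suc pev_pCons T_scale)

lemma pev_T: "pev p (T X) = T (pev p X)"
  by (induction p) (simp_all add: pev_pCons T_add T_scale)

lemma pev_diff_scale: "pev p (Y - mat c ** X) = pev p Y - mat c ** pev p X"
proof (induction p)
  case (pCons a p)
  then show ?case by (simp add: pev_pCons T_diff T_scale) (simp add: vec_eq_iff algebra_simps)
qed simp

lemma pev_linear_factor: "pev ([:- z, 1:] * p) X = T (pev p X) - mat z ** pev p X"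
proof -
  have "[:- z, 1:] * p = smult (- z) p + pCons 0 p" by simp
  then have "pev ([:- z, 1:] * p) X = mat (- z) ** pev p X + T (pev p X)"
    by (simp only: pev_add pev_smult pev_pCons) simp
  then show ?thesis by (simp add: vec_eq_iff)
qed

lemma pev_in_W: "X \<in> W \<Longrightarrow> pev p X \<in> W"
  by (induction p) (simp_all add: pev_pCons W_zero W_add W_scale T_W)

text \<open>One more iterate than the real dimension forces a linear relation, and real coefficients
  are enough. A repeated iterate is treated apart, since the set of iterates then loses an
  element.\<close>

lemma annihilating_poly: "\<exists>p. p \<noteq> 0 \<and> pev p X = 0"
proof -
  define N where "N = DIM(complex^'n^'n)"
  define g where "g k = (T ^^ k) X" for k
  have "\<exists>c :: nat \<Rightarrow> real. (\<exists>k\<le>N. c k \<noteq> 0) \<and> (\<Sum>k\<le>N. c k *\<^sub>R g k) = 0"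
  proof (cases "inj_on g {..N}")
    case True
    then have "card (g ` {..N}) = Suc N" by (simp add: card_image)
    then have "dependent (g ` {..N})"
      using independent_bound[of "g ` {..N}"] by (auto simp: N_def)
    then obtain u where u: "\<exists>v\<in>g ` {..N}. u v \<noteq> 0" "(\<Sum>v\<in>g ` {..N}. u v *\<^sub>R v) = 0"
      using dependent_finite[of "g ` {..N}"] by auto
    then show ?thesis
      by (intro exI[of _ "u \<circ> g"]) (auto simp: sum.reindex[OF True])
  next
    case False
    then obtain i j where ij: "i \<le> N" "j \<le> N" "i \<noteq> j" "g i = g j" by (auto simp: inj_on_def)
    define c where "c k = (if k = i then 1 else 0) - (if k = j then 1 else 0 :: real)" for k
    have "(\<Sum>k\<le>N. c k *\<^sub>R g k) = g i - g j"
      using ij by (simp add: c_def scaleR_left_diff_distrib sum_subtractf if_distrib[of "\<lambda>x. x *\<^sub>R _"] cong: if_cong)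
    then show ?thesis using ij by (intro exI[of _ c]) (auto simp: c_def)
  qed
  then obtain c :: "nat \<Rightarrow> real" and k where c: "k \<le> N" "c k \<noteq> 0" "(\<Sum>k\<le>N. c k *\<^sub>R g k) = 0" by auto
  define p where "p = (\<Sum>k\<le>N. monom (complex_of_real (c k)) k)"
  have "coeff p k = of_real (c k)" using c(1) by (simp add: p_def coeff_sum)
  then have "p \<noteq> 0" using c(2) by auto
  moreover have "pev p X = 0"
    using c(3) by (simp add: p_def pev_sum pev_monom g_def mat_real)
  ultimately show ?thesis by blast
qed

text \<open>One root \<open>z\<close> is split off at a time. If \<open>z\<close> is not in the
  spectrum, \<open>T - z\<close> is injective on \<open>W\<close> and its factor can be cancelled.
  Otherwise \<open>|z| < R\<close>; then \<open>Y = (T - z) X\<close> has an annihilator of smaller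
  degree, and the recursion \<open>T^(n+1) X = z T^n X + T^n Y\<close> preserves the bound. The gap
  between \<open>|z|\<close> and \<open>R\<close> absorbs the polynomial factors that Jordan blocks
  would produce.\<close>

lemma iterate_growth_poly:
  assumes R: "op_spectral_radius W T < R"
  shows "p \<noteq> 0 \<Longrightarrow> X \<in> W \<Longrightarrow> pev p X = 0 \<Longrightarrow> \<exists>C. \<forall>n. cmod ((T ^^ n) X $ i $ j) \<le> C * R ^ n"
proof (induction "degree p" arbitrary: p X)
  case 0
  then obtain c where "p = [:c:]" "c \<noteq> 0" by (metis degree_eq_zeroE pCons_0_0)
  then have "X = 0" using 0 by (simp add: pev_pCons vec_eq_iff)
  moreover have "(T ^^ n) 0 = 0" for n by (induction n) simp_all
  ultimately show ?case by (intro exI[of _ 0]) simp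
next
  case (Suc d)
  then obtain z where "poly p z = 0"
    using fundamental_theorem_of_algebra[of p] constant_degree[of p] by auto
  then obtain q where q: "p = [:- z, 1:] * q" by (metis dvdE poly_eq_0_iff_dvd)
  with Suc.prems have "q \<noteq> 0" by auto
  then have d: "d = degree q" 
    using Suc.hyps(2) degree_mult_eq[of "[:- z, 1:]" q] unfolding q by (simp del: mult_pCons_left)
  show ?case
  proof (cases "z \<in> op_spectrum W T")
    case False
    have "T (pev q X) = mat z ** pev q X" using Suc.prems(3) unfolding q pev_linear_factor by simp
    then have "pev q X = 0"
      using False pev_in_W[OF Suc.prems(2), of q] unfolding spectrum_iff by auto
    with Suc.hyps(1)[OF d \<open>q \<noteq> 0\<close> Suc.prems(2)] show ?thesis by simp
  next
    case True
    then have z: "cmod z < R" using spectrum_le_radius R by force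
    define Y where "Y = T X - mat z ** X"
    have "pev q Y = 0" using Suc.prems(3) unfolding Y_def q pev_diff_scale pev_T pev_linear_factor .
    moreover have "Y \<in> W" using Suc.prems by (simp add: Y_def shift_W)
    ultimately obtain C where C: "\<And>n. cmod ((T ^^ n) Y $ i $ j) \<le> C * R ^ n"
      using Suc.hyps(1)[OF d \<open>q \<noteq> 0\<close>] by blast
    have step: "(T ^^ Suc n) X = mat z ** (T ^^ n) X + (T ^^ n) Y" for n
      by (induction n) (simp_all add: Y_def T_add T_scale T_diff)
    \<comment> \<open>Chosen so that \<open>|z| C' + C \<le> R C'\<close> closes the induction; the
      first entry of the maximum covers \<open>n = 0\<close>.\<close>
    define C' where "C' = max (cmod (X $ i $ j)) (C / (R - cmod z))"
    have C': "C \<le> C' * (R - cmod z)" using z by (simp add: C'_def flip: pos_divide_le_eq)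
    have R0: "R \<ge> 0" using z by (meson dual_order.trans less_imp_le norm_ge_zero)
    have "cmod ((T ^^ n) X $ i $ j) \<le> C' * R ^ n" for n
    proof (induction n)
      case (Suc n)
      have "cmod ((T ^^ Suc n) X $ i $ j) \<le> cmod z * cmod ((T ^^ n) X $ i $ j) + cmod ((T ^^ n) Y $ i $ j)"
        unfolding step by (simp add: norm_triangle_le norm_mult)
      also have "\<dots> \<le> cmod z * (C' * R ^ n) + C * R ^ n"
        by (intro add_mono mult_left_mono Suc C) auto
      also have "\<dots> \<le> cmod z * (C' * R ^ n) + C' * (R - cmod z) * R ^ n"
        using C' R0 by (intro add_left_mono mult_right_mono) auto
      also have "\<dots> = C' * R ^ Suc n" by (simp add: algebra_simps)
      finally show ?case .
    qed (simp add: C'_def)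
    then show ?thesis by blast
  qed
qed

lemma iterate_growth:
  assumes "op_spectral_radius W T < R" "X \<in> W"
  shows "\<exists>C. \<forall>n. cmod ((T ^^ n) X $ i $ j) \<le> C * R ^ n"
  using annihilating_poly[of X] iterate_growth_poly[OF assms(1) _ assms(2)] by blast

end


subsection \<open>Completely positive maps\<close>

text \<open>One family covers the channel and its dual, with \<open>c i = 1\<close>, and all
  deformations, with \<open>c i = exp (u \<bullet> s i)\<close>.\<close>

definition kraus_map :: "nat \<Rightarrow> (nat \<Rightarrow> real) \<Rightarrow> (nat \<Rightarrow> complex^'n^'n) \<Rightarrow> complex^'n^'n \<Rightarrow> complex^'n^'n" where
  "kraus_map v c K \<sigma> = (\<Sum>i=1..v. c i *\<^sub>R (K i ** \<sigma> ** cadj (K i)))"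

lemma channel_eq_kraus_map: "channel v L = kraus_map v (\<lambda>_. 1) L"
  by (simp add: fun_eq_iff channel_def kraus_map_def)

lemma kraus_map_form:
  "cinner x (kraus_map v c K \<sigma> *v y) = (\<Sum>i=1..v. c i *\<^sub>R cinner (cadj (K i) *v x) (\<sigma> *v (cadj (K i) *v y)))"
  by (simp add: kraus_map_def matrix_sum_vector cinner_sum_right matrix_scaleR_vector
      cinner_scaleR_right conj_form)

lemma kraus_map_add: "kraus_map v c K (\<sigma> + \<tau>) = kraus_map v c K \<sigma> + kraus_map v c K \<tau>"
  by (simp add: kraus_map_def matrix_add_ldistrib matrix_add_mult_left scaleR_add_right sum.distrib)

lemma kraus_map_scaleR: "kraus_map v c K (a *\<^sub>R \<sigma>) = a *\<^sub>R kraus_map v c K \<sigma>"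
  by (simp add: kraus_map_def matrix_scaleR_mult_left matrix_scaleR_mult_right scaleR_right.sum mult.commute)

lemma matrix_vector_scaleR: "A *v (c *\<^sub>R x) = c *\<^sub>R (A *v (x :: complex^'n))"
  by (simp add: vec_eq_iff matrix_vector_mult_def scaleR_right.sum)

lemma mult_mat_commute:
  fixes X Y :: "complex^'n^'n"
  shows "Y ** (mat a ** X) = mat a ** (Y ** X)"
proof -
  have entry: "(Y ** Z) $ i $ j = (\<Sum>k\<in>UNIV. Y $ i $ k * Z $ k $ j)" for i j and Z :: "complex^'n^'n"
    by (simp add: matrix_matrix_mult_def)
  show ?thesis unfolding vec_eq_iff mat_mult_nth entry by (simp add: sum_distrib_left mult_ac)
qed

lemma kraus_map_scale:
  fixes \<sigma> :: "complex^'n^'n"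
  shows "kraus_map v c K (mat a ** \<sigma>) = mat a ** kraus_map v c K \<sigma>"
proof -
  have "K i ** (mat a ** \<sigma>) ** B = mat a ** (K i ** \<sigma> ** B)" for i and B :: "complex^'n^'n"
    by (simp add: mult_mat_commute matrix_mul_assoc[symmetric])
  then show ?thesis
    by (simp add: kraus_map_def matrix_sum_mult_right matrix_scaleR_mult_right)
qed

lemma bounded_linear_kraus_map: "bounded_linear (kraus_map v c K)"
  by (rule linear_conv_bounded_linear[THEN iffD1], rule linearI) (simp_all add: kraus_map_add kraus_map_scaleR)

lemma bounded_linear_funpow:
  fixes T :: "'a \<Rightarrow> 'a :: real_normed_vector"
  assumes "bounded_linear T" shows "bounded_linear (T ^^ n)"
  by (induction n) (auto intro!: bounded_linear_ident bounded_linear_compose[OF assms] simp: comp_def id_def)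

lemma psd_kraus_map:
  "psd \<sigma> \<Longrightarrow> (\<And>i. i \<in> {1..v} \<Longrightarrow> 0 \<le> c i) \<Longrightarrow> psd (kraus_map v c K \<sigma>)"
  unfolding kraus_map_def by (intro psd_sum psd_scaleR psd_conj) auto

lemma psd_iterate_kraus_map:
  "psd \<sigma> \<Longrightarrow> (\<And>i. i \<in> {1..v} \<Longrightarrow> 0 \<le> c i) \<Longrightarrow> psd ((kraus_map v c K ^^ n) \<sigma>)"
  by (induction n) (auto intro: psd_kraus_map)

lemma trace_mult_le:
  assumes "psd \<sigma>" shows "cmod (trace (M ** \<sigma>)) \<le> (\<Sum>i\<in>UNIV. \<Sum>j\<in>UNIV. cmod (M $ i $ j)) * Re (trace \<sigma>)"
proof -
  have "cmod (trace (M ** \<sigma>)) \<le> (\<Sum>i\<in>UNIV. \<Sum>j\<in>UNIV. cmod (M $ i $ j * \<sigma> $ j $ i))"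
    unfolding trace_def matrix_matrix_mult_def
    by (simp, intro order_trans[OF norm_sum] sum_mono order_trans[OF norm_sum]) simp
  also have "\<dots> \<le> (\<Sum>i\<in>UNIV. \<Sum>j\<in>UNIV. cmod (M $ i $ j) * Re (trace \<sigma>))"
    by (intro sum_mono) (simp add: norm_mult mult_left_mono psd_entry_le_trace[OF assms])
  finally show ?thesis by (simp add: sum_distrib_right)
qed

text \<open>Cyclicity turns the trace of the image into \<open>trace (M ** \<sigma>)\<close> for a
  fixed matrix \<open>M\<close>. The bound lets finitely many time shifts be absorbed into a
  constant.\<close>

lemma trace_kraus_map_le: "\<exists>k\<ge>0. \<forall>\<sigma>. psd \<sigma> \<longrightarrow> Re (trace (kraus_map v c K \<sigma>)) \<le> k * Re (trace \<sigma>)"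
proof -
  define M where "M = (\<Sum>i=1..v. c i *\<^sub>R (cadj (K i) ** K i))"
  define k where "k = (\<Sum>i\<in>UNIV. \<Sum>j\<in>UNIV. cmod (M $ i $ j))"
  have "trace (kraus_map v c K \<sigma>) = trace (M ** \<sigma>)" for \<sigma>
  proof -
    have "trace (K i ** \<sigma> ** cadj (K i)) = trace (cadj (K i) ** K i ** \<sigma>)" for i
      using trace_mul_sym[of "K i ** \<sigma>" "cadj (K i)"] by (simp add: matrix_mul_assoc)
    then show ?thesis
      by (simp add: kraus_map_def M_def trace_sum trace_scaleR matrix_sum_mult_left matrix_scaleR_mult_left)
  qed
  then have "Re (trace (kraus_map v c K \<sigma>)) \<le> k * Re (trace \<sigma>)" if "psd \<sigma>" for \<sigma>
    using order_trans[OF complex_Re_le_cmod trace_mult_le[OF that, of M]] by (simp add: k_def)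
  moreover have "k \<ge> 0" unfolding k_def by (intro sum_nonneg) auto
  ultimately show ?thesis by blast
qed

lemma compact_unit_sphere: "vec.subspace (Q :: (complex^'n) set) \<Longrightarrow> compact {y\<in>Q. norm y = 1}"
  using closed_Int_compact[OF closed_subspace[OF subspace_real], of Q "sphere 0 1"]
  by (simp add: sphere_def dist_norm Int_def compact_sphere[of 0 1, unfolded sphere_def dist_norm, simplified])

lemma continuous_on_form: "continuous_on S (\<lambda>y. Re (cinner y (M *v y)))"
  by (intro continuous_intros continuous_on_cinner_mult)

text \<open>A positive continuous function on the compact unit sphere of \<open>Q\<close> has a
  positive minimum; homogeneity does the rest.\<close>

lemma form_lower_bound:
  assumes Q: "vec.subspace Q" and pos: "\<And>y. y \<in> Q \<Longrightarrow> y \<noteq> 0 \<Longrightarrow> 0 < Re (cinner y (M *v y))"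
  shows "\<exists>c>0. \<forall>y\<in>Q. c * (norm y)\<^sup>2 \<le> Re (cinner y (M *v y))"
proof -
  obtain c where c: "c > 0" "\<And>y. y \<in> Q \<Longrightarrow> norm y = 1 \<Longrightarrow> c \<le> Re (cinner y (M *v y))"
  proof (cases "{y\<in>Q. norm y = 1} = {}")
    case True then show ?thesis using that[of 1] by auto
  next
    case False
    from continuous_attains_inf[OF compact_unit_sphere[OF Q] False continuous_on_form, of M]
    obtain y where y: "y \<in> Q" "norm y = 1" "\<forall>x\<in>{y\<in>Q. norm y = 1}. Re (cinner y (M *v y)) \<le> Re (cinner x (M *v x))"
      by auto
    then show ?thesis using pos[of y] by (cases "y = 0"; intro that[of "Re (cinner y (M *v y))"]) auto
  qed
  have "c * (norm y)\<^sup>2 \<le> Re (cinner y (M *v y))" if y: "y \<in> Q" for y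
  proof (cases "y = 0")
    case False
    define z where "z = (1 / norm y) *\<^sub>R y"
    have "z \<in> Q" using y subspace_real[OF Q] by (simp add: z_def subspace_scale)
    then have "c \<le> Re (cinner z (M *v z))" using False by (intro c) (simp_all add: z_def)
    also have "\<dots> = Re (cinner y (M *v y)) / (norm y)\<^sup>2"
      by (simp add: z_def cinner_scaleR_left cinner_scaleR_right matrix_vector_scaleR power2_eq_square)
    finally show ?thesis using False by (simp add: field_simps)
  qed simp
  with c(1) show ?thesis by blast
qed

text \<open>The assumption \<open>reach\<close> replaces irreducibility: no nonzero vector of
  \<open>Q\<close> is missed by all iterates of the initial operator \<open>\<tau>\<close>.\<close>

locale kraus_corner =
  fixes Q :: "(complex^'n) set" and v :: nat and c :: "nat \<Rightarrow> real" and K :: "nat \<Rightarrow> complex^'n^'n"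
    and \<tau> :: "complex^'n^'n"
  assumes Q: "vec.subspace Q" and c_nonneg: "i \<in> {1..v} \<Longrightarrow> 0 \<le> c i"
    and K_left: "orth_proj Q ** K i = K i"
    and \<tau>: "psd \<tau>" "\<tau> \<in> corner Q"
    and reach: "y \<in> Q \<Longrightarrow> (\<And>m. Re (cinner y ((kraus_map v c K ^^ m) \<tau> *v y)) = 0) \<Longrightarrow> y = 0"
begin

abbreviation "T \<equiv> kraus_map v c K"

lemma corner_iff: "\<sigma> \<in> corner Q \<longleftrightarrow> orth_proj Q ** \<sigma> = \<sigma> \<and> \<sigma> ** orth_proj Q = \<sigma>"
  unfolding corner_def mem_Collect_eq
  by (metis matrix_mul_assoc orth_proj_idem[OF Q])

sublocale complex_operator "corner Q" T
proof
  fix X assume X: "X \<in> corner Q"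
  have K_adj: "cadj (K i) ** orth_proj Q = cadj (K i)" for i
    using arg_cong[OF K_left[of i], of cadj] by (simp add: cadj_mult orth_proj_adj[OF Q])
  show "T X \<in> corner Q"
    unfolding corner_iff kraus_map_def
    by (simp add: matrix_sum_mult_left matrix_sum_mult_right matrix_scaleR_mult_left
        matrix_scaleR_mult_right K_adj matrix_mul_assoc K_left flip: matrix_mul_assoc[of _ "cadj _"])
  fix a show "mat a ** X \<in> corner Q"
  proof -
    show ?thesis using X unfolding corner_iff by (simp add: mult_mat_commute flip: matrix_mul_assoc)
  qed
qed (auto simp: corner_iff matrix_add_ldistrib matrix_add_mult_left kraus_map_add kraus_map_scale)

definition t :: "nat \<Rightarrow> real" where "t n = Re (trace ((T ^^ n) \<tau>))"

lemma psd_iterate: "psd \<sigma> \<Longrightarrow> psd ((T ^^ n) \<sigma>)"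
  by (intro psd_iterate_kraus_map c_nonneg)

lemma t_nonneg: "0 \<le> t n"
  unfolding t_def by (intro psd_trace psd_iterate \<tau>)

lemma t_upper:
  assumes R: "op_spectral_radius (corner Q) T < R" shows "\<exists>C. \<forall>n. t n \<le> C * R ^ n"
proof -
  have "\<forall>i. \<exists>C. \<forall>n. cmod ((T ^^ n) \<tau> $ i $ i) \<le> C * R ^ n"
    using iterate_growth[OF R \<tau>(2)] by blast
  then obtain C where C: "\<And>i n. cmod ((T ^^ n) \<tau> $ i $ i) \<le> C i * R ^ n" by metis
  have "t n \<le> (\<Sum>i\<in>UNIV. C i) * R ^ n" for n
    unfolding t_def trace_def sum_distrib_right
    by (simp, intro sum_mono order_trans[OF complex_Re_le_cmod C])
  then show ?thesis by blast
qed

text \<open>Finitely many iterates suffice by compactness of the unit sphere of \<open>Q\<close>.\<close>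

lemma positive_definite_sum:
  obtains D b where "finite D" "b > 0" "\<And>y. y \<in> Q \<Longrightarrow> b * (norm y)\<^sup>2 \<le> Re (cinner y ((\<Sum>m\<in>D. (T ^^ m) \<tau>) *v y))"
proof -
  define S where "S = {y\<in>Q. norm y = 1}"
  define H where "H m = {y. 0 < Re (cinner y ((T ^^ m) \<tau> *v y))}" for m
  have nonneg: "0 \<le> Re (cinner y ((T ^^ m) \<tau> *v y))" for m y
    by (intro psd_form_nonneg psd_iterate \<tau>)
  have "compact S" unfolding S_def by (rule compact_unit_sphere[OF Q])
  moreover have "S \<subseteq> (\<Union>m. H m)"
  proof
    fix y assume "y \<in> S"
    then have "y \<in> Q" "y \<noteq> 0" by (auto simp: S_def)
    then obtain m where "Re (cinner y ((T ^^ m) \<tau> *v y)) \<noteq> 0" using reach by blast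
    then show "y \<in> (\<Union>m. H m)" using nonneg[of y m] by (auto simp: H_def order_less_le)
  qed
  moreover have "open (H m)" for m
    unfolding H_def by (intro open_Collect_less continuous_intros continuous_on_form)
  ultimately obtain D where D: "finite D" "S \<subseteq> (\<Union>m\<in>D. H m)"
    by (metis compactE_image)
  define \<sigma> where "\<sigma> = (\<Sum>m\<in>D. (T ^^ m) \<tau>)"
  have form: "Re (cinner y (\<sigma> *v y)) = (\<Sum>m\<in>D. Re (cinner y ((T ^^ m) \<tau> *v y)))" for y
    by (simp add: \<sigma>_def matrix_sum_vector cinner_sum_right)
  have "0 < Re (cinner y (\<sigma> *v y))" if y: "y \<in> Q" "y \<noteq> 0" for y
  proof (rule ccontr)
    assume "\<not> ?thesis"
    then have "(\<Sum>m\<in>D. Re (cinner y ((T ^^ m) \<tau> *v y))) = 0"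
      using sum_nonneg[of D "\<lambda>m. Re (cinner y ((T ^^ m) \<tau> *v y))"] nonneg by (simp add: form)
    then have z: "\<forall>m\<in>D. Re (cinner y ((T ^^ m) \<tau> *v y)) = 0"
      using D(1) nonneg by (simp add: sum_nonneg_eq_0_iff)
    define z where "z = (1 / norm y) *\<^sub>R y"
    have "z \<in> S" using y subspace_real[OF Q] by (simp add: S_def z_def subspace_scale)
    then obtain m where "m \<in> D" "z \<in> H m" using D by auto
    then show False using z
      by (simp add: H_def z_def cinner_scaleR_left cinner_scaleR_right matrix_vector_scaleR)
  qed
  from form_lower_bound[OF Q this] D(1) that show ?thesis unfolding \<sigma>_def by blast
qed

text \<open>An eigenvector need be neither positive nor Hermitian, so domination is phrased for the
  sesquilinear form. In this shape it passes through every Kraus term, with \<open>x\<close> and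
  \<open>y\<close> replaced by their images under \<open>cadj (K i)\<close>.\<close>

lemma dominated_iterate:
  assumes "\<And>x y. cmod (cinner x (X *v y)) \<le> Re (cinner x (\<sigma> *v x)) + Re (cinner y (\<sigma> *v y))"
  shows "cmod (cinner x ((T ^^ n) X *v y)) \<le> Re (cinner x ((T ^^ n) \<sigma> *v x)) + Re (cinner y ((T ^^ n) \<sigma> *v y))"
proof (induction n arbitrary: x y)
  case (Suc n)
  define L where "L i = cadj (K i)" for i
  have "cmod (cinner x ((T ^^ Suc n) X *v y)) \<le> (\<Sum>i=1..v. c i * cmod (cinner (L i *v x) ((T ^^ n) X *v (L i *v y))))"
    unfolding funpow.simps comp_apply kraus_map_form L_def
    by (rule order_trans[OF norm_sum]) (auto intro!: sum_mono simp: c_nonneg)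
  also have "\<dots> \<le> (\<Sum>i=1..v. c i * (Re (cinner (L i *v x) ((T ^^ n) \<sigma> *v (L i *v x)))
      + Re (cinner (L i *v y) ((T ^^ n) \<sigma> *v (L i *v y)))))"
    by (intro sum_mono mult_left_mono Suc c_nonneg)
  also have "\<dots> = Re (cinner x ((T ^^ Suc n) \<sigma> *v x)) + Re (cinner y ((T ^^ Suc n) \<sigma> *v y))"
    by (simp add: kraus_map_form L_def sum.distrib distrib_left)
  finally show ?case .
qed (simp add: assms)

text \<open>The form of a corner element sees only the projections of \<open>x\<close> and
  \<open>y\<close> to \<open>Q\<close>, and their norms are controlled there by the faithful
  \<open>\<sigma>\<close>.\<close>

lemma corner_dominated:
  assumes X: "X \<in> corner Q" and \<sigma>: "\<sigma> \<in> corner Q"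
    and b: "b > 0" "\<And>y. y \<in> Q \<Longrightarrow> b * (norm y)\<^sup>2 \<le> Re (cinner y (\<sigma> *v y))"
  shows "\<exists>k>0. \<forall>x y. cmod (cinner x (X *v y)) \<le> k * (Re (cinner x (\<sigma> *v x)) + Re (cinner y (\<sigma> *v y)))"
proof -
  define p where "p = orth_proj Q"
  have p: "cadj p = p" "p ** X = X" "X ** p = X" "p ** \<sigma> = \<sigma>" "\<sigma> ** p = \<sigma>"
    using X \<sigma> Q by (auto simp: p_def orth_proj_adj corner_iff)
  obtain k where k: "k > 0" "\<And>y. norm (X *v y) \<le> norm y * k"
    using bounded_linear.pos_bounded[OF linear_conv_bounded_linear[THEN iffD1, OF matrix_vector_mul_linear[of X]]]
    by blast
  have low: "b * (norm (p *v y))\<^sup>2 \<le> Re (cinner y (\<sigma> *v y))" for y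
  proof -
    have "cinner (p *v y) (\<sigma> *v (p *v y)) = cinner y (\<sigma> *v y)"
      by (simp add: cinner_adj_left p matrix_vector_mul_assoc matrix_mul_assoc)
    then show ?thesis using b(2)[of "p *v y"] orth_proj_in[OF Q] by (simp add: p_def)
  qed
  have "cmod (cinner x (X *v y)) \<le> k / b * (Re (cinner x (\<sigma> *v x)) + Re (cinner y (\<sigma> *v y)))" for x y
  proof -
    have "cinner x (X *v y) = cinner (p *v x) (X *v (p *v y))"
      by (simp add: cinner_adj_left p matrix_vector_mul_assoc matrix_mul_assoc)
    also have "cmod \<dots> \<le> norm (p *v x) * (norm (p *v y) * k)"
      by (rule order_trans[OF norm_cinner_le]) (intro mult_left_mono k norm_ge_zero)
    also have "\<dots> = k * (norm (p *v x) * norm (p *v y))" by simp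
    also have "\<dots> \<le> k * ((norm (p *v x))\<^sup>2 + (norm (p *v y))\<^sup>2)"
    proof (intro mult_left_mono)
      show "norm (p *v x) * norm (p *v y) \<le> (norm (p *v x))\<^sup>2 + (norm (p *v y))\<^sup>2"
      proof -
        have "0 \<le> norm (p *v x) * norm (p *v y)" by simp
        then show ?thesis using sum_squares_bound[of "norm (p *v x)" "norm (p *v y)"] by linarith
      qed
    qed (use k in auto)
    also have "\<dots> = k / b * (b * (norm (p *v x))\<^sup>2 + b * (norm (p *v y))\<^sup>2)"
      using b by (simp add: field_simps)
    also have "\<dots> \<le> k / b * (Re (cinner x (\<sigma> *v x)) + Re (cinner y (\<sigma> *v y)))"
      using k b by (intro mult_left_mono add_mono low) auto
    finally show ?thesis .
  qed
  moreover have "k / b > 0" using k b by simp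
  ultimately show ?thesis by blast
qed

text \<open>The iterates of an eigenvector grow exactly like the powers of \<open>|\<mu>|\<close>
  and are dominated by those of a multiple of \<open>\<sigma>\<close>. As \<open>\<sigma>\<close> is
  a finite sum of iterates of \<open>\<tau>\<close>, its trace at time \<open>n\<close> is a finite
  sum of shifts \<open>t (n + m)\<close>, each at most a constant times \<open>t n\<close>.\<close>

lemma t_lower:
  assumes \<mu>: "\<mu> \<in> op_spectrum (corner Q) T" shows "\<exists>C>0. \<forall>n. cmod \<mu> ^ n \<le> C * t n"
proof -
  obtain X where X: "X \<in> corner Q" "X \<noteq> 0" "T X = mat \<mu> ** X" using \<mu> unfolding spectrum_iff by blast
  then obtain i j where ij: "X $ i $ j \<noteq> 0" by (auto simp: vec_eq_iff)
  obtain D b where D: "finite D" "b > 0"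
    "\<And>y. y \<in> Q \<Longrightarrow> b * (norm y)\<^sup>2 \<le> Re (cinner y ((\<Sum>m\<in>D. (T ^^ m) \<tau>) *v y))"
    by (rule positive_definite_sum) blast
  define \<sigma> where "\<sigma> = (\<Sum>m\<in>D. (T ^^ m) \<tau>)"
  have iter_W: "(T ^^ m) \<tau> \<in> corner Q" for m by (induction m) (auto simp: T_W \<tau>)
  have "\<sigma> \<in> corner Q" unfolding \<sigma>_def by (intro subspace_sum subspace_W iter_W)
  from corner_dominated[OF X(1) this D(2)] D(3)
  obtain k where k: "k > 0" "\<And>x y. cmod (cinner x (X *v y)) \<le> k * (Re (cinner x (\<sigma> *v x)) + Re (cinner y (\<sigma> *v y)))"
    unfolding \<sigma>_def by blast
  have dom: "cmod (cinner x ((T ^^ n) X *v y)) \<le> Re (cinner x ((T ^^ n) (k *\<^sub>R \<sigma>) *v x)) + Re (cinner y ((T ^^ n) (k *\<^sub>R \<sigma>) *v y))"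
    for x y n
    by (rule dominated_iterate)
       (use k in \<open>simp add: matrix_scaleR_vector cinner_scaleR_right distrib_left\<close>)
  have psd\<sigma>: "psd \<sigma>" unfolding \<sigma>_def by (intro psd_sum psd_iterate \<tau>)
  have lin: "linear (T ^^ n)" for n
    using bounded_linear_funpow[OF bounded_linear_kraus_map] bounded_linear.linear by blast
  obtain a where a: "a \<ge> 0" "\<And>\<sigma>. psd \<sigma> \<Longrightarrow> Re (trace (T \<sigma>)) \<le> a * Re (trace \<sigma>)"
    using trace_kraus_map_le by blast
  have t_add: "t (n + m) \<le> a ^ m * t n" for n m
  proof (induction m)
    case (Suc m)
    have "t (n + Suc m) \<le> a * t (n + m)" unfolding t_def
      using a(2)[OF psd_iterate[OF \<tau>(1), of "n + m"]] by simp
    also have "\<dots> \<le> a * (a ^ m * t n)" using Suc a by (intro mult_left_mono)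
    finally show ?case by (simp add: mult.assoc)
  qed simp
  \<comment> \<open>The \<open>2\<close> counts the two diagonal terms of the domination; the
    \<open>+ 1\<close> keeps \<open>C\<close> positive even if the sum vanishes.\<close>
  define C where "C = 2 * k * (\<Sum>m\<in>D. a ^ m) + 1"
  have "cmod \<mu> ^ n * cmod (X $ i $ j) \<le> C * t n" for n
  proof -
    have "cmod \<mu> ^ n * cmod (X $ i $ j) = cmod (cinner (axis i 1) ((T ^^ n) X *v axis j 1))"
      by (simp add: iterate_eigenvector[OF X(3)] norm_mult norm_power flip: matrix_nth_cinner)
    also have "\<dots> \<le> Re ((T ^^ n) (k *\<^sub>R \<sigma>) $ i $ i) + Re ((T ^^ n) (k *\<^sub>R \<sigma>) $ j $ j)"
      using dom[of "axis i 1" n "axis j 1"] by (simp flip: matrix_nth_cinner)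
    also have "\<dots> \<le> 2 * Re (trace ((T ^^ n) (k *\<^sub>R \<sigma>)))"
      using k psd\<sigma> psd_diag_le_trace[OF psd_iterate, of "k *\<^sub>R \<sigma>" n i] psd_diag_le_trace[OF psd_iterate, of "k *\<^sub>R \<sigma>" n j]
      by (simp add: psd_scaleR)
    also have "\<dots> = 2 * k * (\<Sum>m\<in>D. t (n + m))"
      by (simp add: linear_cmul[OF lin] \<sigma>_def linear_sum[OF lin] trace_scaleR trace_sum t_def funpow_add)
    also have "\<dots> \<le> 2 * k * (\<Sum>m\<in>D. a ^ m * t n)"
      using k by (intro mult_left_mono sum_mono t_add) auto
    also have "\<dots> \<le> C * t n"
      using t_nonneg[of n] by (simp add: C_def algebra_simps flip: sum_distrib_left sum_distrib_right)
    finally show ?thesis .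
  qed
  then have "cmod \<mu> ^ n \<le> C / cmod (X $ i $ j) * t n" for n
    using ij by (simp add: field_simps)
  moreover have "C > 0" using k a by (simp add: C_def add_nonneg_pos sum_nonneg)
  ultimately show ?thesis using ij by (intro exI[of _ "C / cmod (X $ i $ j)"]) auto
qed

lemma t_growth:
  assumes r: "op_spectral_radius (corner Q) T = r" "r > 0" and e: "e > 0"
  shows "\<forall>\<^sub>F n in sequentially. t n \<le> exp (real n * (ln r + e))"
    and "\<forall>\<^sub>F n in sequentially. t n \<ge> exp (real n * (ln r - e))"
proof -
  have large: "\<forall>\<^sub>F n in sequentially. C * exp (- real n * (e / 2)) \<le> 1" for C
  proof -
    have "(\<lambda>n. C * exp (- real n * (e / 2))) \<longlonglongrightarrow> 0"
      using tendsto_mult_right_zero[OF exp_decay[of "e / 2"]] e by simp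
    then show ?thesis by (rule eventually_mono[OF order_tendstoD(2)[where a = 1]]) auto
  qed
  have expn: "(r * exp x) ^ n = exp (real n * (ln r + x))" for x n
    using r by (simp add: exp_add exp_of_nat_mult)
  \<comment> \<open>The growth bounds require a base strictly above or strictly below
    \<open>r\<close>. Half of \<open>e\<close> buys that, and the other half absorbs the
    constants.\<close>
  have "r < r * exp (e / 2)" using r e by simp
  then obtain C where C: "\<And>n. t n \<le> C * (r * exp (e / 2)) ^ n" using t_upper r by metis
  show "\<forall>\<^sub>F n in sequentially. t n \<le> exp (real n * (ln r + e))"
    using large[of C]
  proof eventually_elim
    case (elim n)
    have "t n \<le> C * exp (real n * (ln r + e / 2))" using C[of n] by (simp add: expn)
    also have "\<dots> = (C * exp (- real n * (e / 2))) * exp (real n * (ln r + e))"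
      by (simp add: algebra_simps flip: exp_add)
    also have "\<dots> \<le> 1 * exp (real n * (ln r + e))" by (intro mult_right_mono elim) auto
    finally show ?case by simp
  qed
  have "r * exp (- (e / 2)) < r" using r e by simp
  then obtain \<mu> where \<mu>: "\<mu> \<in> op_spectrum (corner Q) T" "r * exp (- (e / 2)) < cmod \<mu>"
    using spectrum_near_radius[of "r * exp (- (e / 2))"] r by auto
  obtain C' where C': "C' > 0" "\<And>n. cmod \<mu> ^ n \<le> C' * t n" using t_lower[OF \<mu>(1)] by blast
  show "\<forall>\<^sub>F n in sequentially. t n \<ge> exp (real n * (ln r - e))"
    using large[of C']
  proof eventually_elim
    case (elim n)
    have "exp (real n * (ln r - e)) * C' = (C' * exp (- real n * (e / 2))) * exp (real n * (ln r + - (e / 2)))"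
      by (simp add: algebra_simps flip: exp_add)
    also have "\<dots> \<le> 1 * (r * exp (- (e / 2))) ^ n" unfolding expn by (intro mult_right_mono elim) auto
    also have "\<dots> \<le> cmod \<mu> ^ n" using \<mu>(2) r by (simp add: power_mono)
    also have "\<dots> \<le> C' * t n" by (rule C')
    finally show ?case using C'(1) by (simp add: mult.commute)
  qed
qed

end


subsection \<open>Kraus words\<close>

definition words :: "nat \<Rightarrow> nat \<Rightarrow> nat list set" where
  "words v n = {w. set w \<subseteq> {1..v} \<and> length w = n}"

lemma finite_words: "finite (words v n)"
  unfolding words_def by (rule finite_lists_length_eq) simp

lemma words_0: "words v 0 = {[]}"
  by (auto simp: words_def)

lemma words_Suc: "words v (Suc n) = (\<lambda>(w, j). w @ [j]) ` (words v n \<times> {1..v})"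
proof (intro set_eqI iffI)
  fix w assume w: "w \<in> words v (Suc n)"
  then obtain u j where "w = u @ [j]" by (cases w rule: rev_cases) (auto simp: words_def)
  with w show "w \<in> (\<lambda>(w, j). w @ [j]) ` (words v n \<times> {1..v})"
    by (intro image_eqI[of _ _ "(u, j)"]) (auto simp: words_def)
qed (auto simp: words_def)

lemma sum_words_Suc: "(\<Sum>w\<in>words v (Suc n). h w) = (\<Sum>w\<in>words v n. \<Sum>j=1..v. h (w @ [j]))"
proof -
  have "inj_on (\<lambda>(w, j). w @ [j]) (words v n \<times> {1..v})" by (auto simp: inj_on_def)
  then show ?thesis
    by (simp add: words_Suc sum.reindex sum.cartesian_product case_prod_unfold comp_def)
qed

lemma kraus_word_Nil [simp]: "kraus_word L [] = mat 1"
  by (simp add: kraus_word_def)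

lemma kraus_word_snoc: "kraus_word L (w @ [j]) = L j ** kraus_word L w"
  by (simp add: kraus_word_def)

text \<open>The bridge between operators and trajectories: with exponential coefficients, a word is
  weighted by the exponential of its total displacement.\<close>

lemma iterate_kraus_map:
  "(kraus_map v c L ^^ n) X
    = (\<Sum>w\<in>words v n. prod_list (map c w) *\<^sub>R (kraus_word L w ** X ** cadj (kraus_word L w)))"
proof (induction n)
  case (Suc n)
  define Z where "Z w = kraus_word L w ** X ** cadj (kraus_word L w)" for w
  have snoc: "L j ** Z w ** cadj (L j) = Z (w @ [j])" for w j
    by (simp add: Z_def kraus_word_snoc cadj_mult matrix_mul_assoc)
  have "(kraus_map v c L ^^ Suc n) X
      = (\<Sum>j=1..v. c j *\<^sub>R (L j ** (\<Sum>w\<in>words v n. prod_list (map c w) *\<^sub>R Z w) ** cadj (L j)))"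
    by (simp add: Suc kraus_map_def Z_def)
  also have "\<dots> = (\<Sum>j=1..v. \<Sum>w\<in>words v n. (prod_list (map c w) * c j) *\<^sub>R Z (w @ [j]))"
    by (simp add: matrix_sum_mult_left matrix_sum_mult_right matrix_scaleR_mult_left
        matrix_scaleR_mult_right scaleR_right.sum mult.commute snoc)
  also have "\<dots> = (\<Sum>w\<in>words v (Suc n). prod_list (map c w) *\<^sub>R Z w)"
    by (subst sum.swap) (simp add: sum_words_Suc)
  finally show ?case by (simp add: Z_def)
qed (simp add: words_0)

subsection \<open>Absorption operators\<close>

lemma dual_channel_eq_kraus_map: "dual_channel v L = kraus_map v (\<lambda>_. 1) (\<lambda>i. cadj (L i))"
  by (simp add: fun_eq_iff dual_channel_def kraus_map_def)

lemma dual_channel_form: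
  "cinner x (dual_channel v L M *v y) = (\<Sum>i=1..v. cinner (L i *v x) (M *v (L i *v y)))"
  by (simp add: dual_channel_eq_kraus_map kraus_map_form)

lemma trace_dual_channel: "trace (dual_channel v L M ** \<sigma>) = trace (M ** channel v L \<sigma>)"
proof -
  have "trace (cadj (L i) ** M ** L i ** \<sigma>) = trace (M ** (L i ** \<sigma> ** cadj (L i)))" for i
    using trace_mul_sym[of "cadj (L i)" "M ** L i ** \<sigma>"] by (simp add: matrix_mul_assoc)
  then show ?thesis
    by (simp add: dual_channel_def channel_def matrix_sum_mult_left matrix_sum_mult_right trace_sum)
qed

lemma trace_dual_channel_iterate: "trace ((dual_channel v L ^^ n) M ** \<sigma>) = trace (M ** (channel v L ^^ n) \<sigma>)"
proof (induction n arbitrary: M)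
  case (Suc n)
  have "(dual_channel v L ^^ Suc n) M = (dual_channel v L ^^ n) (dual_channel v L M)"
    by (simp add: funpow_swap1)
  then show ?case unfolding Suc by (simp add: Suc trace_dual_channel)
qed simp

lemma psd_limit:
  assumes "X \<longlonglongrightarrow> Y" "\<And>n. psd (X n)" shows "psd Y"
  unfolding psd_iff
proof (intro allI conjI)
  fix x
  have lim: "(\<lambda>n. cinner x (X n *v x)) \<longlonglongrightarrow> cinner x (Y *v x)"
    by (rule bounded_linear.tendsto[OF bounded_linear_cinner_mult assms(1)])
  show "0 \<le> Re (cinner x (Y *v x))"
    using assms(2) by (intro tendsto_lowerbound[OF tendsto_Re[OF lim]]) (auto simp: psd_iff)
  show "Im (cinner x (Y *v x)) = 0"
    using tendsto_Im[OF lim] assms(2) by (simp add: psd_iff LIMSEQ_const_iff)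
qed

text \<open>The entries of a positive difference are bounded by its trace, so the bounded increasing
  traces make every entry a Cauchy sequence.\<close>

lemma monotone_psd_convergent:
  fixes X :: "nat \<Rightarrow> complex^'n^'n"
  assumes mono: "\<And>n. psd (X (Suc n) - X n)" and bound: "\<And>n. Re (trace (X n)) \<le> b"
  shows "convergent X"
proof -
  define a where "a n = Re (trace (X n))" for n
  have diff: "psd (X m - X n)" if "n \<le> m" for m n
    using that
  proof (induction m rule: dec_induct)
    case (step m)
    from psd_add[OF mono[of m] step(3)] show ?case by simp
  qed simp
  have inc: "incseq a"
    using psd_trace(1)[OF mono] by (intro incseq_SucI) (simp add: a_def trace_sub)
  have "\<forall>n. a n \<le> b" using bound by (simp add: a_def)
  from incseq_convergent[OF inc this] obtain l where "a \<longlonglongrightarrow> l" by blast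
  then have "convergent a" by (rule convergentI)
  then have ca: "Cauchy a" by (rule convergent_Cauchy)
  have "Cauchy (\<lambda>n. X n $ i $ j)" for i j
    unfolding Cauchy_altdef2
  proof (intro allI impI)
    fix e :: real assume "e > 0"
    then obtain N where N: "\<And>n. n \<ge> N \<Longrightarrow> dist (a n) (a N) < e" using ca unfolding Cauchy_altdef2 by blast
    have "dist (X n $ i $ j) (X N $ i $ j) < e" if "n \<ge> N" for n
    proof -
      have "dist (X n $ i $ j) (X N $ i $ j) \<le> a n - a N"
        using psd_entry_le_trace[OF diff[OF that], of i j] by (simp add: dist_norm a_def trace_sub)
      also have "\<dots> < e" using N[OF that] by (simp add: dist_real_def)
      finally show ?thesis .
    qed
    then show "\<exists>N. \<forall>n\<ge>N. dist (X n $ i $ j) (X N $ i $ j) < e" by blast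
  qed
  then have "\<forall>i j. \<exists>l. (\<lambda>n. X n $ i $ j) \<longlonglongrightarrow> l" by (simp add: Cauchy_convergent_iff convergent_def)
  then obtain l where l: "\<And>i j. (\<lambda>n. X n $ i $ j) \<longlonglongrightarrow> l i j" by metis
  have "X \<longlonglongrightarrow> (\<chi> i j. l i j)" by (intro vec_tendstoI) (simp add: l)
  then show ?thesis by (rule convergentI)
qed

text \<open>Enclosures are defined through positive operators; testing with the rank-one operator of
  \<open>x\<close> yields invariance under each Kraus operator, since \<open>L i *v x\<close> lies
  in the support of the image.\<close>

lemma enclosure_invariant:
  assumes U: "enclosure v L U" and x: "x \<in> U" and i: "i \<in> {1..v}"
  shows "L i *v x \<in> U"
proof -
  have sub: "vec.subspace U" using U by (simp add: enclosure_def)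
  have "supp (outer x) \<subseteq> U"
  proof
    fix y assume y: "y \<in> supp (outer x)"
    show "y \<in> U"
    proof (cases "x = 0")
      case True
      then have "cinner y y = 0" using y by (auto simp: supp_def outer_mult)
      then show ?thesis using sub by (simp add: vec.subspace_0)
    next
      case False
      define a where "a = cinner x y / cinner x x"
      define z where "z = y - a *s x"
      have xz: "cinner x z = 0" using False by (simp add: z_def a_def cinner_diff_right cinner_scale_right)
      then have "cinner z y = 0" using y by (simp add: supp_def outer_mult)
      moreover have "cinner z x = 0" using xz cinner_eq_0_commute by blast
      moreover have "cinner z z = cinner z y - a * cinner z x"
        by (subst (2) z_def) (simp add: cinner_diff_right cinner_scale_right)
      ultimately have "cinner z z = 0" by simp
      then have "y = a *s x" by (simp add: z_def)
      then show ?thesis using sub x by (simp add: vec.subspace_scale)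
    qed
  qed
  then have sup: "supp (channel v L (outer x)) \<subseteq> U"
    using U psd_outer[of x] by (auto simp: enclosure_def)
  have "L i *v x \<in> supp (channel v L (outer x))"
    unfolding supp_def mem_Collect_eq
  proof (intro allI impI)
    fix z assume "channel v L (outer x) *v z = 0"
    then have "Re (cinner z (channel v L (outer x) *v z)) = 0" by simp
    moreover have "Re (cinner z (channel v L (outer x) *v z)) = (\<Sum>i=1..v. (cmod (cinner (L i *v x) z))\<^sup>2)"
      by (simp add: channel_def conj_outer matrix_sum_vector cinner_sum_right outer_form)
    ultimately have "(cmod (cinner (L i *v x) z))\<^sup>2 = 0"
      using i sum_nonneg_eq_0_iff[of "{1..v}" "\<lambda>i. (cmod (cinner (L i *v x) z))\<^sup>2"] by simp
    then show "cinner z (L i *v x) = 0" by (simp add: cinner_eq_0_commute)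
  qed
  with sup show ?thesis by blast
qed

lemma trace_mult_mono:
  assumes "psd (N - M)" "psd X" shows "Re (trace (M ** X)) \<le> Re (trace (N ** X))"
  using trace_psd_mult_psd(1)[OF assms] by (simp add: matrix_diff_mult_left trace_sub)

locale trace_preserving =
  fixes v :: nat and L :: "nat \<Rightarrow> complex^'n^'n"
  assumes normalised: "(\<Sum>i=1..v. cadj (L i) ** L i) = mat 1"
begin

lemma dual_channel_1: "dual_channel v L (mat 1) = mat 1"
  unfolding dual_channel_def by (simp only: matrix_mul_rid normalised)

lemma dual_channel_iterate_linear: "linear (dual_channel v L ^^ n)"
  unfolding dual_channel_eq_kraus_map
  using bounded_linear_kraus_map bounded_linear_funpow bounded_linear.linear by blast+

lemma psd_dual_channel_iterate: "psd M \<Longrightarrow> psd ((dual_channel v L ^^ n) M)"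
  unfolding dual_channel_eq_kraus_map by (rule psd_iterate_kraus_map) simp_all

lemma norm_kraus_sum: "(\<Sum>i=1..v. (norm (L i *v x))\<^sup>2) = (norm x)\<^sup>2"
proof -
  have "complex_of_real (\<Sum>i=1..v. (norm (L i *v x))\<^sup>2) = of_real ((norm x)\<^sup>2)"
    using dual_channel_form[of x v L "mat 1" x] by (simp add: dual_channel_1 cinner_self)
  then show ?thesis by (simp only: of_real_eq_iff)
qed

lemma trace_channel: "trace (channel v L \<sigma>) = trace \<sigma>"
  using trace_dual_channel[of v L "mat 1" \<sigma>] by (simp add: dual_channel_1)

lemma trace_channel_iterate: "trace ((channel v L ^^ n) \<sigma>) = trace \<sigma>"
  by (induction n) (simp_all add: trace_channel)

lemma psd_channel_iterate: "psd \<sigma> \<Longrightarrow> psd ((channel v L ^^ n) \<sigma>)"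
  unfolding channel_eq_kraus_map by (rule psd_iterate_kraus_map) simp_all

end

lemma norm_orth_proj_residual:
  assumes "vec.subspace U"
  shows "(norm (orth_proj U *v x))\<^sup>2 + (norm (x - orth_proj U *v x))\<^sup>2 = (norm x)\<^sup>2"
proof -
  define y where "y = orth_proj U *v x"
  have "cinner (x - y) y = 0" unfolding y_def by (rule orth_proj_residual[OF assms orth_proj_in[OF assms]])
  then have "(x - y) \<bullet> y = 0" by (metis Re_cinner zero_complex.simps(1))
  then have "(norm (y + (x - y)))\<^sup>2 = (norm y)\<^sup>2 + (norm (x - y))\<^sup>2"
    by (simp add: power2_norm_eq_inner inner_add inner_commute inner_diff)
  then show ?thesis by (simp add: y_def)
qed

lemma psd_1_minus_orth_proj: "vec.subspace U \<Longrightarrow> psd (mat 1 - orth_proj U)"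
proof -
  assume U: "vec.subspace U"
  have "cinner x ((mat 1 - orth_proj U) *v x) = of_real ((norm (x - orth_proj U *v x))\<^sup>2)" for x
    by (simp add: matrix_vector_mult_diff_rdistrib cinner_diff_right orth_proj_form[OF U] cinner_self
        flip: norm_orth_proj_residual[OF U, of x])
  then show ?thesis by (simp add: psd_iff)
qed

locale trace_preserving_enclosure = trace_preserving v L
  for v :: nat and L :: "nat \<Rightarrow> complex^'n^'n" +
  fixes U :: "(complex^'n) set"
  assumes enclosure: "enclosure v L U"
begin

lemma subspace_U: "vec.subspace U"
  using enclosure by (simp add: enclosure_def)

text \<open>As the Kraus operators preserve \<open>U\<close>, the part of \<open>L i *v x\<close>
  outside \<open>U\<close> comes only from \<open>y = x - p *v x\<close>. Its total squared norm is
  thus at most that of \<open>y\<close>, so the part outside \<open>U\<close> never grows.\<close>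

lemma psd_dual_channel_orth_proj_increase: "psd (dual_channel v L (orth_proj U) - orth_proj U)"
proof -
  define p where "p = orth_proj U"
  have pU: "\<And>x. p *v x \<in> U" "\<And>x. x \<in> U \<Longrightarrow> p *v x = x"
    using subspace_U by (simp_all add: p_def orth_proj_in orth_proj_fix)
  have split: "(norm (p *v x))\<^sup>2 = (norm x)\<^sup>2 - (norm (x - p *v x))\<^sup>2" for x
    using norm_orth_proj_residual[OF subspace_U, of x] by (simp add: p_def)
  have dual: "cinner x (dual_channel v L p *v x) = of_real (\<Sum>i=1..v. (norm (p *v (L i *v x)))\<^sup>2)" for x
    by (simp add: dual_channel_form orth_proj_form[OF subspace_U] p_def)
  have le: "(norm (p *v x))\<^sup>2 \<le> (\<Sum>i=1..v. (norm (p *v (L i *v x)))\<^sup>2)" for x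
  proof -
    define y where "y = x - p *v x"
    have "(norm (L i *v x - p *v (L i *v x)))\<^sup>2 \<le> (norm (L i *v y))\<^sup>2" if "i \<in> {1..v}" for i
    proof -
      have "p *v (L i *v (p *v x)) = L i *v (p *v x)"
        by (intro pU enclosure_invariant[OF enclosure _ that])
      then have "L i *v x - p *v (L i *v x) = L i *v y - p *v (L i *v y)"
        by (simp add: y_def matrix_vector_mult_diff_distrib)
      then show ?thesis using split[of "L i *v y"] zero_le_power2[of "norm (p *v (L i *v y))"]
        by (simp only:)
    qed
    then have "(\<Sum>i=1..v. (norm (L i *v x - p *v (L i *v x)))\<^sup>2) \<le> (\<Sum>i=1..v. (norm (L i *v y))\<^sup>2)"
      by (rule sum_mono)
    then have "(\<Sum>i=1..v. (norm (L i *v x))\<^sup>2) - (\<Sum>i=1..v. (norm (p *v (L i *v x)))\<^sup>2) \<le> (norm y)\<^sup>2"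
      by (simp add: split[of "L _ *v x"] norm_kraus_sum[simplified] sum_subtractf)
    then show ?thesis using split[of x] by (simp add: norm_kraus_sum[simplified] y_def)
  qed
  show ?thesis
    unfolding psd_iff p_def[symmetric]
    using le by (simp add: matrix_vector_mult_diff_rdistrib cinner_diff_right dual)
      (simp add: p_def orth_proj_form[OF subspace_U])
qed

lemma psd_1_minus_iterate: "psd (mat 1 - (dual_channel v L ^^ n) (orth_proj U))"
proof -
  have "(dual_channel v L ^^ n) (mat 1) = mat 1" by (induction n) (simp_all add: dual_channel_1)
  then show ?thesis
    using psd_dual_channel_iterate[OF psd_1_minus_orth_proj[OF subspace_U], of n]
    by (simp add: linear_diff[OF dual_channel_iterate_linear])
qed

text \<open>The iterates increase and stay below the identity. This convergence is what gives the
  \<open>lim\<close> in \<open>absorption\<close> its meaning.\<close>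

lemma absorption_LIMSEQ: "(\<lambda>n. (dual_channel v L ^^ n) (orth_proj U)) \<longlonglongrightarrow> absorption v L U"
proof -
  define X where "X n = (dual_channel v L ^^ n) (orth_proj U)" for n
  have "psd (X (Suc n) - X n)" for n
    using psd_dual_channel_iterate[OF psd_dual_channel_orth_proj_increase, of n]
    by (simp add: X_def linear_diff[OF dual_channel_iterate_linear] funpow_swap1)
  moreover have "Re (trace (X n)) \<le> Re (trace (mat 1 :: complex^'n^'n))" for n
    using psd_trace(1)[OF psd_1_minus_iterate[of n]] by (simp add: X_def trace_sub)
  ultimately have "convergent X" by (rule monotone_psd_convergent)
  then show ?thesis by (simp add: X_def[abs_def] absorption_def convergent_LIMSEQ_iff)
qed

lemma psd_absorption: "psd (absorption v L U)"
  by (rule psd_limit[OF absorption_LIMSEQ]) (intro psd_dual_channel_iterate psd_orth_proj subspace_U)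

lemma psd_1_minus_absorption: "psd (mat 1 - absorption v L U)"
  by (rule psd_limit[OF tendsto_diff[OF tendsto_const absorption_LIMSEQ]]) (rule psd_1_minus_iterate)

lemma absorption_harmonic: "dual_channel v L (absorption v L U) = absorption v L U"
proof (rule LIMSEQ_unique)
  have "bounded_linear (dual_channel v L)"
    unfolding dual_channel_eq_kraus_map by (rule bounded_linear_kraus_map)
  from bounded_linear.tendsto[OF this absorption_LIMSEQ]
  show "(\<lambda>n. (dual_channel v L ^^ Suc n) (orth_proj U)) \<longlonglongrightarrow> dual_channel v L (absorption v L U)" by simp
  show "(\<lambda>n. (dual_channel v L ^^ Suc n) (orth_proj U)) \<longlonglongrightarrow> absorption v L U"
    by (rule LIMSEQ_Suc[OF absorption_LIMSEQ])
qed

lemma absorption_iterate: "(dual_channel v L ^^ n) (absorption v L U) = absorption v L U"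
  by (induction n) (simp_all add: absorption_harmonic)

lemma trace_absorption_iterate:
  "trace (absorption v L U ** (channel v L ^^ n) \<sigma>) = trace (absorption v L U ** \<sigma>)"
  by (simp add: absorption_iterate flip: trace_dual_channel_iterate)

text \<open>By duality every iterate of the projection has the same trace against an invariant
  operator as the projection itself.\<close>

lemma trace_absorption_invariant:
  assumes "channel v L \<tau> = \<tau>" shows "trace (absorption v L U ** \<tau>) = trace (orth_proj U ** \<tau>)"
proof (rule LIMSEQ_unique)
  have "bounded_linear (\<lambda>M. trace (M ** \<tau>))"
    by (intro bounded_linear_compose[OF bounded_linear_trace] bounded_linear_matrix_mult_right)
  from bounded_linear.tendsto[OF this absorption_LIMSEQ]
  show "(\<lambda>n. trace ((dual_channel v L ^^ n) (orth_proj U) ** \<tau>)) \<longlonglongrightarrow> trace (absorption v L U ** \<tau>)" .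
  have "(channel v L ^^ n) \<tau> = \<tau>" for n by (induction n) (simp_all add: assms)
  then show "(\<lambda>n. trace ((dual_channel v L ^^ n) (orth_proj U) ** \<tau>)) \<longlonglongrightarrow> trace (orth_proj U ** \<tau>)"
    by (simp add: trace_dual_channel_iterate)
qed

text \<open>By harmonicity the form at \<open>x\<close> is the sum of the nonnegative forms at the
  vectors \<open>L i *v x\<close>; if it vanishes, so does each of them.\<close>

lemma absorption_kernel_invariant:
  assumes "absorption v L U *v x = 0" "i \<in> {1..v}" shows "absorption v L U *v (L i *v x) = 0"
proof (rule psd_form_eq_0[OF psd_absorption])
  have "(\<Sum>i=1..v. Re (cinner (L i *v x) (absorption v L U *v (L i *v x)))) = 0"
    using dual_channel_form[of x v L "absorption v L U" x] assms(1)
    by (simp add: absorption_harmonic flip: Re_sum)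
  then show "Re (cinner (L i *v x) (absorption v L U *v (L i *v x))) = 0"
    using assms(2) by (subst (asm) sum_nonneg_eq_0_iff) (auto simp: psd_form_nonneg psd_absorption)
qed

end

subsection \<open>The absorption operators add up to the identity\<close>

lemma norm_matrix_le: "norm (X :: complex^'n^'n) \<le> (\<Sum>i\<in>UNIV. \<Sum>j\<in>UNIV. cmod (X $ i $ j))"
proof -
  have "norm X \<le> (\<Sum>i\<in>UNIV. norm (X $ i))" unfolding norm_vec_def[of X] by (rule L2_set_le_sum) simp
  also have "\<dots> \<le> (\<Sum>i\<in>UNIV. \<Sum>j\<in>UNIV. cmod (X $ i $ j))"
    by (intro sum_mono) (simp add: norm_vec_def L2_set_le_sum)
  finally show ?thesis .
qed

lemma psd_norm_le: "psd (X :: complex^'n^'n) \<Longrightarrow> norm X \<le> (real CARD('n))\<^sup>2 * Re (trace X)"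
proof -
  assume X: "psd X"
  have "norm X \<le> (\<Sum>i\<in>(UNIV :: 'n set). \<Sum>j\<in>(UNIV :: 'n set). Re (trace X))"
    by (rule order_trans[OF norm_matrix_le]) (intro sum_mono psd_entry_le_trace X)
  then show ?thesis by (simp add: power2_eq_square mult.assoc)
qed

context trace_preserving
begin

text \<open>Cesaro means are nearly invariant because their defect telescopes, and their traces
  against a harmonic \<open>B\<close> do not depend on \<open>n\<close>.\<close>

lemma invariant_cesaro_limit:
  assumes X: "psd X"
  obtains \<tau> where "psd \<tau>" "trace \<tau> = trace X" "channel v L \<tau> = \<tau>"
    "\<And>B. dual_channel v L B = B \<Longrightarrow> trace (B ** \<tau>) = trace (B ** X)"
proof -
  define S where "S n = (1 / real (Suc n)) *\<^sub>R (\<Sum>k<Suc n. (channel v L ^^ k) X)" for n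
  have psdS: "psd (S n)" for n
    unfolding S_def by (intro psd_scaleR psd_sum psd_channel_iterate X) auto
  have const: "trace (B ** S n) = trace (B ** X)" if "dual_channel v L B = B" for B n
  proof -
    have "(dual_channel v L ^^ k) B = B" for k by (induction k) (simp_all add: that)
    then have "trace (B ** (channel v L ^^ k) X) = trace (B ** X)" for k
      by (metis trace_dual_channel_iterate)
    then show ?thesis
      by (simp add: S_def matrix_scaleR_mult_right matrix_sum_mult_right trace_scaleR trace_sum
          scaleR_conv_of_real[where 'a = complex] del: sum.lessThan_Suc of_nat_Suc)
  qed
  have "bounded (range S)"
    using psd_norm_le[OF psdS] const[OF dual_channel_1] by (auto simp: bounded_iff)
  \<comment> \<open>A subsequence is enough: only some invariant operator with the prescribed traces
    is wanted.\<close>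
  then obtain \<tau> r where r: "strict_mono r" "(S \<circ> r) \<longlonglongrightarrow> \<tau>"
    using bounded_imp_convergent_subsequence by blast
  have limB: "trace (B ** \<tau>) = trace (B ** X)" if B: "dual_channel v L B = B" for B
  proof (rule LIMSEQ_unique)
    have "bounded_linear (\<lambda>M. trace (B ** M))"
      by (intro bounded_linear_compose[OF bounded_linear_trace] bounded_linear_matrix_mult_left)
    from bounded_linear.tendsto[OF this r(2)]
    show "(\<lambda>n. trace (B ** (S \<circ> r) n)) \<longlonglongrightarrow> trace (B ** \<tau>)" .
    show "(\<lambda>n. trace (B ** (S \<circ> r) n)) \<longlonglongrightarrow> trace (B ** X)" by (simp add: const[OF B])
  qed
  have linc: "linear (channel v L)"
    unfolding channel_eq_kraus_map using bounded_linear_kraus_map bounded_linear.linear by blast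
  have diff: "channel v L (S n) - S n = (1 / real (Suc n)) *\<^sub>R ((channel v L ^^ Suc n) X - X)" for n
  proof -
    have "channel v L (S n) = (1 / real (Suc n)) *\<^sub>R (\<Sum>k<Suc n. (channel v L ^^ Suc k) X)"
      by (simp add: S_def linear_cmul[OF linc] linear_sum[OF linc] del: sum.lessThan_Suc of_nat_Suc)
    then have "channel v L (S n) - S n = (1 / real (Suc n)) *\<^sub>R (\<Sum>k<Suc n. (channel v L ^^ Suc k) X - (channel v L ^^ k) X)"
      by (simp add: S_def sum_subtractf scaleR_right_diff_distrib del: sum.lessThan_Suc of_nat_Suc)
    then show ?thesis
      using sum_lessThan_telescope[of "\<lambda>k. (channel v L ^^ k) X" "Suc n"]
      by (simp del: sum.lessThan_Suc of_nat_Suc funpow.simps)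
  qed
  have "(\<lambda>n. channel v L (S n) - S n) \<longlonglongrightarrow> 0"
  proof (rule Lim_null_comparison)
    define b where "b = (real CARD('n))\<^sup>2 * Re (trace X) + norm X"
    show "\<forall>\<^sub>F n in sequentially. norm (channel v L (S n) - S n) \<le> b * (1 / real (Suc n))"
    proof (rule always_eventually, rule allI)
      fix n
      have "norm ((channel v L ^^ Suc n) X - X) \<le> b"
        using norm_triangle_ineq4[of "(channel v L ^^ Suc n) X" X] psd_norm_le[OF psd_channel_iterate[OF X], of "Suc n"]
        by (simp add: b_def trace_channel trace_channel_iterate)
      then show "norm (channel v L (S n) - S n) \<le> b * (1 / real (Suc n))"
        unfolding diff by (simp add: divide_right_mono del: funpow.simps)
    qed
    show "(\<lambda>n. b * (1 / real (Suc n))) \<longlonglongrightarrow> 0"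
      using LIMSEQ_inverse_real_of_nat by (intro tendsto_mult_right_zero) (simp add: inverse_eq_divide)
  qed
  from LIMSEQ_subseq_LIMSEQ[OF this r(1)]
  have 1: "(\<lambda>n. channel v L ((S \<circ> r) n) - (S \<circ> r) n) \<longlonglongrightarrow> 0" by (simp add: comp_def)
  have "bounded_linear (channel v L)" unfolding channel_eq_kraus_map by (rule bounded_linear_kraus_map)
  from tendsto_diff[OF bounded_linear.tendsto[OF this r(2)] r(2)] 1
  have "channel v L \<tau> - \<tau> = 0" by (rule LIMSEQ_unique)
  moreover have "psd \<tau>" by (rule psd_limit[OF r(2)]) (simp add: psdS)
  moreover have "trace \<tau> = trace X" using limB[OF dual_channel_1] by simp
  ultimately show ?thesis using limB that by simp
qed

text \<open>Harmonicity replaces \<open>X\<close> by an invariant \<open>\<tau>\<close>, and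
  invariance then replaces each absorption operator by the projection onto its enclosure. The range
  of \<open>\<tau>\<close> lies in the fast recurrent space, on which these projections add up to
  the identity.\<close>

lemma sum_absorption:
  assumes J: "finite J" and encl: "\<And>j. j \<in> J \<Longrightarrow> enclosure v L (U j)"
    and orth: "\<And>i j. i \<in> J \<Longrightarrow> j \<in> J \<Longrightarrow> i \<noteq> j \<Longrightarrow> orth (U i) (U j)"
    and rec: "fast_recurrent v L \<subseteq> vec.span (\<Union>j\<in>J. U j)" and X: "psd X"
  shows "(\<Sum>j\<in>J. trace (absorption v L (U j) ** X)) = trace X"
proof -
  obtain \<tau> where \<tau>: "psd \<tau>" "trace \<tau> = trace X" "channel v L \<tau> = \<tau>"
    "\<And>B. dual_channel v L B = B \<Longrightarrow> trace (B ** \<tau>) = trace (B ** X)"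
    using invariant_cesaro_limit[OF X] by blast
  have sub: "vec.subspace (U j)" if "j \<in> J" for j using encl[OF that] by (simp add: enclosure_def)
  have enc: "trace_preserving_enclosure v L (U j)" if "j \<in> J" for j
    using encl[OF that] by unfold_locales
  define p where "p = (\<Sum>j\<in>J. orth_proj (U j))"
  have fix_rec: "p *v x = x" if "x \<in> vec.span (\<Union>j\<in>J. U j)" for x
    using that
  proof (induction rule: vec.span_induct_alt)
    case (step c x y)
    then obtain i where i: "i \<in> J" "x \<in> U i" by auto
    have "orth_proj (U j) *v x = (if j = i then x else 0)" if "j \<in> J" for j
      using i that orth[of i j] sub by (auto simp: orth_proj_fix orth_def intro!: orth_proj_orth)
    then have "p *v x = x"
      using i J by (simp add: p_def matrix_sum_vector)
    then show ?case using step by (simp add: matrix_vector_right_distrib vector_scalar_commute)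
  qed simp
  have "p ** \<tau> = \<tau>"
  \<comment> \<open>The fast recurrent space is spanned by supports of normalised states, hence the
    rescaling below, which is possible unless \<open>\<tau>\<close> vanishes.\<close>
  proof (cases "Re (trace \<tau>) = 0")
    case True then show ?thesis using psd_trace_0[OF \<tau>(1)] by simp
  next
    case False
    define a where "a = 1 / Re (trace \<tau>)"
    have a: "a > 0" using False psd_trace(1)[OF \<tau>(1)] by (simp add: a_def)
    define \<sigma> where "\<sigma> = a *\<^sub>R \<tau>"
    have "psd \<sigma>" using a \<tau>(1) by (simp add: \<sigma>_def psd_scaleR)
    moreover have "trace \<sigma> = 1"
    proof -
      have "trace \<sigma> = of_real (a * Re (trace \<tau>))"
        unfolding \<sigma>_def trace_scaleR
        by (subst psd_trace(2)[OF \<tau>(1)]) (simp add: scaleR_conv_of_real[where 'a = complex])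
      then show ?thesis using False by (simp add: a_def)
    qed
    moreover have "channel v L \<sigma> = \<sigma>"
      using \<tau>(3) by (simp add: \<sigma>_def channel_eq_kraus_map kraus_map_scaleR)
    ultimately have "supp \<sigma> \<subseteq> fast_recurrent v L"
      unfolding fast_recurrent_def by (auto intro!: vec.span_base)
    then have "p *v (\<sigma> *v x) = \<sigma> *v x" for x
      using fix_rec rec mult_in_supp[OF psd_hermitian[OF \<open>psd \<sigma>\<close>]] by blast
    then have "p ** \<sigma> = \<sigma>" by (simp add: matrix_eq matrix_vector_mul_assoc)
    then show ?thesis using a by (simp add: \<sigma>_def matrix_scaleR_mult_right)
  qed
  then have "trace \<tau> = (\<Sum>j\<in>J. trace (orth_proj (U j) ** \<tau>))"
    by (metis p_def matrix_sum_mult_left trace_sum)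
  also have "\<dots> = (\<Sum>j\<in>J. trace (absorption v L (U j) ** X))"
  proof (rule sum.cong[OF refl])
    fix j assume "j \<in> J"
    then interpret trace_preserving_enclosure v L "U j" by (rule enc)
    show "trace (orth_proj (U j) ** \<tau>) = trace (absorption v L (U j) ** X)"
      using trace_absorption_invariant[OF \<tau>(3)] \<tau>(4)[OF absorption_harmonic] by simp
  qed
  finally show ?thesis using \<tau>(2) by simp
qed

end


subsection \<open>Reachable space and growth of the moment generating functions\<close>

lemma prod_list_map_pos:
  "w \<in> words v n \<Longrightarrow> (\<And>i. i \<in> {1..v} \<Longrightarrow> 0 < c i) \<Longrightarrow> (0 :: real) < prod_list (map c w)"
  by (induction w arbitrary: n) (auto simp: words_def)

lemma iterate_form:
  "Re (cinner z ((kraus_map v c L ^^ n) X *v z))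
    = (\<Sum>w\<in>words v n. prod_list (map c w) * Re (cinner (cadj (kraus_word L w) *v z) (X *v (cadj (kraus_word L w) *v z))))"
  by (simp add: iterate_kraus_map matrix_sum_vector cinner_sum_right matrix_scaleR_vector
      cinner_scaleR_right conj_form)

text \<open>The right-hand side does not mention the positive factors \<open>c\<close>; this
  transfers reachability from the undeformed channel to every deformation.\<close>

lemma iterate_form_eq_0_iff:
  assumes "psd X" "\<And>i. i \<in> {1..v} \<Longrightarrow> 0 < c i"
  shows "Re (cinner z ((kraus_map v c L ^^ n) X *v z)) = 0 \<longleftrightarrow>
    (\<forall>w\<in>words v n. Re (cinner (cadj (kraus_word L w) *v z) (X *v (cadj (kraus_word L w) *v z))) = 0)"
proof -
  have pos: "0 < prod_list (map c w)" if "w \<in> words v n" for w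
    using prod_list_map_pos[OF that, of c] assms(2) by blast
  then have nz: "prod_list (map c w) \<noteq> 0" if "w \<in> words v n" for w using that by fastforce
  define F where "F w = Re (cinner (cadj (kraus_word L w) *v z) (X *v (cadj (kraus_word L w) *v z)))" for w
  have "(\<Sum>w\<in>words v n. prod_list (map c w) * F w) = 0 \<longleftrightarrow> (\<forall>w\<in>words v n. prod_list (map c w) * F w = 0)"
    unfolding F_def
    by (rule sum_nonneg_eq_0_iff[OF finite_words])
       (intro mult_nonneg_nonneg less_imp_le[OF pos] psd_form_nonneg[OF assms(1)])
  then show ?thesis unfolding iterate_form F_def[symmetric] using nz by simp
qed

locale oqrw =
  fixes V :: "(real ^ 'd) set" and v :: nat and s :: "nat \<Rightarrow> real ^ 'd"
    and L :: "nat \<Rightarrow> complex ^ 'n ^ 'n" and \<rho> :: "real ^ 'd \<Rightarrow> complex ^ 'n ^ 'n"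
  assumes walk: "homogeneous_oqrw V v s L" and init: "initial_state V \<rho>"

sublocale oqrw \<subseteq> trace_preserving v L
  using walk by unfold_locales (simp add: homogeneous_oqrw_def)

context oqrw
begin

text \<open>The displacement from the starting site depends on the jumps alone, so the blocks of the
  initial state can be merged into one local state.\<close>

definition rho_bar :: "complex^'n^'n" where "rho_bar = (\<Sum>\<^sub>\<infinity>k\<in>V. \<rho> k)"

lemma psd_rho: "k \<in> V \<Longrightarrow> psd (\<rho> k)"
  using init by (simp add: initial_state_def)

text \<open>For positive blocks the norm is bounded by a multiple of the trace, so summable traces
  give absolute summability.\<close>

lemma has_sum_rho: "(\<rho> has_sum rho_bar) V"
proof -
  have "((\<lambda>k. (real CARD('n))\<^sup>2 * Re (trace (\<rho> k))) has_sum (real CARD('n))\<^sup>2 * Re 1) V"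
    using init by (intro has_sum_cmult_right has_sum_Re) (simp add: initial_state_def)
  then have "(\<lambda>k. norm (\<rho> k)) summable_on V"
    by (intro Infinite_Sum.abs_summable_on_comparison_test'[OF has_sum_imp_summable])
       (auto intro: psd_norm_le psd_rho)
  then show ?thesis unfolding rho_bar_def by (rule has_sum_infsum[OF Infinite_Sum.abs_summable_summable])
qed

lemma has_sum_linear_rho: "bounded_linear h \<Longrightarrow> ((\<lambda>k. h (\<rho> k)) has_sum h rho_bar) V"
  by (rule has_sum_bounded_linear[OF _ has_sum_rho])

lemma has_sum_form_rho: "((\<lambda>k. cinner x (\<rho> k *v x)) has_sum cinner x (rho_bar *v x)) V"
  by (rule has_sum_linear_rho[OF bounded_linear_cinner_mult])

lemma psd_rho_bar: "psd rho_bar"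
  unfolding psd_iff
proof (intro allI conjI)
  fix x
  show "0 \<le> Re (cinner x (rho_bar *v x))"
    by (rule has_sum_nonneg[OF has_sum_Re[OF has_sum_form_rho]]) (rule psd_form_nonneg[OF psd_rho])
  have "((\<lambda>k. Im (cinner x (\<rho> k *v x))) has_sum 0) V"
    by (rule has_sum_0) (use psd_rho in \<open>auto simp: psd_iff\<close>)
  then show "Im (cinner x (rho_bar *v x)) = 0"
    by (rule has_sum_unique[OF has_sum_Im[OF has_sum_form_rho]])
qed

lemma rho_bar_form_eq_0_iff:
  "Re (cinner x (rho_bar *v x)) = 0 \<longleftrightarrow> (\<forall>k\<in>V. Re (cinner x (\<rho> k *v x)) = 0)"
proof
  assume 0: "Re (cinner x (rho_bar *v x)) = 0"
  show "\<forall>k\<in>V. Re (cinner x (\<rho> k *v x)) = 0"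
    using nonneg_has_sum_le_0D[OF has_sum_Re[OF has_sum_form_rho[of x]]] 0 psd_form_nonneg[OF psd_rho] by auto
next
  assume "\<forall>k\<in>V. Re (cinner x (\<rho> k *v x)) = 0"
  then have "((\<lambda>k. Re (cinner x (\<rho> k *v x))) has_sum 0) V" by (intro has_sum_0) auto
  then show "Re (cinner x (rho_bar *v x)) = 0"
    by (rule has_sum_unique[OF has_sum_Re[OF has_sum_form_rho]])
qed

lemma psd_channel_rho: "k \<in> V \<Longrightarrow> psd ((channel v L ^^ n) (\<rho> k))"
  by (intro psd_channel_iterate psd_rho)

lemma iterate_rho_bar_form_eq_0_iff:
  assumes c: "\<And>i. i \<in> {1..v} \<Longrightarrow> 0 < c i"
  shows "Re (cinner z ((kraus_map v c L ^^ n) rho_bar *v z)) = 0 \<longleftrightarrow> (\<forall>k\<in>V. (channel v L ^^ n) (\<rho> k) *v z = 0)"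
proof -
  have "(channel v L ^^ n) (\<rho> k) *v z = 0 \<longleftrightarrow>
      (\<forall>w\<in>words v n. Re (cinner (cadj (kraus_word L w) *v z) (\<rho> k *v (cadj (kraus_word L w) *v z))) = 0)"
    if k: "k \<in> V" for k
  proof -
    have "(channel v L ^^ n) (\<rho> k) *v z = 0 \<longleftrightarrow> Re (cinner z ((channel v L ^^ n) (\<rho> k) *v z)) = 0"
      using psd_form_eq_0[OF psd_channel_rho[OF k]] by auto
    then show ?thesis
      unfolding channel_eq_kraus_map by (simp add: iterate_form_eq_0_iff[OF psd_rho[OF k]])
  qed
  then show ?thesis
    using iterate_form_eq_0_iff[OF psd_rho_bar c] by (auto simp: rho_bar_form_eq_0_iff)
qed

text \<open>For a positive operator, being orthogonal to the support means lying in the kernel, so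
  the complement of the reachable space is a common kernel.\<close>

lemma orth_reachable_iff:
  "(\<forall>e\<in>reachable V v L \<rho>. cinner z e = 0) \<longleftrightarrow> (\<forall>k\<in>V. \<forall>n. (channel v L ^^ n) (\<rho> k) *v z = 0)"
proof (intro iffI ballI allI)
  fix k n assume orth: "\<forall>e\<in>reachable V v L \<rho>. cinner z e = 0" and k: "k \<in> V"
  have "supp ((channel v L ^^ n) (\<rho> k)) \<subseteq> reachable V v L \<rho>"
    unfolding reachable_def using k by (intro subsetI vec.span_base) blast
  then show "(channel v L ^^ n) (\<rho> k) *v z = 0"
    using orth by (intro psd_orth_supp psd_channel_rho k) blast
next
  fix e assume zero: "\<forall>k\<in>V. \<forall>n. (channel v L ^^ n) (\<rho> k) *v z = 0" and "e \<in> reachable V v L \<rho>"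
  then have "e \<in> vec.span (\<Union>k\<in>V. \<Union>n. supp ((channel v L ^^ n) (\<rho> k)))" by (simp add: reachable_def)
  then show "cinner z e = 0"
    by (induction rule: vec.span_induct_alt) (use zero in \<open>auto simp: cinner_add_right cinner_scale_right supp_def\<close>)
qed

lemma subspace_reachable: "vec.subspace (reachable V v L \<rho>)"
  by (simp add: reachable_def)

end

section \<open>Compression to the reachable part of the absorption support\<close>

locale oqrw_enclosure = oqrw V v s L \<rho>
  for V :: "(real ^ 'd) set" and v :: nat and s :: "nat \<Rightarrow> real ^ 'd"
    and L :: "nat \<Rightarrow> complex ^ 'n ^ 'n" and \<rho> :: "real ^ 'd \<Rightarrow> complex ^ 'n ^ 'n" +
  fixes U :: "(complex ^ 'n) set"
  assumes enclosure_U: "enclosure v L U"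

sublocale oqrw_enclosure \<subseteq> trace_preserving_enclosure v L U
  by unfold_locales (rule enclosure_U)

context oqrw_enclosure
begin

abbreviation "A \<equiv> absorption v L U"
abbreviation "E \<equiv> reachable V v L \<rho>"
abbreviation "S \<equiv> supp A"
abbreviation "Q \<equiv> reach_absorb V v L \<rho> U"

definition p_abs :: "complex^'n^'n" where "p_abs = absorption_proj v L U"
definition p :: "complex^'n^'n" where "p = orth_proj Q"
definition K :: "nat \<Rightarrow> complex^'n^'n" where "K i = p ** L i ** p"

lemma Q_eq: "Q = (\<lambda>x. p_abs *v x) ` E"
  by (simp add: reach_absorb_def p_abs_def)

lemma p_abs_eq: "p_abs = orth_proj S"
  by (simp add: p_abs_def absorption_proj_def)

lemma subspace_Q: "vec.subspace Q"
  unfolding Q_eq vec.subspace_def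
proof (intro conjI ballI allI)
  show "0 \<in> (*v) p_abs ` E" using vec.subspace_0[OF subspace_reachable] by (force intro: image_eqI[of _ _ 0])
  fix x assume "x \<in> (*v) p_abs ` E"
  then obtain a where a: "a \<in> E" "x = p_abs *v a" by auto
  show "c *s x \<in> (*v) p_abs ` E" for c
    using vec.subspace_scale[OF subspace_reachable a(1), of c] by (auto simp: a(2) vector_scalar_commute[symmetric])
  fix y assume "y \<in> (*v) p_abs ` E"
  then obtain b where b: "b \<in> E" "y = p_abs *v b" by auto
  show "x + y \<in> (*v) p_abs ` E"
    using vec.subspace_add[OF subspace_reachable a(1) b(1)]
    by (auto simp: a(2) b(2) matrix_vector_right_distrib[symmetric])
qed

lemma p_abs_in: "p_abs *v x \<in> S" and p_abs_fix: "x \<in> S \<Longrightarrow> p_abs *v x = x"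
  and p_abs_adj: "cadj p_abs = p_abs" and p_abs_idem: "p_abs ** p_abs = p_abs"
  by (simp_all add: p_abs_eq subspace_supp orth_proj_in orth_proj_fix orth_proj_adj orth_proj_idem)

lemma p_in: "p *v x \<in> Q" and p_fix: "x \<in> Q \<Longrightarrow> p *v x = x"
  and p_adj: "cadj p = p" and p_idem: "p ** p = p"
  by (simp_all add: p_def subspace_Q orth_proj_in orth_proj_fix orth_proj_adj orth_proj_idem)

lemma mult_p_p: "X ** p ** p = X ** p"
  by (simp add: p_idem flip: matrix_mul_assoc)

lemma Q_subset: "Q \<subseteq> S"
  by (auto simp: Q_eq p_abs_in)

lemma p_abs_p: "p_abs ** p = p"
  using p_abs_fix Q_subset p_in by (auto simp: matrix_eq matrix_vector_mul_assoc[symmetric])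

lemma p_p_abs: "p ** p_abs = p"
  using arg_cong[OF p_abs_p, of cadj] by (simp add: cadj_mult p_adj p_abs_adj)

lemma p_abs_eq_0_iff: "p_abs *v x = 0 \<longleftrightarrow> A *v x = 0"
proof
  assume "A *v x = 0"
  then show "p_abs *v x = 0"
    unfolding p_abs_eq by (intro orth_proj_orth subspace_supp) (auto simp: supp_def)
next
  assume 0: "p_abs *v x = 0"
  have "cinner x y = 0" if "y \<in> S" for y
    using orth_proj_residual[OF subspace_supp that, of x] 0 by (simp add: p_abs_eq)
  then show "A *v x = 0" by (rule psd_orth_supp[OF psd_absorption])
qed

lemma p_abs_residual: "p_abs *v (x - p_abs *v x) = 0"
  by (simp add: matrix_vector_mult_diff_distrib matrix_vector_mul_assoc p_abs_idem)

lemma A_p_abs: "A ** p_abs = A"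
proof -
  have "A *v (x - p_abs *v x) = 0" for x using p_abs_residual p_abs_eq_0_iff by blast
  then show ?thesis by (simp add: matrix_eq matrix_vector_mul_assoc[symmetric] matrix_vector_mult_diff_distrib)
qed

lemma p_abs_A: "p_abs ** A = A"
  using arg_cong[OF A_p_abs, of cadj] by (simp add: cadj_mult p_abs_adj psd_hermitian[OF psd_absorption])

text \<open>The residual \<open>x - p_abs *v x\<close> lies in the kernel of \<open>A\<close>, which
  \<open>L i\<close> preserves: whatever the projection discards before \<open>L i\<close> would be
  discarded afterwards too.\<close>

lemma p_abs_L: assumes "i \<in> {1..v}" shows "p_abs ** L i ** p_abs = p_abs ** L i"
  unfolding matrix_eq
proof
  fix x
  have "A *v (x - p_abs *v x) = 0" using p_abs_residual p_abs_eq_0_iff by simp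
  then have "A *v (L i *v (x - p_abs *v x)) = 0" by (rule absorption_kernel_invariant[OF _ assms])
  then have "p_abs *v (L i *v (x - p_abs *v x)) = 0" by (simp add: p_abs_eq_0_iff)
  then show "p_abs ** L i ** p_abs *v x = p_abs ** L i *v x"
    by (simp add: matrix_vector_mul_assoc[symmetric] matrix_vector_mult_diff_distrib)
qed

lemma p_L: assumes "i \<in> {1..v}" shows "p ** L i ** p_abs = p ** L i"
proof -
  have "p ** L i ** p_abs = p ** (p_abs ** L i ** p_abs)"
    by (simp add: matrix_mul_assoc p_p_abs)
  also have "\<dots> = p ** L i" by (simp add: p_abs_L[OF assms] matrix_mul_assoc p_p_abs)
  finally show ?thesis .
qed

context
  fixes c :: "nat \<Rightarrow> real"
  assumes c: "\<And>i. i \<in> {1..v} \<Longrightarrow> 0 < c i"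
begin

definition Y :: "nat \<Rightarrow> complex^'n^'n" where "Y n = (kraus_map v c L ^^ n) rho_bar"

lemma psd_Y: "psd (Y n)"
  unfolding Y_def using c by (intro psd_iterate_kraus_map psd_rho_bar) (auto intro: less_imp_le)

lemma Y_orth_reachable:
  assumes "\<And>e. e \<in> E \<Longrightarrow> cinner z e = 0" shows "Y n *v z = 0"
proof (rule psd_form_eq_0[OF psd_Y])
  have "\<forall>k\<in>V. (channel v L ^^ n) (\<rho> k) *v z = 0" using assms orth_reachable_iff by blast
  then show "Re (cinner z (Y n *v z)) = 0" unfolding Y_def using iterate_rho_bar_form_eq_0_iff[where c = c, OF c] by blast
qed

text \<open>The difference \<open>z\<close> of the two projections of \<open>x\<close> lies in
  \<open>S\<close> and is orthogonal to \<open>Q\<close>, the image of \<open>E\<close> under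
  \<open>p_abs\<close>. Hence it is orthogonal to \<open>E\<close> itself, and \<open>Y n\<close>
  annihilates it.\<close>

lemma Y_p_abs: "Y n ** p_abs = Y n ** p"
  unfolding matrix_eq
proof
  fix x
  define z where "z = p_abs *v x - p *v x"
  have "cinner z e = 0" if "e \<in> E" for e
  proof -
    have "z \<in> S" unfolding z_def
      using p_abs_in p_in Q_subset by (intro vec.subspace_diff subspace_supp) auto
    then have "cinner z e = cinner z (p_abs *v e)" by (simp add: cinner_adj_right p_abs_adj p_abs_fix)
    moreover have q: "p_abs *v e \<in> Q" using that by (auto simp: Q_eq)
    have "cinner z (p_abs *v e) = cinner x (p_abs *v (p_abs *v e)) - cinner x (p *v (p_abs *v e))"
      by (simp add: z_def cinner_diff_left cinner_adj_left p_abs_adj p_adj)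
    then have "cinner z (p_abs *v e) = 0" using p_fix[OF q] p_abs_fix[OF p_abs_in] by simp
    ultimately show ?thesis by simp
  qed
  then have "Y n *v z = 0" by (rule Y_orth_reachable)
  then show "Y n ** p_abs *v x = Y n ** p *v x"
    by (simp add: z_def matrix_vector_mult_diff_distrib matrix_vector_mul_assoc)
qed

lemma p_abs_Y: "p_abs ** Y n = p ** Y n"
  using arg_cong[OF Y_p_abs, of cadj] by (simp add: cadj_mult p_abs_adj p_adj psd_hermitian[OF psd_Y])

lemma p_Y_p: "p_abs ** Y n ** p_abs = p ** Y n ** p"
  by (simp add: p_abs_Y Y_p_abs flip: matrix_mul_assoc)

text \<open>Inside one step, \<open>p\<close> may be traded for \<open>p_abs\<close> on both sides
  of \<open>Y n\<close>; the latter is then swallowed by \<open>p ** L i\<close>, so no projection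
  is left between successive Kraus operators.\<close>

lemma iterate_compression: "(kraus_map v c K ^^ n) (p ** rho_bar ** p) = p ** Y n ** p"
proof (induction n)
  case (Suc n)
  have step: "K i ** (p ** Y n ** p) ** cadj (K i) = p ** (L i ** Y n ** cadj (L i)) ** p"
    if i: "i \<in> {1..v}" for i
  proof -
    have L': "p_abs ** cadj (L i) ** p = cadj (L i) ** p"
      using arg_cong[OF p_L[OF i], of cadj] by (simp add: cadj_mult p_abs_adj p_adj matrix_mul_assoc)
    have "K i ** (p ** Y n ** p) ** cadj (K i) = p ** L i ** (p ** p ** Y n ** p ** p) ** cadj (L i) ** p"
      by (simp add: K_def cadj_mult p_adj matrix_mul_assoc)
    also have "p ** p ** Y n ** p ** p = p_abs ** Y n ** p_abs"
      by (simp add: p_Y_p p_idem mult_p_p)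
    also have "p ** L i ** (p_abs ** Y n ** p_abs) ** cadj (L i) ** p
        = (p ** L i ** p_abs) ** Y n ** (p_abs ** cadj (L i) ** p)"
      by (simp add: matrix_mul_assoc)
    also have "\<dots> = p ** (L i ** Y n ** cadj (L i)) ** p"
      unfolding p_L[OF i] L' by (simp add: matrix_mul_assoc)
    finally show ?thesis .
  qed
  have "(kraus_map v c K ^^ Suc n) (p ** rho_bar ** p) = kraus_map v c K (p ** Y n ** p)" by (simp add: Suc)
  also have "\<dots> = (\<Sum>i=1..v. c i *\<^sub>R (p ** (L i ** Y n ** cadj (L i)) ** p))"
    unfolding kraus_map_def using step by (intro sum.cong refl) simp
  also have "\<dots> = p ** Y (Suc n) ** p"
    by (simp add: Y_def kraus_map_def matrix_sum_mult_left matrix_sum_mult_right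
        matrix_scaleR_mult_left matrix_scaleR_mult_right)
  finally show ?case .
qed (simp add: Y_def)

lemma p_form: "cinner x (p ** Z ** p *v x) = cinner (p *v x) (Z *v (p *v x))"
  using conj_form[of x p Z x] by (simp add: p_adj)

lemma kraus_corner_Q: "kraus_corner Q v c K (p ** rho_bar ** p)"
proof
  show "vec.subspace Q" by (rule subspace_Q)
  show "0 \<le> c i" if "i \<in> {1..v}" for i using c[OF that] by simp
  show "orth_proj Q ** K i = K i" for i
    by (simp add: K_def matrix_mul_assoc p_idem flip: p_def)
  show "psd (p ** rho_bar ** p)" using psd_conj[OF psd_rho_bar, of p] by (simp add: p_adj)
  show "p ** rho_bar ** p \<in> corner Q"
    by (simp add: corner_def matrix_mul_assoc p_idem flip: p_def) (simp add: p_idem flip: matrix_mul_assoc)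
  fix y assume y: "y \<in> Q" and zero: "\<And>m. Re (cinner y ((kraus_map v c K ^^ m) (p ** rho_bar ** p) *v y)) = 0"
  have "Re (cinner y (Y m *v y)) = 0" for m
    using zero[of m] y by (simp add: iterate_compression p_form p_fix)
  then have "\<forall>k\<in>V. \<forall>m. (channel v L ^^ m) (\<rho> k) *v y = 0"
    unfolding Y_def using iterate_rho_bar_form_eq_0_iff[where c = c, OF c] by blast
  then have orth: "cinner y e = 0" if "e \<in> E" for e using that orth_reachable_iff by blast
  \<comment> \<open>\<open>y\<close> is orthogonal to \<open>E\<close> yet is the projection of some
    \<open>e\<close> in \<open>E\<close>; since \<open>y\<close> lies in \<open>S\<close>, its form
    with itself equals its form with \<open>e\<close>.\<close>
  obtain e where e: "e \<in> E" "y = p_abs *v e" using y by (auto simp: Q_eq)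
  have "cinner y y = cinner (p_abs *v y) e" by (subst (2) e(2)) (simp add: cinner_adj_right p_abs_adj)
  also have "\<dots> = 0" using y Q_subset orth[OF e(1)] by (simp add: p_abs_fix subset_iff)
  finally show "y = 0" by simp
qed

text \<open>On its support \<open>A\<close> lies between \<open>b\<close> and \<open>1\<close>, with
  \<open>b > 0\<close> by compactness. Absorbing the projections into \<open>A\<close> turns
  \<open>Y n\<close> into its compression without changing the trace.\<close>

lemma absorption_sandwich:
  obtains b where "b > 0"
    "\<And>n. b * Re (trace (p ** Y n ** p)) \<le> Re (trace (A ** Y n))"
    "\<And>n. Re (trace (A ** Y n)) \<le> Re (trace (p ** Y n ** p))"
proof -
  have trA: "trace (A ** Y n) = trace (A ** (p ** Y n ** p))" for n
  proof -
    have "trace (A ** Y n) = trace (p_abs ** (A ** (p_abs ** Y n)))"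
      by (simp add: matrix_mul_assoc A_p_abs p_abs_A)
    also have "\<dots> = trace (A ** (p_abs ** Y n ** p_abs))"
      by (subst trace_mul_sym) (simp add: matrix_mul_assoc)
    finally show ?thesis by (simp add: p_Y_p)
  qed
  have psdp: "psd (p ** Y n ** p)" for n using psd_conj[OF psd_Y, of p n] by (simp add: p_adj)
  have "0 < Re (cinner y (A *v y))" if "y \<in> S" "y \<noteq> 0" for y
  proof (rule ccontr)
    assume "\<not> ?thesis"
    then have "Re (cinner y (A *v y)) = 0" using psd_form_nonneg[OF psd_absorption, of y] by simp
    then have "p_abs *v y = 0" using psd_form_eq_0[OF psd_absorption] p_abs_eq_0_iff by blast
    then show False using p_abs_fix that by simp
  qed
  from form_lower_bound[OF subspace_supp this]
  obtain b where b: "b > 0" "\<And>y. y \<in> S \<Longrightarrow> b * (norm y)\<^sup>2 \<le> Re (cinner y (A *v y))" by blast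
  have form_abs: "cinner x (p_abs *v x) = of_real ((norm (p_abs *v x))\<^sup>2)" for x
    unfolding p_abs_eq by (rule orth_proj_form[OF subspace_supp])
  have "psd (A - b *\<^sub>R p_abs)"
    unfolding psd_iff
  proof (intro allI conjI)
    fix x
    have "cinner x (A *v x) = cinner (p_abs *v x) (A *v (p_abs *v x))"
      by (simp add: cinner_adj_left p_abs_adj matrix_vector_mul_assoc A_p_abs p_abs_A)
    then show "0 \<le> Re (cinner x ((A - b *\<^sub>R p_abs) *v x))"
      using b(2)[OF p_abs_in, of x]
      by (simp add: matrix_vector_mult_diff_rdistrib cinner_diff_right matrix_scaleR_vector
          cinner_scaleR_right form_abs)
    show "Im (cinner x ((A - b *\<^sub>R p_abs) *v x)) = 0"
      using psd_absorption
      by (simp add: matrix_vector_mult_diff_rdistrib cinner_diff_right matrix_scaleR_vector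
          cinner_scaleR_right form_abs psd_iff)
  qed
  from trace_mult_mono[OF this psdp]
  have "b * Re (trace (p ** Y n ** p)) \<le> Re (trace (A ** Y n))" for n
    by (simp add: trA matrix_scaleR_mult_left trace_scaleR matrix_mul_assoc p_abs_p)
  moreover have "Re (trace (A ** Y n)) \<le> Re (trace (p ** Y n ** p))" for n
    using trace_mult_mono[OF psd_1_minus_absorption psdp] by (simp add: trA)
  ultimately show ?thesis using b(1) that by blast
qed

end

end


section \<open>Moment generating functions and rates of the components\<close>

lemma prod_list_exp: "prod_list (map (\<lambda>i. exp (u \<bullet> s i)) w) = exp (u \<bullet> sum_list (map s w))"
  by (induction w) (simp_all add: inner_add_right exp_add)

lemma scaled_constant_eventually_le_1:
  assumes "0 < (a :: real)" shows "\<forall>\<^sub>F n in sequentially. C * exp (- real n * a) \<le> 1"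
  using order_tendstoD(2)[OF tendsto_mult_right_zero[OF exp_decay[OF assms], of C], of 1]
  by (auto elim: eventually_mono)

definition mean :: "(nat \<Rightarrow> real ^ 'd) \<Rightarrow> nat \<Rightarrow> nat list \<Rightarrow> real ^ 'd" where
  "mean s n w = sum_list (map s w) /\<^sub>R real n"

lemma norm_mean_le:
  assumes "w \<in> words v n" shows "norm (mean s n w) \<le> (\<Sum>i=1..v. norm (s i))"
proof -
  have "norm (sum_list (map s w)) \<le> real (length w) * (\<Sum>i=1..v. norm (s i))"
    if "set w \<subseteq> {1..v}" for w
    using that
  proof (induction w)
    case (Cons j w)
    have "norm (s j) \<le> (\<Sum>i=1..v. norm (s i))" using Cons.prems by (intro member_le_sum) auto
    then show ?case using Cons norm_triangle_ineq[of "s j" "sum_list (map s w)"]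
      by (simp add: algebra_simps)
  qed simp
  from this[of w] assms have "norm (sum_list (map s w)) \<le> real n * (\<Sum>i=1..v. norm (s i))"
    by (simp add: words_def)
  moreover have "0 \<le> (\<Sum>i=1..v. norm (s i))" by (intro sum_nonneg) simp
  ultimately show ?thesis by (cases "n = 0") (auto simp: mean_def field_simps)
qed

text \<open>At \<open>n = 0\<close> the mean is \<open>0\<close> by division by zero, in agreement
  with the empty word being the only one.\<close>

lemma inner_mean: "w \<in> words v n \<Longrightarrow> real n * (u \<bullet> mean s n w) = u \<bullet> sum_list (map s w)"
  by (cases "n = 0") (auto simp: mean_def words_def)

context oqrw_enclosure
begin

definition weight :: "nat list \<Rightarrow> real" where
  "weight w = Re (trace (A ** (kraus_word L w ** rho_bar ** cadj (kraus_word L w))))"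

definition c_u :: "real ^ 'd \<Rightarrow> nat \<Rightarrow> real" where "c_u u i = exp (u \<bullet> s i)"

lemma c_u_pos: "0 < c_u u i"
  by (simp add: c_u_def)

lemma weight_nonneg: "0 \<le> weight w"
  unfolding weight_def by (intro trace_psd_mult_psd psd_absorption psd_conj psd_rho_bar)

abbreviation "mgf n u \<equiv> (\<Sum>w\<in>words v n. weight w * exp (real n * (u \<bullet> mean s n w)))"

lemma mgf_eq: "mgf n u = Re (trace (A ** (kraus_map v (c_u u) L ^^ n) rho_bar))"
proof -
  have "weight w * exp (real n * (u \<bullet> mean s n w)) = prod_list (map (c_u u) w) * weight w"
    if "w \<in> words v n" for w
    using prod_list_exp[of u s w] by (simp add: inner_mean[OF that] c_u_def[abs_def])
  then have "mgf n u = (\<Sum>w\<in>words v n. prod_list (map (c_u u) w) * weight w)"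
    by (rule sum.cong[OF refl])
  then show ?thesis
    by (simp add: iterate_kraus_map matrix_sum_mult_right matrix_scaleR_mult_right trace_sum trace_scaleR weight_def)
qed

lemma absorption_weight_eq: "absorption_weight V v L \<rho> U = trace (A ** rho_bar)"
  unfolding absorption_weight_def
  by (intro infsumI has_sum_linear_rho bounded_linear_compose[OF bounded_linear_trace] bounded_linear_matrix_mult_left)

lemma sum_weight: "(\<Sum>w\<in>words v n. weight w) = Re (trace (A ** rho_bar))"
proof -
  have "c_u 0 = (\<lambda>_. 1)" by (simp add: fun_eq_iff c_u_def)
  then show ?thesis
    using mgf_eq[of n 0] trace_absorption_iterate[of n rho_bar] by (simp add: channel_eq_kraus_map)
qed

lemma weight_eq_0:
  assumes "absorption_weight V v L \<rho> U = 0" "w \<in> words v n" shows "weight w = 0"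
  using assms sum_weight[of n] sum_nonneg_eq_0_iff[OF finite_words, of v n weight]
  by (simp add: absorption_weight_eq weight_nonneg)

lemma deformed_eq: "deformed v s L Q u = kraus_map v (c_u u) K"
  by (simp add: fun_eq_iff deformed_def kraus_map_def K_def c_u_def Let_def cadj_mult p_adj matrix_mul_assoc
      flip: p_def)

lemma lam_eq: "lam V v s L \<rho> U u = op_spectral_radius (corner Q) (kraus_map v (c_u u) K)"
  by (simp add: lam_def deformed_eq)

end

locale oqrw_absorbing = oqrw_enclosure V v s L \<rho> U
  for V :: "(real ^ 'd) set" and v :: nat and s :: "nat \<Rightarrow> real ^ 'd"
    and L :: "nat \<Rightarrow> complex ^ 'n ^ 'n" and \<rho> :: "real ^ 'd \<Rightarrow> complex ^ 'n ^ 'n"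
    and U :: "(complex ^ 'n) set" +
  assumes nonzero: "absorption_weight V v L \<rho> U \<noteq> 0"
begin

lemma weight_pos: "0 < Re (trace (A ** rho_bar))"
  using trace_psd_mult_psd[OF psd_absorption psd_rho_bar] nonzero
  by (auto simp: absorption_weight_eq complex_eq_iff order_less_le)

lemma compressed_trace_growth:
  obtains b where "b > 0" "\<And>n. b * Re (trace ((kraus_map v (c_u u) K ^^ n) (p ** rho_bar ** p))) \<le> mgf n u"
    "\<And>n. mgf n u \<le> Re (trace ((kraus_map v (c_u u) K ^^ n) (p ** rho_bar ** p)))"
proof -
  obtain b where "b > 0"
    "\<And>n. b * Re (trace (p ** Y (c_u u) n ** p)) \<le> Re (trace (A ** Y (c_u u) n))"
    "\<And>n. Re (trace (A ** Y (c_u u) n)) \<le> Re (trace (p ** Y (c_u u) n ** p))"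
    using absorption_sandwich[of "c_u u"] c_u_pos by blast
  then show ?thesis
    using that[of b] iterate_compression[of "c_u u"] c_u_pos by (simp add: mgf_eq Y_def)
qed

lemma mgf_lower: "exp (- real n * (norm u * (\<Sum>i=1..v. norm (s i)))) * Re (trace (A ** rho_bar)) \<le> mgf n u"
proof -
  define M where "M = (\<Sum>i=1..v. norm (s i))"
  have "exp (- real n * (norm u * M)) * weight w \<le> weight w * exp (real n * (u \<bullet> mean s n w))"
    if w: "w \<in> words v n" for w
  proof -
    have "- (u \<bullet> mean s n w) \<le> norm u * norm (mean s n w)"
      using norm_cauchy_schwarz[of "- u" "mean s n w"] by simp
    also have "\<dots> \<le> norm u * M" unfolding M_def by (intro mult_left_mono norm_mean_le[OF w]) simp
    finally have "real n * - (norm u * M) \<le> real n * (u \<bullet> mean s n w)" by (intro mult_left_mono) auto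
    then show ?thesis using weight_nonneg by (simp add: mult.commute mult_left_mono)
  qed
  then show ?thesis unfolding sum_weight[of n, symmetric] M_def[symmetric] sum_distrib_left by (rule sum_mono)
qed

text \<open>Bounded jumps prevent the moment generating function from decaying faster than
  \<open>\<kappa> ^ n\<close>, whereas a vanishing spectral radius would make it decay faster than
  any geometric rate. Positivity makes \<open>ln\<close> of the spectral radius a genuine finite
  function of \<open>u\<close>.\<close>

lemma lam_pos: "0 < lam V v s L \<rho> U u"
proof (rule ccontr)
  interpret kraus_corner Q v "c_u u" K "p ** rho_bar ** p" by (rule kraus_corner_Q) (rule c_u_pos)
  define \<kappa> where "\<kappa> = exp (- (norm u * (\<Sum>i=1..v. norm (s i))))"
  define a where "a = Re (trace (A ** rho_bar))"
  have a: "a > 0" using weight_pos by (simp add: a_def)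
  have \<kappa>0: "\<kappa> > 0" by (simp add: \<kappa>_def)
  have \<kappa>n: "\<kappa> ^ n = exp (- real n * (norm u * (\<Sum>i=1..v. norm (s i))))" for n
    by (simp add: \<kappa>_def flip: exp_of_nat_mult)
  assume "\<not> 0 < lam V v s L \<rho> U u"
  then have "op_spectral_radius (corner Q) T < \<kappa> / 2"
    using \<kappa>0 by (simp add: lam_eq)
  then obtain C where C: "\<And>n. t n \<le> C * (\<kappa> / 2) ^ n" using t_upper by blast
  obtain b where "\<And>n. mgf n u \<le> t n" using compressed_trace_growth[of u] unfolding t_def by blast
  then have "\<kappa> ^ n * a \<le> C * (\<kappa> / 2) ^ n" for n
    using mgf_lower[of n u] C[of n] unfolding \<kappa>n[symmetric] a_def[symmetric] by (meson order_trans)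
  then have "\<kappa> ^ n * a \<le> \<kappa> ^ n * (C / 2 ^ n)" for n by (simp add: power_divide mult.commute)
  then have le: "a * 2 ^ n \<le> C" for n using \<kappa>0 by (simp add: mult_le_cancel_left_pos pos_le_divide_eq)
  obtain n where "C / a < 2 ^ n" using real_arch_pow[of 2 "C / a"] by auto
  then show False using le[of n] a by (simp add: field_simps)
qed

sublocale weighted_points "words v" "\<lambda>_. weight" "mean s" "\<Sum>i=1..v. norm (s i)" "\<lambda>u. ln (lam V v s L \<rho> U u)"
proof
  fix e :: real and u :: "real ^ 'd"
  assume e: "e > 0"
  interpret kraus_corner Q v "c_u u" K "p ** rho_bar ** p" by (rule kraus_corner_Q) (rule c_u_pos)
  obtain b where b: "b > 0" "\<And>n. b * t n \<le> mgf n u" "\<And>n. mgf n u \<le> t n"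
    using compressed_trace_growth[of u] unfolding t_def by blast
  show "\<forall>\<^sub>F n in sequentially. mgf n u \<le> exp (real n * (ln (lam V v s L \<rho> U u) + e))"
    using t_growth(1)[OF lam_eq[symmetric] lam_pos e]
    by eventually_elim (use b(3) order_trans in blast)
  have e2: "e / 2 > 0" using e by simp
  show "\<forall>\<^sub>F n in sequentially. exp (real n * (ln (lam V v s L \<rho> U u) - e)) \<le> mgf n u"
    using t_growth(2)[OF lam_eq[symmetric] lam_pos e2] scaled_constant_eventually_le_1[OF e2, of "1 / b"]
  proof eventually_elim
    case (elim n)
    have "exp (real n * (ln (lam V v s L \<rho> U u) - e))
        = exp (- real n * (e / 2)) * exp (real n * (ln (lam V v s L \<rho> U u) - e / 2))"
      by (simp add: algebra_simps flip: exp_add)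
    also have "\<dots> \<le> b * t n"
      using elim b(1) by (intro mult_mono) (auto simp: field_simps)
    also have "\<dots> \<le> mgf n u" by (rule b(2))
    finally show ?case .
  qed
qed (auto simp: finite_words weight_nonneg norm_mean_le[simplified])

lemma rate_eq: "rate V v s L \<rho> U x = (SUP u. ereal (u \<bullet> x - ln (lam V v s L \<rho> U u)))"
  using lam_pos by (simp add: rate_def log_ereal_def)

lemma rate_upper:
  assumes "closed F" "\<And>x. x \<in> F \<Longrightarrow> ereal a < rate V v s L \<rho> U x"
  shows "\<forall>\<^sub>F n in sequentially. mass n F \<le> exp (- real n * a)"
  using assms by (intro mass_upper) (auto simp: rate_eq less_SUP_iff)

lemma rate_ge: "ereal (u \<bullet> x - ln (lam V v s L \<rho> U u)) \<le> rate V v s L \<rho> U x"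
  unfolding rate_eq by (rule SUP_upper) simp

lemma rate_lower:
  assumes G: "open G" "y \<in> G" and y: "y \<in> lower_set V v s L \<rho> U" and b: "rate V v s L \<rho> U y < ereal b"
  shows "\<forall>\<^sub>F n in sequentially. mass n G \<ge> exp (- real n * b)"
proof (cases "smooth (lam V v s L \<rho> U)")
  case True
  obtain l where l: "rate V v s L \<rho> U y = ereal l"
    using rate_ge[of 0 y] b by (cases "rate V v s L \<rho> U y") auto
  have diff: "(\<lambda>u. ln (lam V v s L \<rho> U u)) differentiable (at u)" for u
  proof -
    have "times_differentiable (Suc 0) (lam V v s L \<rho> U)" using True unfolding smooth_def by blast
    then obtain f' where "(lam V v s L \<rho> U has_derivative f') (at u)" by (auto simp: differentiable_def)
    from has_derivative_ln[OF lam_pos this] show ?thesis by (auto simp: differentiable_def)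
  qed
  have "u \<bullet> y - ln (lam V v s L \<rho> U u) \<le> l" for u using rate_ge[of u y] by (simp add: l)
  from differentiable_lower[OF diff this G, of "b - l"] show ?thesis using b by (simp add: l)
next
  case False
  then obtain \<eta> where \<eta>: "\<And>x. x \<noteq> y \<Longrightarrow> ereal (\<eta> \<bullet> x) - rate V v s L \<rho> U x < ereal (\<eta> \<bullet> y) - rate V v s L \<rho> U y"
    using y by (auto simp: lower_set_def exposed_points_def)
  define f where "f u = ln (lam V v s L \<rho> U u)" for u
  have low: "ereal (\<eta> \<bullet> y) - rate V v s L \<rho> U y \<le> ereal (f \<eta>)"
    using rate_ge[of \<eta> y] by (cases "rate V v s L \<rho> U y") (auto simp: f_def)
  \<comment> \<open>A subgradient \<open>x\<close> at \<open>\<eta>\<close> has rate at most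
    \<open>\<eta> \<bullet> x - f \<eta>\<close>, while \<open>\<eta> \<bullet> y\<close> minus the
    rate of \<open>y\<close> is at most \<open>f \<eta>\<close>. Hence \<open>x\<close> does as well
    as \<open>y\<close> in the exposing functional, which forces equality.\<close>
  have "x = y" if x: "\<And>u. u \<bullet> x - ln (lam V v s L \<rho> U (\<eta> + u)) \<le> - ln (lam V v s L \<rho> U \<eta>)" for x
  proof (rule ccontr)
    assume "x \<noteq> y"
    have "u \<bullet> x - ln (lam V v s L \<rho> U u) \<le> \<eta> \<bullet> x - f \<eta>" for u
      using x[of "u - \<eta>"] by (simp add: inner_diff_left f_def)
    then have "rate V v s L \<rho> U x \<le> ereal (\<eta> \<bullet> x - f \<eta>)"
      unfolding rate_eq by (intro SUP_least) simp
    then have "ereal (f \<eta>) \<le> ereal (\<eta> \<bullet> x) - rate V v s L \<rho> U x"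
      by (cases "rate V v s L \<rho> U x") auto
    with \<eta>[OF \<open>x \<noteq> y\<close>] low show False by (metis leD order.trans)
  qed
  moreover have "\<eta> \<bullet> y - f \<eta> < b" using rate_ge[of \<eta> y] b le_less_trans[of _ "rate V v s L \<rho> U y" "ereal b"]
    by (fastforce simp: f_def)
  ultimately have "\<forall>\<^sub>F n in sequentially. mass n G \<ge> exp (- real n * (\<eta> \<bullet> y - f \<eta> + (b - (\<eta> \<bullet> y - f \<eta>))))"
    unfolding f_def by (intro exposed_lower[OF _ G]) auto
  then show ?thesis by simp
qed

end

subsection \<open>The law of the empirical mean\<close>

text \<open>The countable index set is enumerated by naturals; numbers that encode no index
  contribute empty sets.\<close>

lemma has_sum_measure_UN:
  assumes "finite_measure M" "countable I" "\<And>i. i \<in> I \<Longrightarrow> X i \<in> sets M" "disjoint_family_on X I"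
  shows "((\<lambda>i. measure M (X i)) has_sum measure M (\<Union>i\<in>I. X i)) I"
proof -
  interpret finite_measure M by fact
  define Z where "Z m = (\<Union>i\<in>{i\<in>I. to_nat_on I i = m}. X i)" for m
  have inj: "inj_on (to_nat_on I) I" using assms(2) by (rule inj_on_to_nat_on)
  have Z_to_nat: "Z (to_nat_on I i) = X i" if "i \<in> I" for i
    using that inj by (auto simp: Z_def inj_on_def)
  have Z_empty: "Z m = {}" if "m \<notin> to_nat_on I ` I" for m using that by (auto simp: Z_def)
  have "range Z \<subseteq> sets M"
  proof
    fix B assume "B \<in> range Z"
    then obtain m where "B = Z m" by auto
    then show "B \<in> sets M" using Z_to_nat Z_empty assms(3) by (cases "m \<in> to_nat_on I ` I") auto
  qed
  moreover have "disjoint_family Z"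
    using assms(4) by (fastforce simp: disjoint_family_on_def Z_def)
  ultimately have "(\<lambda>m. measure M (Z m)) sums measure M (\<Union>m. Z m)" by (rule finite_measure_UNION)
  then have "((\<lambda>m. measure M (Z m)) has_sum measure M (\<Union>m. Z m)) UNIV" by (rule sums_nonneg_imp_has_sum) simp
  then have "((\<lambda>m. measure M (Z m)) has_sum measure M (\<Union>m. Z m)) (to_nat_on I ` I)"
    by (subst has_sum_cong_neutral[where T = UNIV]) (auto simp: Z_empty)
  moreover have "(\<Union>m. Z m) = (\<Union>i\<in>I. X i)" by (auto simp: Z_def)
  ultimately show ?thesis
    unfolding has_sum_reindex[OF inj] by (subst has_sum_cong[where g = "(\<lambda>m. measure M (Z m)) \<circ> to_nat_on I"]) (auto simp: Z_to_nat)
qed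

lemma pos_eq: "pos s n \<omega> - pos s 0 \<omega> = sum_list (map s (map (snd \<omega>) [0..<n]))"
  by (induction n) (simp_all add: algebra_simps)

context oqrw
begin

lemma countable_V: "countable V"
proof -
  have fin: "finite (V \<inter> cball 0 R)" for R
    using walk by (auto simp: homogeneous_oqrw_def locally_finite_lattice_def)
  have "V = (\<Union>m :: nat. V \<inter> cball 0 (real m))"
    using real_arch_simple by (auto simp: dist_norm)
  moreover have "countable (\<Union>m :: nat. V \<inter> cball 0 (real m))"
    by (intro countable_UN countableI_type) (simp add: countable_finite fin)
  ultimately show ?thesis by simp
qed

text \<open>The mean depends only on the first \<open>n\<close> letters, so the event is a finite
  disjoint union over words. Each \<open>Ev w\<close> collects one cylinder per site, and summing
  over sites produces \<open>rho_bar\<close>.\<close>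

lemma measure_mean_law:
  assumes P: "trajectory_law V v L \<rho> P" and B: "B \<in> sets borel"
  shows "measure (mean_law s P n) B
    = (\<Sum>w\<in>{w\<in>words v n. mean s n w \<in> B}. Re (trace (kraus_word L w ** rho_bar ** cadj (kraus_word L w))))"
proof -
  interpret prob_space P using P by (simp add: trajectory_law_def)
  have space: "space P = traj V v"
    and sets: "sets P = sigma_sets (traj V v) {cyl v k js | k js. k \<in> V \<and> set js \<subseteq> {1..v}}"
    and law: "\<And>k js. k \<in> V \<Longrightarrow> set js \<subseteq> {1..v} \<Longrightarrow>
      complex_of_real (measure P (cyl v k js)) = trace (kraus_word L js ** \<rho> k ** cadj (kraus_word L js))"
    using P unfolding trajectory_law_def by blast+
  have cyl_sets: "cyl v k w \<in> sets P" if "k \<in> V" "w \<in> words v n" for k w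
    unfolding sets using that by (intro sigma_sets.Basic) (auto simp: words_def)
  have cyl_measure: "measure P (cyl v k w) = Re (trace (kraus_word L w ** \<rho> k ** cadj (kraus_word L w)))"
    if "k \<in> V" "w \<in> words v n" for k w
    using law[of k w] that by (metis (no_types, lifting) Re_complex_of_real mem_Collect_eq words_def)
  define Ev where "Ev w = (\<Union>k\<in>V. cyl v k w)" for w
  have Ev_sets: "Ev w \<in> sets P" if "w \<in> words v n" for w
    unfolding Ev_def using countable_V cyl_sets that by (intro sets.countable_UN') auto
  have Ev_iff: "\<omega> \<in> Ev w \<longleftrightarrow> \<omega> \<in> space P \<and> map (snd \<omega>) [0..<n] = w" if "w \<in> words v n" for w \<omega>
    using that by (cases \<omega>) (auto simp: Ev_def cyl_def space traj_def words_def list_eq_iff_nth_eq)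
  have prefix: "map (snd \<omega>) [0..<n] \<in> words v n" if "\<omega> \<in> space P" for \<omega>
    using that by (cases \<omega>) (auto simp: space traj_def words_def)
  have Ev_measure: "measure P (Ev w) = Re (trace (kraus_word L w ** rho_bar ** cadj (kraus_word L w)))"
    if w: "w \<in> words v n" for w
  proof (rule has_sum_unique)
    have "((\<lambda>k. measure P (cyl v k w)) has_sum measure P (Ev w)) V"
      unfolding Ev_def using cyl_sets w
      by (intro has_sum_measure_UN finite_measure_axioms countable_V) (auto simp: disjoint_family_on_def cyl_def)
    then show "((\<lambda>k. Re (trace (kraus_word L w ** \<rho> k ** cadj (kraus_word L w)))) has_sum measure P (Ev w)) V"
      using cyl_measure[OF _ w] by (subst has_sum_cong[where g = "\<lambda>k. measure P (cyl v k w)"]) auto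
    show "((\<lambda>k. Re (trace (kraus_word L w ** \<rho> k ** cadj (kraus_word L w))))
        has_sum Re (trace (kraus_word L w ** rho_bar ** cadj (kraus_word L w)))) V"
      by (intro has_sum_Re has_sum_linear_rho bounded_linear_compose[OF bounded_linear_trace]
          bounded_linear_compose[OF bounded_linear_matrix_mult_right] bounded_linear_matrix_mult_left)
  qed
  define g where "g \<omega> = (pos s n \<omega> - pos s 0 \<omega>) /\<^sub>R real n" for \<omega>
  have g_eq: "g \<omega> = mean s n (map (snd \<omega>) [0..<n])" for \<omega>
    unfolding g_def pos_eq by (simp add: mean_def)
  have preimage: "g -` B' \<inter> space P = (\<Union>w\<in>{w\<in>words v n. mean s n w \<in> B'}. Ev w)" for B'
    using prefix by (auto simp: g_eq Ev_iff)
  have fin: "finite {w\<in>words v n. mean s n w \<in> B'}" for B' by (simp add: finite_words)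
  \<comment> \<open>\<open>g\<close> takes finitely many values, so the preimage of any set is a
    finite union of events.\<close>
  have "g \<in> measurable P borel"
  proof (rule measurableI)
    show "g -` B' \<inter> space P \<in> sets P" for B'
      unfolding preimage using fin Ev_sets by (intro sets.finite_UN) auto
  qed simp
  then have "measure (mean_law s P n) B = measure P (g -` B \<inter> space P)"
    unfolding mean_law_def g_def[symmetric] using B by (rule measure_distr)
  also have "\<dots> = (\<Sum>w\<in>{w\<in>words v n. mean s n w \<in> B}. measure P (Ev w))"
    unfolding preimage using fin Ev_sets
    by (intro finite_measure_finite_Union) (auto simp: disjoint_family_on_def Ev_iff)
  also have "\<dots> = (\<Sum>w\<in>{w\<in>words v n. mean s n w \<in> B}. Re (trace (kraus_word L w ** rho_bar ** cadj (kraus_word L w))))"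
    by (intro sum.cong refl Ev_measure) auto
  finally show ?thesis .
qed

end

section \<open>From exponential bounds to the upper and lower limits\<close>

lemma log_ereal_divide_le:
  assumes "n > 0" "x \<le> exp (- real n * a)" shows "log_ereal x / ereal (real n) \<le> - ereal a"
proof (cases "x > 0")
  case True
  then have "ln x \<le> - real n * a" using assms(2) ln_le_cancel_iff[of x "exp (- real n * a)"] by simp
  then show ?thesis using assms(1) True by (simp add: log_ereal_def field_simps)
qed (use assms(1) in \<open>simp add: log_ereal_def\<close>)

lemma log_ereal_divide_ge:
  assumes "n > 0" "exp (- real n * a) \<le> x" shows "- ereal a \<le> log_ereal x / ereal (real n)"
proof -
  have "x > 0" using assms(2) less_le_trans[OF exp_gt_zero] by blast
  moreover from this have "- real n * a \<le> ln x" using assms(2) ln_le_cancel_iff[of "exp (- real n * a)" x] by simp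
  ultimately show ?thesis using assms(1) by (simp add: log_ereal_def field_simps)
qed

theorem theorem5p2:
  fixes V :: "(real ^ 'd) set" and v :: nat and s :: "nat \<Rightarrow> real ^ 'd"
    and L :: "nat \<Rightarrow> complex ^ 'n ^ 'n" and \<rho> :: "real ^ 'd \<Rightarrow> complex ^ 'n ^ 'n"
    and P :: "((real ^ 'd) \<times> (nat \<Rightarrow> nat)) measure"
    and A :: "'a set" and C :: "'a \<Rightarrow> (complex ^ 'n) set"
    and I :: "'a \<Rightarrow> 'b set" and U :: "'a \<Rightarrow> 'b \<Rightarrow> (complex ^ 'n) set"
    and B :: "(real ^ 'd) set"
  assumes "homogeneous_oqrw V v s L"
    and "initial_state V \<rho>"
    and "trajectory_law V v L \<rho> P"
    and "enclosure_decomposition v L A C I U"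
    and "B \<in> sets borel"
  shows "(limsup (\<lambda>n. log_ereal (measure (mean_law s P n) B) / ereal (real n)) \<le>
      - (INF x\<in>closure B.
           Min ((\<lambda>(\<alpha>, \<beta>). rate V v s L \<rho> (U \<alpha> \<beta>) x) `
             {(\<alpha>, \<beta>). \<alpha> \<in> A \<and> \<beta> \<in> I \<alpha> \<and> absorption_weight V v L \<rho> (U \<alpha> \<beta>) \<noteq> 0}))) \<and>
    (liminf (\<lambda>n. log_ereal (measure (mean_law s P n) B) / ereal (real n)) \<ge>
      - Min ((\<lambda>(\<alpha>, \<beta>).
               INF x\<in>interior B \<inter> lower_set V v s L \<rho> (U \<alpha> \<beta>). rate V v s L \<rho> (U \<alpha> \<beta>) x) `
             {(\<alpha>, \<beta>). \<alpha> \<in> A \<and> \<beta> \<in> I \<alpha> \<and> absorption_weight V v L \<rho> (U \<alpha> \<beta>) \<noteq> 0}))"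
proof -
  interpret oqrw V v s L \<rho> using assms(1,2) by unfold_locales
  define J where "J = (SIGMA \<alpha>:A. I \<alpha>)"
  define W where "W = (\<lambda>(\<alpha>, \<beta>). U \<alpha> \<beta>)"
  define J' where "J' = {j\<in>J. absorption_weight V v L \<rho> (W j) \<noteq> 0}"
  have J'_eq: "{(\<alpha>, \<beta>). \<alpha> \<in> A \<and> \<beta> \<in> I \<alpha> \<and> absorption_weight V v L \<rho> (U \<alpha> \<beta>) \<noteq> 0} = J'"
    by (auto simp: J'_def J_def W_def)
  note dec = assms(4)[unfolded enclosure_decomposition_def orth_direct_sum_def]
  have finJ: "finite J" unfolding J_def using dec by (intro finite_SigmaI) auto
  have finJ': "finite J'" using finJ by (simp add: J'_def)
  have encl: "enclosure v L (W j)" if "j \<in> J" for j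
    using that dec by (auto simp: J_def W_def minimal_enclosure_def)
  have W_sub: "W (\<alpha>, \<beta>) \<subseteq> C \<alpha>" if "\<alpha> \<in> A" "\<beta> \<in> I \<alpha>" for \<alpha> \<beta>
    using that dec by (auto simp: W_def intro: vec.span_base)
  have orthW: "orth (W i) (W j)" if "i \<in> J" "j \<in> J" "i \<noteq> j" for i j
  proof -
    obtain \<alpha> \<beta> \<alpha>' \<beta>' where ij: "i = (\<alpha>, \<beta>)" "j = (\<alpha>', \<beta>')" by (metis prod.exhaust)
    show ?thesis
    proof (cases "\<alpha> = \<alpha>'")
      case True
      then show ?thesis using that dec ij by (auto simp: J_def W_def)
    next
      case False
      then have "orth (C \<alpha>) (C \<alpha>')" using that dec ij by (auto simp: J_def)
      moreover have "W i \<subseteq> C \<alpha>" "W j \<subseteq> C \<alpha>'" using W_sub that ij by (auto simp: J_def)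
      ultimately show ?thesis by (auto simp: orth_def)
    qed
  qed
  have rec: "fast_recurrent v L \<subseteq> vec.span (\<Union>j\<in>J. W j)"
  proof -
    have "C \<alpha> \<subseteq> vec.span (\<Union>j\<in>J. W j)" if "\<alpha> \<in> A" for \<alpha>
    proof -
      have "C \<alpha> = vec.span (\<Union>\<beta>\<in>I \<alpha>. U \<alpha> \<beta>)"
        by (rule dec[THEN conjunct2, THEN conjunct2, THEN conjunct1, THEN bspec, OF that,
              THEN conjunct2, THEN conjunct2, THEN conjunct2])
      also have "\<dots> \<subseteq> vec.span (\<Union>j\<in>J. W j)"
        using that by (intro vec.span_mono) (force simp: J_def W_def)
      finally show ?thesis .
    qed
    then have "vec.span (\<Union>\<alpha>\<in>A. C \<alpha>) \<subseteq> vec.span (\<Union>j\<in>J. W j)"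
      by (intro vec.span_minimal vec.subspace_span) auto
    then show ?thesis using dec[THEN conjunct1, THEN conjunct2, THEN conjunct2, THEN conjunct2] by simp
  qed
  have locJ: "oqrw_enclosure V v s L \<rho> (W j)" if "j \<in> J" for j
    using encl[OF that] by unfold_locales
  have locJ': "oqrw_absorbing V v s L \<rho> (W j)" if "j \<in> J'" for j
    using that locJ[of j] by (intro oqrw_absorbing.intro) (auto simp: J'_def oqrw_absorbing_axioms_def)
  define q where "q j w = Re (trace (absorption v L (W j) ** (kraus_word L w ** rho_bar ** cadj (kraus_word L w))))"
    for j w
  define m where "m j n F = (\<Sum>w\<in>{w\<in>words v n. mean s n w \<in> F}. q j w)" for j n F
  define pr where "pr n = measure (mean_law s P n) B" for n
  have q_nonneg: "0 \<le> q j w" if "j \<in> J" for j w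
    using oqrw_enclosure.weight_nonneg[OF locJ[OF that]]
    by (simp add: q_def oqrw_enclosure.weight_def[OF locJ[OF that]])
  have q_0: "q j w = 0" if "j \<in> J - J'" "w \<in> words v n" for j w n
    using oqrw_enclosure.weight_eq_0[OF locJ, of j w n] that
    by (simp add: q_def J'_def oqrw_enclosure.weight_def[OF locJ])
  have pr_eq: "pr n = (\<Sum>j\<in>J'. m j n B)" for n
  proof -
    have "Re (trace (kraus_word L w ** rho_bar ** cadj (kraus_word L w))) = (\<Sum>j\<in>J. q j w)" for w
      using sum_absorption[OF finJ encl orthW rec psd_conj[OF psd_rho_bar]]
      by (simp add: q_def flip: Re_sum)
    then have "pr n = (\<Sum>j\<in>J. m j n B)"
      unfolding pr_def measure_mean_law[OF assms(3,5)] m_def by (simp add: sum.swap[of _ J])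
    also have "\<dots> = (\<Sum>j\<in>J'. m j n B)"
      unfolding m_def by (rule sum.mono_neutral_right[OF finJ]) (auto simp: J'_def intro!: sum.neutral q_0)
    finally show ?thesis .
  qed
  have m_mono: "m j n F \<le> m j n F'" if "j \<in> J'" "F \<subseteq> F'" for j n F F'
    unfolding m_def using that q_nonneg by (intro sum_mono2) (auto simp: finite_words J'_def)
  have m_nonneg: "0 \<le> m j n F" if "j \<in> J'" for j n F
    unfolding m_def using that q_nonneg by (intro sum_nonneg) (auto simp: J'_def)
  have upper: "\<forall>\<^sub>F n in sequentially. m j n F \<le> exp (- real n * a)"
    if "j \<in> J'" "closed F" "\<And>x. x \<in> F \<Longrightarrow> ereal a < rate V v s L \<rho> (W j) x" for j F a
  proof -
    interpret oqrw_absorbing V v s L \<rho> "W j" by (rule locJ'[OF that(1)])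
    show ?thesis using rate_upper[OF that(2,3)] by (simp add: mass_def m_def q_def weight_def)
  qed
  have lower: "\<forall>\<^sub>F n in sequentially. m j n G \<ge> exp (- real n * b)"
    if "j \<in> J'" "open G" "y \<in> G" "y \<in> lower_set V v s L \<rho> (W j)" "rate V v s L \<rho> (W j) y < ereal b" for j G y b
  proof -
    interpret oqrw_absorbing V v s L \<rho> "W j" by (rule locJ'[OF that(1)])
    show ?thesis using rate_lower[OF that(2-5)] by (simp add: mass_def m_def q_def weight_def)
  qed
  \<comment> \<open>The component masses add up to the total mass \<open>1\<close>, so they cannot
    all vanish; this makes both minima range over nonempty sets.\<close>
  have "J' \<noteq> {}"
  proof
    assume "J' = {}"
    then have "absorption_weight V v L \<rho> (W j) = 0" if "j \<in> J" for j
      using that by (cases j) (auto simp: J'_def)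
    then have "trace (absorption v L (W j) ** rho_bar) = 0" if "j \<in> J" for j
      using oqrw_enclosure.absorption_weight_eq[OF locJ[OF that]] that by simp
    then have "trace rho_bar = 0"
      using sum_absorption[OF finJ encl orthW rec psd_rho_bar] by simp
    moreover have "trace rho_bar = 1"
      using has_sum_unique[OF has_sum_linear_rho[OF bounded_linear_trace]] init by (simp add: initial_state_def)
    ultimately show False by simp
  qed
  define h where "h n = log_ereal (pr n) / ereal (real n)" for n
  have sup: "(INF x\<in>closure B. Min ((\<lambda>j. rate V v s L \<rho> (W j) x) ` J')) \<le> - limsup h"
  \<comment> \<open>Approximating from below treats finite and infinite infima alike, including that
    of an empty closure. The second intermediate value \<open>b\<close> leaves a gap
    \<open>b - a\<close>.\<close>
  proof (rule dense_le)
    fix z assume "z < (INF x\<in>closure B. Min ((\<lambda>j. rate V v s L \<rho> (W j) x) ` J'))"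
    then obtain a where a: "z < ereal a" "ereal a < (INF x\<in>closure B. Min ((\<lambda>j. rate V v s L \<rho> (W j) x) ` J'))"
      by (meson ereal_dense2)
    then obtain b where b: "ereal a < ereal b" "ereal b < (INF x\<in>closure B. Min ((\<lambda>j. rate V v s L \<rho> (W j) x) ` J'))"
      by (meson ereal_dense2)
    have "ereal b < rate V v s L \<rho> (W j) x" if "j \<in> J'" "x \<in> closure B" for j x
      using less_INF_D[OF b(2) that(2)] that(1) finJ' by (subst (asm) Min_gr_iff) auto
    then have "\<forall>\<^sub>F n in sequentially. \<forall>j\<in>J'. m j n (closure B) \<le> exp (- real n * b)"
      by (intro eventually_ball_finite finJ' ballI upper) auto
    \<comment> \<open>The gap absorbs the number of components, each of which decays at rate
      \<open>b\<close>.\<close>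
    moreover have "\<forall>\<^sub>F n in sequentially. real (card J') * exp (- real n * (b - a)) \<le> 1"
      using b(1) by (intro scaled_constant_eventually_le_1) simp
    ultimately have "\<forall>\<^sub>F n in sequentially. h n \<le> - ereal a"
      using eventually_gt_at_top[of 0]
    proof eventually_elim
      case (elim n)
      have "pr n \<le> (\<Sum>j\<in>J'. exp (- real n * b))"
        unfolding pr_eq using elim(1) m_mono[OF _ closure_subset] by (intro sum_mono) (meson order_trans)
      also have "\<dots> = (real (card J') * exp (- real n * (b - a))) * exp (- real n * a)"
        by (simp add: algebra_simps flip: exp_add)
      also have "\<dots> \<le> 1 * exp (- real n * a)" by (intro mult_right_mono elim) auto
      finally show ?case unfolding h_def using elim(3) by (intro log_ereal_divide_le) auto
    qed
    then have "limsup h \<le> - ereal a" by (rule Limsup_bounded)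
    then show "z \<le> - limsup h" using a(1) by (metis ereal_uminus_le_reorder ereal_uminus_uminus less_imp_le order_trans)
  qed
  have "- liminf h \<le> (INF x\<in>interior B \<inter> lower_set V v s L \<rho> (W j). rate V v s L \<rho> (W j) x)"
    if j: "j \<in> J'" for j
  \<comment> \<open>A single component already bounds the probability from below, so each
    \<open>j\<close> and each admissible \<open>y\<close> is treated on its own.\<close>
  proof (rule INF_greatest, rule dense_ge)
    fix y z assume y: "y \<in> interior B \<inter> lower_set V v s L \<rho> (W j)" and "rate V v s L \<rho> (W j) y < z"
    then obtain b where b: "rate V v s L \<rho> (W j) y < ereal b" "ereal b < z" by (meson ereal_dense2)
    have "\<forall>\<^sub>F n in sequentially. m j n (interior B) \<ge> exp (- real n * b)"
      using y by (intro lower[OF j open_interior _ _ b(1)]) auto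
    then have "\<forall>\<^sub>F n in sequentially. - ereal b \<le> h n"
      using eventually_gt_at_top[of 0]
    proof eventually_elim
      case (elim n)
      note elim(1)
      also have "m j n (interior B) \<le> m j n B" by (intro m_mono j interior_subset)
      also have "\<dots> \<le> pr n" unfolding pr_eq using j finJ' m_nonneg by (intro member_le_sum) auto
      finally show ?case unfolding h_def using elim(2) by (intro log_ereal_divide_ge) auto
    qed
    then have "- ereal b \<le> liminf h" by (rule Liminf_bounded)
    then show "- liminf h \<le> z" using b(2) by (metis ereal_uminus_le_reorder less_imp_le order_trans)
  qed
  then have inf: "- liminf h \<le> Min ((\<lambda>j. INF x\<in>interior B \<inter> lower_set V v s L \<rho> (W j). rate V v s L \<rho> (W j) x) ` J')"
    using finJ' \<open>J' \<noteq> {}\<close> by (subst Min_ge_iff) auto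
  show ?thesis
    using ereal_minus_le_minus[THEN iffD2, OF sup] inf[unfolded ereal_uminus_le_reorder[of "liminf h"]]
    unfolding J'_eq h_def pr_def W_def by (simp add: case_prod_unfold)
qed

end
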